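(* Suppose $\psi:\mathfrak{sv}^+\to\mathbb{C}$ is identically zero and $\xi\in\mathbb{C}$, $\xi\neq 0$. Let $\bar w=\overline{1\otimes1}\in L_{\psi,\xi}$. For $\zeta\in\mathbb{C}$ and $i\in\mathbb{N}=\{0,1,2,\dots\}$ let $V^i=U(\mathfrak{sv})(L_0-\zeta)^i\bar w\subseteq L_{\psi,\xi}$. Then: (i) For each $\zeta\in\mathbb{C}$, the Whittaker module $L_{\psi,\xi}$ has the filtration $$L_{\psi,\xi}=V^0\supseteq V^1\supseteq\cdots\supseteq V^i\supseteq\cdots,$$ where each $V^i$ is a Whittaker submodule of $L_{\psi,\xi}$ (a submodule that is a Whittaker module of type $\psi$), and $V^{i+1}$ is a maximal submodule of $V^i$. More precisely, $V^i/V^{i+1}$ is isomorphic to the Verma module $V(\xi,\zeta)$. (ii) $L_{\psi,\xi}$ is isomorphic to $V^i$ as $\mathfrak{sv}$-modules for each $i\in\mathbb{N}$.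
   Context: The Schrödinger-Virasoro algebra $\mathfrak{sv}$ is the complex Lie algebra with basis $\{L_n,M_n,Y_{n+\frac12}\mid n\in\mathbb{Z}\}$ and brackets, for $m,n\in\mathbb{Z}$: $[L_m,L_n]=(n-m)L_{m+n}$, $[L_m,M_n]=nM_{m+n}$, $[L_m,Y_{n+\frac12}]=(n+\frac{1-m}{2})Y_{m+n+\frac12}$, $[Y_{m+\frac12},Y_{n+\frac12}]=(n-m)M_{m+n+1}$, $[M_m,M_n]=[M_m,Y_{n+\frac12}]=0$. The element $M_0$ is central. Put $\mathfrak{sv}^+=\mathrm{span}_{\mathbb{C}}\{L_n,M_n,Y_{m+\frac12}\mid n\geq 1,\ m\geq 0\}$. For a Lie algebra homomorphism $\psi:\mathfrak{sv}^+\to\mathbb{C}$, a vector $v$ in an $\mathfrak{sv}$-module is a Whittaker vector (of type $\psi$) if $xv=\psi(x)v$ for all $x\in\mathfrak{sv}^+$, and an $\mathfrak{sv}$-module is a Whittaker module of type $\psi$ if it is generated by a Whittaker vector of type $\psi$. Let $\mathbb{C}_\psi$ be the one-dimensional $\mathfrak{sv}^+$-module with $x\alpha=\psi(x)\alpha$, let $W_\psi=U(\mathfrak{sv})\otimes_{U(\mathfrak{sv}^+)}\mathbb{C}_\psi$, and for $\xi\in\mathbb{C}$ let $L_{\psi,\xi}=W_\psi/(M_0-\xi)W_\psi$; $\overline{1\otimes1}$ denotes the image of $1\otimes1$. For $\psi=0$ and $\zeta\in\mathbb{C}$, the Verma module is $V(\xi,\zeta)=L_{\psi,\xi}/V_\zeta$,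 where $V_\zeta$ is the submodule of $L_{\psi,\xi}$ generated by $(L_0-\zeta)\bar w$. *)

theory Defs
  imports Complex_Main "HOL-Library.Poly_Mapping" "HOL-Algebra.Free_Abelian_Groups"
    "HOL-Algebra.Generated_Groups" "HOL-Algebra.QuotRing" "HOL-Algebra.Module"
begin

section \<open>The Schroedinger-Virasoro algebra\<close>

text \<open>The index \<open>Yix n\<close> stands for the basis vector with half-integral subscript \<open>n + 1/2\<close>.\<close>

datatype sv_index = Lix int | Mix int | Yix int

type_synonym sv = "sv_index \<Rightarrow>\<^sub>0 complex"

definition sv_scale :: "complex \<Rightarrow> sv \<Rightarrow> sv" where
  "sv_scale c x = Poly_Mapping.map (\<lambda>z. c * z) x"

abbreviation sv_L :: "int \<Rightarrow> sv" where "sv_L n \<equiv> Poly_Mapping.single (Lix n) 1"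
abbreviation sv_M :: "int \<Rightarrow> sv" where "sv_M n \<equiv> Poly_Mapping.single (Mix n) 1"
abbreviation sv_Y :: "int \<Rightarrow> sv" where "sv_Y n \<equiv> Poly_Mapping.single (Yix n) 1"

text \<open>The brackets \<open>[M, L]\<close> and \<open>[Y, L]\<close> are those forced by antisymmetry.\<close>

fun sv_basis_bracket :: "sv_index \<Rightarrow> sv_index \<Rightarrow> sv" where
  "sv_basis_bracket (Lix m) (Lix n) = sv_scale (of_int (n - m)) (sv_L (m + n))"
| "sv_basis_bracket (Lix m) (Mix n) = sv_scale (of_int n) (sv_M (m + n))"
| "sv_basis_bracket (Mix m) (Lix n) = - sv_scale (of_int m) (sv_M (n + m))"
| "sv_basis_bracket (Lix m) (Yix n) = sv_scale (of_int n + (1 - of_int m) / 2) (sv_Y (m + n))"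
| "sv_basis_bracket (Yix m) (Lix n) = - sv_scale (of_int m + (1 - of_int n) / 2) (sv_Y (n + m))"
| "sv_basis_bracket (Yix m) (Yix n) = sv_scale (of_int (n - m)) (sv_M (m + n + 1))"
| "sv_basis_bracket (Mix m) (Mix n) = 0"
| "sv_basis_bracket (Mix m) (Yix n) = 0"
| "sv_basis_bracket (Yix m) (Mix n) = 0"

definition sv_bracket :: "sv \<Rightarrow> sv \<Rightarrow> sv" where
  "sv_bracket x y = (\<Sum>a\<in>Poly_Mapping.keys x. \<Sum>b\<in>Poly_Mapping.keys y.
     sv_scale (Poly_Mapping.lookup x a * Poly_Mapping.lookup y b) (sv_basis_bracket a b))"

definition sv_plus :: "sv set" where
  "sv_plus = {x. Poly_Mapping.keys x \<subseteq>
     {Lix n | n. n \<ge> 1} \<union> {Mix n | n. n \<ge> 1} \<union> {Yix m | m. m \<ge> 0}}"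

text \<open>Only the restriction of \<open>\<psi>\<close> to \<open>sv_plus\<close> matters; the bracket of the one-dimensional
  Lie algebra \<open>\<complex>\<close> vanishes.\<close>

definition sv_plus_hom :: "(sv \<Rightarrow> complex) \<Rightarrow> bool" where
  "sv_plus_hom \<psi> \<longleftrightarrow>
     (\<forall>x\<in>sv_plus. \<forall>y\<in>sv_plus. \<psi> (x + y) = \<psi> x + \<psi> y) \<and>
     (\<forall>c. \<forall>x\<in>sv_plus. \<psi> (sv_scale c x) = c * \<psi> x) \<and>
     (\<forall>x\<in>sv_plus. \<forall>y\<in>sv_plus. \<psi> (sv_bracket x y) = 0)"


section \<open>Universal enveloping algebras of Lie subalgebras of sv\<close>

datatype 'a free_word = Word (letters: "'a list")

instantiation free_word :: (type) monoid_add
begin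

definition zero_free_word :: "'a free_word" where "zero_free_word = Word []"

definition plus_free_word :: "'a free_word \<Rightarrow> 'a free_word \<Rightarrow> 'a free_word" where
  "plus_free_word v w = Word (letters v @ letters w)"

instance
  by standard (simp_all add: zero_free_word_def plus_free_word_def)

end

text \<open>Words form a monoid written additively, so the finitely supported functions on words,
  with the convolution product of \<open>poly_mapping\<close>, are the noncommutative polynomials.
  The ring below is the free associative unital algebra on the set \<open>g\<close>.\<close>

type_synonym 'a nc_poly = "'a free_word \<Rightarrow>\<^sub>0 complex"

definition free_alg :: "'a set \<Rightarrow> 'a nc_poly ring" where
  "free_alg g = \<lparr>carrier = {p. \<forall>w\<in>Poly_Mapping.keys p. set (letters w) \<subseteq> g},
     mult = (*), one = 1, zero = 0, add = (+)\<rparr>"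

definition nc_const :: "complex \<Rightarrow> 'a nc_poly" where
  "nc_const c = Poly_Mapping.single 0 c"

definition nc_var :: "'a \<Rightarrow> 'a nc_poly" where
  "nc_var x = Poly_Mapping.single (Word [x]) 1"

text \<open>The first two sets of relations turn the free algebra on the underlying set of \<open>g\<close> into the
  tensor algebra of the vector space \<open>g\<close>; the third one yields the enveloping algebra.\<close>

definition uea_rels :: "sv set \<Rightarrow> sv nc_poly set" where
  "uea_rels g =
     {nc_var (x + y) - nc_var x - nc_var y | x y. x \<in> g \<and> y \<in> g} \<union>
     {nc_var (sv_scale c x) - nc_const c * nc_var x | c x. x \<in> g} \<union>
     {nc_var x * nc_var y - nc_var y * nc_var x - nc_var (sv_bracket x y) | x y. x \<in> g \<and> y \<in> g}"

definition uea_ideal :: "sv set \<Rightarrow> sv nc_poly set" where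
  "uea_ideal g = genideal (free_alg g) (uea_rels g)"

definition uea :: "sv set \<Rightarrow> sv nc_poly set ring" where
  "uea g = free_alg g Quot uea_ideal g"

abbreviation Usv :: "sv nc_poly set ring" where "Usv \<equiv> uea UNIV"

definition Usv_elem :: "sv \<Rightarrow> sv nc_poly set" where
  "Usv_elem x = uea_ideal UNIV +>\<^bsub>free_alg UNIV\<^esub> nc_var x"

definition Usv_const :: "complex \<Rightarrow> sv nc_poly set" where
  "Usv_const c = uea_ideal UNIV +>\<^bsub>free_alg UNIV\<^esub> nc_const c"

text \<open>The ring homomorphism from the enveloping algebra of \<open>sv_plus\<close> to that of \<open>sv\<close> induced by
  the inclusion.\<close>

definition uea_incl :: "sv nc_poly set \<Rightarrow> sv nc_poly set" where
  "uea_incl X = (\<Union>p\<in>X. uea_ideal UNIV +>\<^bsub>free_alg UNIV\<^esub> p)"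


section \<open>Left modules over noncommutative rings\<close>

text \<open>The \<open>module\<close> locale of HOL-Algebra requires a commutative ring; the record, the module axioms and
  \<open>submodule\<close> do not. The fields \<open>mult\<close> and \<open>one\<close> of the record play no role for modules.
  An \<open>sv\<close>-module is a left module over \<open>Usv\<close>; its scalars act through \<open>Usv_const\<close>.\<close>

definition left_module :: "('r, 'x) ring_scheme \<Rightarrow> ('r, 'm, 'y) module_scheme \<Rightarrow> bool" where
  "left_module R M \<longleftrightarrow> ring R \<and> abelian_group M \<and> module_axioms R M"

definition module_iso ::
    "('r, 'x) ring_scheme \<Rightarrow> ('r, 'm) module \<Rightarrow> ('r, 'n) module \<Rightarrow> bool" where
  "module_iso R M N \<longleftrightarrow> (\<exists>f. bij_betw f (carrier M) (carrier N) \<and>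
     (\<forall>x\<in>carrier M. \<forall>y\<in>carrier M. f (x \<oplus>\<^bsub>M\<^esub> y) = f x \<oplus>\<^bsub>N\<^esub> f y) \<and>
     (\<forall>r\<in>carrier R. \<forall>x\<in>carrier M. f (r \<odot>\<^bsub>M\<^esub> x) = r \<odot>\<^bsub>N\<^esub> f x))"

definition gen_submodule ::
    "('r, 'x) ring_scheme \<Rightarrow> ('r, 'm) module \<Rightarrow> 'm set \<Rightarrow> 'm set" where
  "gen_submodule R M S = \<Inter>{N. submodule N R M \<and> S \<subseteq> N}"

definition maximal_submodule ::
    "('r, 'x) ring_scheme \<Rightarrow> ('r, 'm) module \<Rightarrow> 'm set \<Rightarrow> bool" where
  "maximal_submodule R M N \<longleftrightarrow> submodule N R M \<and> N \<noteq> carrier M \<and>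
     (\<forall>K. submodule K R M \<and> N \<subseteq> K \<longrightarrow> K = N \<or> K = carrier M)"

definition quot_module :: "('r, 'm) module \<Rightarrow> 'm set \<Rightarrow> ('r, 'm set) module" where
  "quot_module M N = \<lparr>carrier = a_rcosets\<^bsub>M\<^esub> N, mult = undefined, one = undefined,
     zero = N, add = set_add M, smult = (\<lambda>r X. \<Union>x\<in>X. N +>\<^bsub>M\<^esub> (r \<odot>\<^bsub>M\<^esub> x))\<rparr>"

text \<open>The tensor product over \<open>A\<close> of a bimodule \<open>M\<close> (left action \<open>smult\<close>, right \<open>A\<close>-action \<open>ract\<close>)
  with a left \<open>A\<close>-module \<open>N\<close>, as a quotient of the free abelian group on pairs. The left action
  on \<open>M\<close> makes it a left module.\<close>

definition tensor_rels ::
    "('a, 'x) ring_scheme \<Rightarrow> ('r, 'm) module \<Rightarrow> ('m \<Rightarrow> 'a \<Rightarrow> 'm) \<Rightarrow> ('a, 'n) module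
     \<Rightarrow> ('m \<times> 'n \<Rightarrow>\<^sub>0 int) set" where
  "tensor_rels A M ract N =
     {frag_of (m \<oplus>\<^bsub>M\<^esub> m', n) - frag_of (m, n) - frag_of (m', n) | m m' n.
        m \<in> carrier M \<and> m' \<in> carrier M \<and> n \<in> carrier N} \<union>
     {frag_of (m, n \<oplus>\<^bsub>N\<^esub> n') - frag_of (m, n) - frag_of (m, n') | m n n'.
        m \<in> carrier M \<and> n \<in> carrier N \<and> n' \<in> carrier N} \<union>
     {frag_of (ract m a, n) - frag_of (m, a \<odot>\<^bsub>N\<^esub> n) | m a n.
        m \<in> carrier M \<and> a \<in> carrier A \<and> n \<in> carrier N}"

definition tensor_kernel ::
    "('a, 'x) ring_scheme \<Rightarrow> ('r, 'm) module \<Rightarrow> ('m \<Rightarrow> 'a \<Rightarrow> 'm) \<Rightarrow> ('a, 'n) module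
     \<Rightarrow> ('m \<times> 'n \<Rightarrow>\<^sub>0 int) set" where
  "tensor_kernel A M ract N =
     generate (free_Abelian_group (carrier M \<times> carrier N)) (tensor_rels A M ract N)"

definition tensor_product ::
    "('a, 'x) ring_scheme \<Rightarrow> ('r, 'm) module \<Rightarrow> ('m \<Rightarrow> 'a \<Rightarrow> 'm) \<Rightarrow> ('a, 'n) module
     \<Rightarrow> ('r, ('m \<times> 'n \<Rightarrow>\<^sub>0 int) set) module" where
  "tensor_product A M ract N =
     (let F = free_Abelian_group (carrier M \<times> carrier N); K = tensor_kernel A M ract N in
      \<lparr>carrier = carrier (F Mod K), mult = undefined, one = undefined,
       zero = \<one>\<^bsub>F Mod K\<^esub>, add = mult (F Mod K),
       smult = (\<lambda>r X. \<Union>p\<in>X.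
         K #>\<^bsub>F\<^esub> frag_extend (\<lambda>(m, n). frag_of (r \<odot>\<^bsub>M\<^esub> m, n)) p)\<rparr>)"

definition tensor_elem ::
    "('a, 'x) ring_scheme \<Rightarrow> ('r, 'm) module \<Rightarrow> ('m \<Rightarrow> 'a \<Rightarrow> 'm) \<Rightarrow> ('a, 'n) module
     \<Rightarrow> 'm \<Rightarrow> 'n \<Rightarrow> ('m \<times> 'n \<Rightarrow>\<^sub>0 int) set" where
  "tensor_elem A M ract N m n =
     tensor_kernel A M ract N #>\<^bsub>free_Abelian_group (carrier M \<times> carrier N)\<^esub> frag_of (m, n)"

definition regular_module :: "'r ring \<Rightarrow> ('r, 'r) module" where
  "regular_module R = \<lparr>carrier = carrier R, mult = mult R, one = one R,
     zero = zero R, add = add R, smult = mult R\<rparr>"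


section \<open>Whittaker modules and Verma modules\<close>

definition whittaker_vector ::
    "(sv \<Rightarrow> complex) \<Rightarrow> (sv nc_poly set, 'm) module \<Rightarrow> 'm \<Rightarrow> bool" where
  "whittaker_vector \<psi> V v \<longleftrightarrow> v \<in> carrier V \<and>
     (\<forall>x\<in>sv_plus. Usv_elem x \<odot>\<^bsub>V\<^esub> v = Usv_const (\<psi> x) \<odot>\<^bsub>V\<^esub> v)"

definition whittaker_module ::
    "(sv \<Rightarrow> complex) \<Rightarrow> (sv nc_poly set, 'm) module \<Rightarrow> bool" where
  "whittaker_module \<psi> V \<longleftrightarrow> left_module Usv V \<and>
     (\<exists>v. whittaker_vector \<psi> V v \<and> gen_submodule Usv V {v} = carrier V)"

text \<open>The algebra homomorphism to \<open>\<complex>\<close> from the free algebra extending \<open>\<psi>\<close>. When \<open>\<psi>\<close> is a Lie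
  algebra homomorphism it is constant on each element of \<open>uea sv_plus\<close>, and its value there is
  the scalar by which that element acts on the one-dimensional module.\<close>

definition nc_eval :: "(sv \<Rightarrow> complex) \<Rightarrow> sv nc_poly \<Rightarrow> complex" where
  "nc_eval \<psi> p = (\<Sum>w\<in>Poly_Mapping.keys p. Poly_Mapping.lookup p w * prod_list (map \<psi> (letters w)))"

definition C_mod :: "(sv \<Rightarrow> complex) \<Rightarrow> (sv nc_poly set, complex) module" where
  "C_mod \<psi> = \<lparr>carrier = UNIV, mult = undefined, one = undefined, zero = 0, add = (+),
     smult = (\<lambda>X z. the_elem (nc_eval \<psi> ` X) * z)\<rparr>"

definition Usv_ract :: "sv nc_poly set \<Rightarrow> sv nc_poly set \<Rightarrow> sv nc_poly set" where
  "Usv_ract u a = u \<otimes>\<^bsub>Usv\<^esub> uea_incl a"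

type_synonym W_elem = "(sv nc_poly set \<times> complex \<Rightarrow>\<^sub>0 int) set"

definition W_mod :: "(sv \<Rightarrow> complex) \<Rightarrow> (sv nc_poly set, W_elem) module" where
  "W_mod \<psi> = tensor_product (uea sv_plus) (regular_module Usv) Usv_ract (C_mod \<psi>)"

definition W_gen :: "(sv \<Rightarrow> complex) \<Rightarrow> W_elem" where
  "W_gen \<psi> = tensor_elem (uea sv_plus) (regular_module Usv) Usv_ract (C_mod \<psi>) \<one>\<^bsub>Usv\<^esub> 1"

definition M0_image :: "(sv \<Rightarrow> complex) \<Rightarrow> complex \<Rightarrow> W_elem set" where
  "M0_image \<psi> \<xi> =
     (\<lambda>w. (Usv_elem (sv_M 0) \<ominus>\<^bsub>Usv\<^esub> Usv_const \<xi>) \<odot>\<^bsub>W_mod \<psi>\<^esub> w) ` carrier (W_mod \<psi>)"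

definition L_mod :: "(sv \<Rightarrow> complex) \<Rightarrow> complex \<Rightarrow> (sv nc_poly set, W_elem set) module" where
  "L_mod \<psi> \<xi> = quot_module (W_mod \<psi>) (M0_image \<psi> \<xi>)"

definition L_gen :: "(sv \<Rightarrow> complex) \<Rightarrow> complex \<Rightarrow> W_elem set" where
  "L_gen \<psi> \<xi> = M0_image \<psi> \<xi> +>\<^bsub>W_mod \<psi>\<^esub> W_gen \<psi>"

definition verma :: "complex \<Rightarrow> complex \<Rightarrow> (sv nc_poly set, W_elem set set) module" where
  "verma \<xi> \<zeta> = quot_module (L_mod (\<lambda>_. 0) \<xi>)
     (gen_submodule Usv (L_mod (\<lambda>_. 0) \<xi>)
       {(Usv_elem (sv_L 0) \<ominus>\<^bsub>Usv\<^esub> Usv_const \<zeta>) \<odot>\<^bsub>L_mod (\<lambda>_. 0) \<xi>\<^esub> L_gen (\<lambda>_. 0) \<xi>})"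

definition V_fil :: "(sv \<Rightarrow> complex) \<Rightarrow> complex \<Rightarrow> complex \<Rightarrow> nat \<Rightarrow> W_elem set set" where
  "V_fil \<psi> \<xi> \<zeta> i =
     {u \<odot>\<^bsub>L_mod \<psi> \<xi>\<^esub> (((Usv_elem (sv_L 0) \<ominus>\<^bsub>Usv\<^esub> Usv_const \<zeta>) [^]\<^bsub>Usv\<^esub> i)
        \<odot>\<^bsub>L_mod \<psi> \<xi>\<^esub> L_gen \<psi> \<xi>) | u. u \<in> carrier Usv}"

definition V_mod ::
    "(sv \<Rightarrow> complex) \<Rightarrow> complex \<Rightarrow> complex \<Rightarrow> nat \<Rightarrow> (sv nc_poly set, W_elem set) module" where
  "V_mod \<psi> \<xi> \<zeta> i = (L_mod \<psi> \<xi>)\<lparr>carrier := V_fil \<psi> \<xi> \<zeta> i\<rparr>"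

end

theory Submission
  imports Defs "HOL-Library.Multiset"
begin

text \<open>
Write \<open>U\<close> for the enveloping algebra of \<open>sv\<close>, \<open>h = L\<^sub>0 - \<zeta>\<close>, and \<open>J\<close> for the left ideal of \<open>U\<close> generated
  by \<open>M\<^sub>0 - \<xi>\<close> and by the positive letters \<open>L\<^sub>n\<close>, \<open>M\<^sub>n\<close> with \<open>n \<ge> 1\<close> and \<open>Y\<^bsub>m+1/2\<^esub>\<close> with \<open>m \<ge> 0\<close>.
  Because \<open>\<psi>\<close> vanishes on \<open>sv_plus\<close>, the module \<open>L_mod \<psi> \<xi>\<close> is \<open>U/J\<close>, and all assertions become
  assertions on left ideals: two cyclic modules whose generators have the same annihilator are
  isomorphic (\<open>cyclic_presentation_iso\<close>). Bracketing with \<open>L\<^sub>0\<close> multiplies a letter by a scalar,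
  so \<open>J h \<subseteq> J\<close>, right multiplication by \<open>h\<close> is an endomorphism of \<open>U/J\<close>, and \<open>V\<^sup>i\<close> is the image of
  its \<open>i\<close>-th power. Three facts then give the theorem:

  \<^item> \<open>x h \<in> J\<close> implies \<open>x \<in> J\<close> (\<open>whittaker_ideal_right_cancel\<close>), so the generator of \<open>V\<^sup>i\<close> has the
    annihilator \<open>J\<close> again and \<open>V\<^sup>i\<close> is a copy of \<open>U/J\<close>;

  \<^item> each element outside \<open>J + U h\<close> has a left multiple congruent to \<open>1\<close> modulo \<open>J + U h\<close>
    (\<open>verma_ideal_maximal\<close>);

  \<^item> \<open>1 \<notin> J + U h\<close> (\<open>one_not_in_verma_ideal\<close>).

  The last two say that the Verma module \<open>U/(J + U h)\<close>, which is the quotient of \<open>V\<^sup>i\<close> by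
  \<open>V\<^bsup>i+1\<^esup>\<close>, is simple, for every \<open>\<zeta>\<close>: the brackets of \<open>L\<^bsub>-n\<^esub>\<close> with \<open>M\<^sub>n\<close>, of
  \<open>M\<^bsub>-n\<^esub>\<close> with \<open>L\<^sub>n\<close>, and of \<open>Y\<^bsub>-n-1/2\<^esub>\<close> with \<open>Y\<^bsub>n+1/2\<^esub>\<close> are nonzero multiples of \<open>M\<^sub>0\<close>, which acts as
  \<open>\<xi> \<noteq> 0\<close>, while the weight \<open>\<zeta>\<close> never enters these pairings.

  The first two facts come from one reduction (\<open>reaches_L0_span\<close>). Let \<open>K\<close> be a left ideal
  containing \<open>J\<close> and \<open>x \<notin> K\<close>. Modulo \<open>K\<close>, \<open>U\<close> is spanned by products of negative \<open>L\<close>s, then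
  negative \<open>Y\<close>s, then negative \<open>M\<close>s, then a polynomial in \<open>L\<^sub>0\<close>. Multiplying \<open>x\<close> by suitable
  positive \<open>M\<close>s removes the \<open>L\<close>s, positive \<open>Y\<close>s remove the \<open>Y\<close>s, and positive \<open>L\<close>s remove the \<open>M\<close>s,
  each time without falling into \<open>K\<close>. What is left is a polynomial in \<open>L\<^sub>0\<close> outside \<open>K\<close>. For
  \<open>K = J + U h\<close> it is a nonzero constant modulo \<open>K\<close>, which is maximality. For \<open>K = J\<close> it is some
  \<open>p(L\<^sub>0)\<close>; if \<open>x h \<in> J\<close>, then \<open>p(L\<^sub>0) h\<close> is zero in all Verma modules of parameters \<open>\<xi>\<close>, \<open>t\<close>, so that
  \<open>p(t) = 0\<close> for all \<open>t \<noteq> \<zeta>\<close> and \<open>p = 0\<close>, a contradiction.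

  The third fact asserts that Verma modules are nonzero, and it is here that a part of the
  Poincare-Birkhoff-Witt theorem is needed. A functional on words in the basis of \<open>sv\<close> is defined
  by straightening a word into increasing order, every exchange of neighbours contributing
  their bracket. The result does not depend on the exchanges chosen because of the Jacobi
  identity (\<open>straighten_swap\<close>). An increasing word is sent to the product of the weights of its
  letters, \<open>\<zeta>\<close> for \<open>L\<^sub>0\<close>, \<open>\<xi>\<close> for \<open>M\<^sub>0\<close> and \<open>0\<close> for the others. This functional takes \<open>1\<close> to \<open>1\<close> and
  vanishes on the defining relations of \<open>U\<close> and on \<open>J + U h\<close>.

  It remains to identify the modules defined by tensor products and quotients with \<open>U/J\<close>
  (\<open>W_mod_presentation\<close>, \<open>L_mod_presentation\<close>).
\<close>

section \<open>Left ideals and adjoining letters\<close>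

definition left_ideal :: "'u::ring_1 set \<Rightarrow> bool" where
  "left_ideal K \<longleftrightarrow> 0 \<in> K \<and> (\<forall>x\<in>K. \<forall>y\<in>K. x + y \<in> K) \<and> (\<forall>a. \<forall>x\<in>K. a * x \<in> K)"

lemma left_idealD:
  assumes "left_ideal K"
  shows "0 \<in> K" "x \<in> K \<Longrightarrow> y \<in> K \<Longrightarrow> x + y \<in> K" "x \<in> K \<Longrightarrow> a * x \<in> K"
    "x \<in> K \<Longrightarrow> - x \<in> K" "x \<in> K \<Longrightarrow> y \<in> K \<Longrightarrow> x - y \<in> K"
proof -
  show 0: "0 \<in> K" and add: "\<And>x y. x \<in> K \<Longrightarrow> y \<in> K \<Longrightarrow> x + y \<in> K" and mul: "\<And>a x. x \<in> K \<Longrightarrow> a * x \<in> K"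
    using assms by (auto simp: left_ideal_def)
  show neg: "\<And>x. x \<in> K \<Longrightarrow> - x \<in> K"
    using mul[of _ "-1"] by simp
  show "x \<in> K \<Longrightarrow> y \<in> K \<Longrightarrow> x - y \<in> K"
    using add[of x "- y"] neg[of y] by simp
qed

lemma left_ideal_sum:
  assumes "left_ideal K" "\<And>i. i \<in> I \<Longrightarrow> f i \<in> K"
  shows "sum f I \<in> K"
  using assms(2) by (induction I rule: infinite_finite_induct) (auto intro: left_idealD[OF assms(1)])

lemma left_ideal_cong:
  assumes "left_ideal K" "x - y \<in> K"
  shows "x \<in> K \<longleftrightarrow> y \<in> K"
  by (metis add_diff_cancel_left' assms diff_add_cancel left_idealD(2) left_idealD(5))

lemma left_ideal_trans:
  assumes "left_ideal K" "x - y \<in> K" "y - z \<in> K"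
  shows "x - z \<in> K"
  using left_idealD(2)[OF assms] by simp

text \<open>The span of \<open>V\<close> under left multiplication by words in \<open>G\<close>. All spaces of normally ordered
  products are built with it, one kind of letter at a time.\<close>

inductive_set adjoin :: "'u::ring_1 set \<Rightarrow> 'u set \<Rightarrow> 'u set" for G V where
  adjoin_base: "v \<in> V \<Longrightarrow> v \<in> adjoin G V"
| adjoin_add: "x \<in> adjoin G V \<Longrightarrow> y \<in> adjoin G V \<Longrightarrow> x + y \<in> adjoin G V"
| adjoin_mult: "g \<in> G \<Longrightarrow> x \<in> adjoin G V \<Longrightarrow> g * x \<in> adjoin G V"

text \<open>Adjoining one letter at each step makes every element of a step a polynomial in the last
  letter with coefficients in the previous step, so that letters can be removed one by one.\<close>

primrec chain :: "(nat \<Rightarrow> 'u::ring_1) \<Rightarrow> 'u set \<Rightarrow> nat \<Rightarrow> 'u set" where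
  "chain C V 0 = V"
| "chain C V (Suc k) = adjoin {C k} (chain C V k)"

lemma chain_mono: "j \<le> k \<Longrightarrow> chain C V j \<subseteq> chain C V k"
  by (induction k rule: dec_induct) (auto intro: adjoin_base)

section \<open>Rings with the relations of the Schroedinger-Virasoro algebra\<close>

text \<open>Working with an arbitrary ring in which the commutation relations hold keeps the arguments
  independent of how the enveloping algebra is constructed. The last assumption is the induction principle for words in the letters.\<close>

locale sv_enveloping =
  fixes cst :: "complex \<Rightarrow> 'u::ring_1" and L M Y :: "int \<Rightarrow> 'u"
  assumes cst_add: "cst (a + b) = cst a + cst b"
    and cst_mult: "cst (a * b) = cst a * cst b"
    and cst_1: "cst 1 = 1"
    and cst_central: "x * cst a = cst a * x"
    and LL: "L m * L n = L n * L m + cst (of_int (n - m)) * L (m + n)"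
    and LM: "L m * M n = M n * L m + cst (of_int n) * M (m + n)"
    and LY: "L m * Y n = Y n * L m + cst (of_int n + (1 - of_int m) / 2) * Y (m + n)"
    and YY: "Y m * Y n = Y n * Y m + cst (of_int (n - m)) * M (m + n + 1)"
    and MM: "M m * M n = M n * M m"
    and MY: "M m * Y n = Y n * M m"
    and letters_generate: "\<lbrakk>1 \<in> S; \<And>x y. x \<in> S \<Longrightarrow> y \<in> S \<Longrightarrow> x + y \<in> S; \<And>a x. x \<in> S \<Longrightarrow> cst a * x \<in> S;
        \<And>n x. x \<in> S \<Longrightarrow> L n * x \<in> S; \<And>n x. x \<in> S \<Longrightarrow> M n * x \<in> S; \<And>n x. x \<in> S \<Longrightarrow> Y n * x \<in> S\<rbrakk>
      \<Longrightarrow> x \<in> S"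
begin

lemma cst_0 [simp]: "cst 0 = 0"
  using cst_add[of 0 0] by simp

lemma cst_minus: "cst (- a) = - cst a"
  using minus_unique[of "cst a" "cst (- a)"] cst_add[of a "- a"] by simp

lemma cst_sum: "cst (\<Sum>i\<in>I. f i) = (\<Sum>i\<in>I. cst (f i))"
  by (induction I rule: infinite_finite_induct) (simp_all add: cst_add)

lemma cst_mult_assoc: "x * (cst a * y) = cst a * (x * y)"
  by (metis cst_central mult.assoc)

lemma cst_in_iff:
  assumes "left_ideal K" "a \<noteq> 0"
  shows "cst a * x \<in> K \<longleftrightarrow> x \<in> K"
proof
  assume "cst a * x \<in> K"
  then have "cst (inverse a) * (cst a * x) \<in> K" by (rule left_idealD(3)[OF assms(1)])
  moreover have "cst (inverse a) * (cst a * x) = x"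
    unfolding mult.assoc[symmetric] cst_mult[symmetric] using assms(2) by (simp add: cst_1)
  ultimately show "x \<in> K" by simp
qed (rule left_idealD(3)[OF assms(1)])

lemma LM': "M n * L m = L m * M n + cst (- of_int n) * M (m + n)"
  using LM[of m n] by (simp add: cst_minus)

lemma LY': "Y n * L m = L m * Y n + cst (- (of_int n + (1 - of_int m) / 2)) * Y (m + n)"
  unfolding cst_minus using LY[of m n] by simp

definition subsp :: "'u set \<Rightarrow> bool" where
  "subsp V \<longleftrightarrow> 0 \<in> V \<and> (\<forall>x\<in>V. \<forall>y\<in>V. x + y \<in> V) \<and> (\<forall>a. \<forall>x\<in>V. cst a * x \<in> V)"

lemma subspD:
  assumes "subsp V"
  shows "0 \<in> V" "x \<in> V \<Longrightarrow> y \<in> V \<Longrightarrow> x + y \<in> V" "x \<in> V \<Longrightarrow> cst a * x \<in> V"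
  using assms by (auto simp: subsp_def)

lemma subsp_adjoin:
  assumes "subsp V" shows "subsp (adjoin G V)"
proof -
  have "cst a * x \<in> adjoin G V" if "x \<in> adjoin G V" for a x
    using that
  proof induction
    case (adjoin_base v)
    then show ?case by (intro adjoin.adjoin_base subspD[OF assms])
  next
    case (adjoin_add x y)
    then show ?case by (simp add: distrib_left adjoin.adjoin_add)
  next
    case (adjoin_mult g x)
    then have "g * (cst a * x) \<in> adjoin G V" by (blast intro: adjoin.adjoin_mult)
    then show ?case by (simp only: cst_mult_assoc)
  qed
  then show ?thesis
    using subspD(1)[OF assms] by (auto simp: subsp_def intro: adjoin_base adjoin_add)
qed

lemma subsp_chain: "subsp V \<Longrightarrow> subsp (chain C V k)"
  by (induction k) (auto intro: subsp_adjoin)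

lemma subsp_Union_chain:
  assumes "subsp V" shows "subsp (\<Union>k. chain C V k)"
proof -
  have "x + y \<in> (\<Union>k. chain C V k)" if x: "x \<in> chain C V j" and y: "y \<in> chain C V k" for x y j k
  proof -
    have "x \<in> chain C V (max j k)" "y \<in> chain C V (max j k)"
      using x y chain_mono[of _ "max j k"] by (meson max.cobounded1 max.cobounded2 subsetD)+
    then show ?thesis using subspD(2)[OF subsp_chain[OF assms]] by blast
  qed
  moreover have "0 \<in> (\<Union>k. chain C V k)"
    using subspD(1)[OF subsp_chain[OF assms]] by blast
  moreover have "cst a * x \<in> (\<Union>k. chain C V k)" if "x \<in> chain C V j" for a x j
    using subspD(3)[OF subsp_chain[OF assms] that] by blast
  ultimately show ?thesis by (auto simp: subsp_def)
qed

text \<open>Moving \<open>X\<close> to the right through the adjoined letters only produces elements of \<open>\<X>\<close>, by the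
  hypothesis on commutators, and these finally meet \<open>V\<close>. The next lemma is the same argument
  with a left ideal as the target.\<close>

lemma adjoin_closed:
  assumes V: "subsp V"
    and base: "\<And>X x. X \<in> \<X> \<Longrightarrow> x \<in> V \<Longrightarrow> X * x \<in> adjoin G V"
    and comm: "\<And>X g. X \<in> \<X> \<Longrightarrow> g \<in> G \<Longrightarrow> \<exists>a Z. Z \<in> \<X> \<and> X * g = g * X + cst a * Z"
    and "x \<in> adjoin G V" "X \<in> \<X>"
  shows "X * x \<in> adjoin G V"
  using assms(4,5)
proof (induction arbitrary: X)
  case (adjoin_mult g x)
  obtain a Z where Z: "Z \<in> \<X>" "X * g = g * X + cst a * Z" using comm adjoin_mult by blast
  have "X * (g * x) = g * (X * x) + cst a * (Z * x)"
    by (simp only: mult.assoc[symmetric] Z distrib_right)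
  moreover have "g * (X * x) \<in> adjoin G V" "cst a * (Z * x) \<in> adjoin G V"
    using adjoin_mult Z by (auto intro: adjoin.adjoin_mult subspD(3)[OF subsp_adjoin[OF V]])
  ultimately show ?case by (simp add: adjoin_add)
qed (auto simp: distrib_left intro: base adjoin_add)

lemma adjoin_annihilated:
  assumes K: "left_ideal K"
    and base: "\<And>X x. X \<in> \<X> \<Longrightarrow> x \<in> V \<Longrightarrow> X * x \<in> K"
    and comm: "\<And>X g. X \<in> \<X> \<Longrightarrow> g \<in> G \<Longrightarrow> \<exists>a Z. Z \<in> \<X> \<and> X * g = g * X + cst a * Z"
    and "x \<in> adjoin G V" "X \<in> \<X>"
  shows "X * x \<in> K"
  using assms(4,5)
proof (induction arbitrary: X)
  case (adjoin_mult g x)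
  obtain a Z where Z: "Z \<in> \<X>" "X * g = g * X + cst a * Z" using comm adjoin_mult by blast
  have "X * (g * x) = g * (X * x) + cst a * (Z * x)"
    by (simp only: mult.assoc[symmetric] Z distrib_right)
  moreover have "g * (X * x) \<in> K" "cst a * (Z * x) \<in> K"
    using adjoin_mult Z by (auto intro: left_idealD(3)[OF K])
  ultimately show ?case by (simp add: left_idealD(2)[OF K])
qed (auto simp: distrib_left intro: base left_idealD[OF K])

text \<open>The set \<open>\<X>\<close> may grow along the chain: the letter adjoined at a step is a new multiplier
  that becomes available from that step on.\<close>

lemma chain_closed:
  assumes V: "subsp V"
    and base: "\<And>X x. X \<in> \<X> 0 \<Longrightarrow> x \<in> V \<Longrightarrow> X * x \<in> V"
    and step: "\<And>k. \<X> (Suc k) \<subseteq> insert (C k) (\<X> k)"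
    and comm: "\<And>k X. X \<in> \<X> (Suc k) \<Longrightarrow> \<exists>a Z. Z \<in> \<X> (Suc k) \<and> X * C k = C k * X + cst a * Z"
    and "X \<in> \<X> k" "x \<in> chain C V k"
  shows "X * x \<in> chain C V k"
  using assms(5,6)
proof (induction k arbitrary: X x)
  case (Suc k)
  have "X * x \<in> adjoin {C k} (chain C V k)"
  proof (rule adjoin_closed[where \<X> = "\<X> (Suc k)"])
    fix X x assume "X \<in> \<X> (Suc k)" "x \<in> chain C V k"
    then show "X * x \<in> adjoin {C k} (chain C V k)"
      using step[of k] Suc.IH by (cases "X = C k") (auto intro: adjoin_base adjoin_mult)
  qed (use Suc.prems V comm in \<open>auto intro: subsp_chain\<close>)
  then show ?case by simp
qed (use base in simp)

lemma Union_chain_closed: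
  assumes V: "subsp V"
    and base: "\<And>X x. X \<in> \<X> 0 \<Longrightarrow> x \<in> V \<Longrightarrow> X * x \<in> V"
    and step: "\<And>k. \<X> (Suc k) \<subseteq> insert (C k) (\<X> k)"
    and comm: "\<And>k X. X \<in> \<X> (Suc k) \<Longrightarrow> \<exists>a Z. Z \<in> \<X> (Suc k) \<and> X * C k = C k * X + cst a * Z"
    and mono: "\<And>j k. j \<le> k \<Longrightarrow> \<X> j \<subseteq> \<X> k"
    and X: "X \<in> (\<Union>k. \<X> k)" and x: "x \<in> (\<Union>k. chain C V k)"
  shows "X * x \<in> (\<Union>k. chain C V k)"
proof -
  obtain j k where "X \<in> \<X> j" "x \<in> chain C V k" using X x by blast
  then have Xm: "X \<in> \<X> (max j k)" and xm: "x \<in> chain C V (max j k)"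
    using mono[of j "max j k"] chain_mono[of k "max j k"] by auto
  have "X * x \<in> chain C V (max j k)"
    by (rule chain_closed[where \<X> = \<X> and C = C]) (fact V base step comm Xm xm)+
  then show ?thesis by blast
qed

text \<open>Here \<open>\<X>\<close> may shrink along the chain: a letter of a given degree annihilates only those words
  whose letters are too short to bring it down to degree zero.\<close>

lemma chain_annihilated:
  assumes K: "left_ideal K"
    and base: "\<And>X x. X \<in> \<X> 0 \<Longrightarrow> x \<in> V \<Longrightarrow> X * x \<in> K"
    and step: "\<And>k. \<X> (Suc k) \<subseteq> \<X> k"
    and comm: "\<And>k X. X \<in> \<X> (Suc k) \<Longrightarrow> \<exists>a Z. Z \<in> \<X> (Suc k) \<and> X * C k = C k * X + cst a * Z"
    and "X \<in> \<X> k" "x \<in> chain C V k"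
  shows "X * x \<in> K"
  using assms(5,6)
proof (induction k arbitrary: X x)
  case (Suc k)
  show ?case
  proof (rule adjoin_annihilated[OF K, where \<X> = "\<X> (Suc k)"])
    fix X x assume "X \<in> \<X> (Suc k)" "x \<in> chain C V k"
    then show "X * x \<in> K" using step[of k] by (intro Suc.IH) blast
  qed (use Suc.prems comm in auto)
qed (use base in simp)

lemma adjoin_single_power_sum:
  assumes V: "subsp V" and "x \<in> adjoin {c} V"
  shows "\<exists>n f. (\<forall>i. f i \<in> V) \<and> x = (\<Sum>i\<le>n. c ^ i * f i)"
  using assms(2)
proof induction
  case (adjoin_base v)
  then show ?case by (intro exI[of _ 0] exI[of _ "\<lambda>_. v"]) simp
next
  case (adjoin_add x y)
  then obtain n f m g where f: "\<forall>i. f i \<in> V" "x = (\<Sum>i\<le>n. c ^ i * f i)"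
    and g: "\<forall>i. g i \<in> V" "y = (\<Sum>i\<le>m. c ^ i * g i)" by blast
  let ?N = "max n m"
  let ?h = "\<lambda>i. (if i \<le> n then f i else 0) + (if i \<le> m then g i else 0)"
  have "x = (\<Sum>i\<le>?N. c ^ i * (if i \<le> n then f i else 0))"
    unfolding f by (rule sum.mono_neutral_cong_left) auto
  moreover have "y = (\<Sum>i\<le>?N. c ^ i * (if i \<le> m then g i else 0))"
    unfolding g by (rule sum.mono_neutral_cong_left) auto
  ultimately have "x + y = (\<Sum>i\<le>?N. c ^ i * ?h i)"
    by (simp add: distrib_left sum.distrib)
  moreover have "\<forall>i. ?h i \<in> V"
    using f g by (auto intro!: subspD[OF V])
  ultimately show ?case by (intro exI[of _ ?N] exI[of _ ?h] conjI)
next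
  case (adjoin_mult g x)
  then obtain n f where f: "\<forall>i. f i \<in> V" "x = (\<Sum>i\<le>n. c ^ i * f i)" by blast
  let ?h = "\<lambda>i. if i = 0 then 0 else f (i - 1)"
  have "g * x = (\<Sum>i\<le>Suc n. c ^ i * ?h i)"
    using adjoin_mult(1) unfolding f sum.atMost_Suc_shift by (simp add: sum_distrib_left mult.assoc)
  moreover have "\<forall>i. ?h i \<in> V"
    using f by (auto intro!: subspD[OF V])
  ultimately show ?case by (intro exI[of _ "Suc n"] exI[of _ ?h] conjI)
qed

text \<open>If \<open>d\<close> annihilates the coefficients and \<open>[d, c] = \<kappa>\<close>, then \<open>d\<close> acts on polynomials in \<open>c\<close> as
  \<open>\<kappa>\<close> times the derivative, so its \<open>n\<close>-th power picks the leading coefficient.\<close>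

lemma ladder:
  assumes K: "left_ideal K"
    and ann: "\<And>x. x \<in> V \<Longrightarrow> d * x \<in> K"
    and comm: "\<And>x. d * (c * x) - c * (d * x) - cst \<kappa> * x \<in> K"
    and f: "\<And>i. f i \<in> V" and V: "subsp V"
  shows "d ^ n * (\<Sum>i\<le>n. c ^ i * f i) - cst (fact n * \<kappa> ^ n) * f n \<in> K"
  using f
proof (induction n arbitrary: f)
  case 0
  then show ?case by (simp add: cst_1 left_idealD(1)[OF K])
next
  case (Suc n)
  have pow: "d * (c ^ i * x) - c ^ i * (d * x) - cst (of_nat i * \<kappa>) * (c ^ (i - 1) * x) \<in> K" for i x
  proof (induction i)
    case 0
    then show ?case by (simp add: left_idealD(1)[OF K])
  next
    case (Suc i)
    have lower: "c * (cst (of_nat i * \<kappa>) * (c ^ (i - 1) * x)) = cst (of_nat i * \<kappa>) * (c ^ i * x)"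
      by (cases i) (simp_all add: cst_mult_assoc mult.assoc)
    have "cst (of_nat (Suc i) * \<kappa>) = cst \<kappa> + cst (of_nat i * \<kappa>)"
      by (simp add: cst_add[symmetric] algebra_simps)
    then have "d * (c ^ Suc i * x) - c ^ Suc i * (d * x) - cst (of_nat (Suc i) * \<kappa>) * (c ^ i * x)
      = (d * (c * (c ^ i * x)) - c * (d * (c ^ i * x)) - cst \<kappa> * (c ^ i * x))
        + c * (d * (c ^ i * x) - c ^ i * (d * x) - cst (of_nat i * \<kappa>) * (c ^ (i - 1) * x))"
      unfolding right_diff_distrib lower by (simp add: distrib_right mult.assoc)
    then show ?case using comm[of "c ^ i * x"] Suc left_idealD[OF K] by simp
  qed
  let ?g = "\<lambda>i. cst (of_nat (Suc i) * \<kappa>) * f (Suc i)"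
  have "d * (c ^ i * f i) - cst (of_nat i * \<kappa>) * (c ^ (i - 1) * f i) \<in> K" for i
    using left_idealD(2)[OF K pow[of i "f i"] left_idealD(3)[OF K ann[OF Suc.prems[of i]], of "c ^ i"]]
    by simp
  then have "(\<Sum>i\<le>Suc n. d * (c ^ i * f i) - cst (of_nat i * \<kappa>) * (c ^ (i - 1) * f i)) \<in> K"
    by (intro left_ideal_sum[OF K])
  also have "(\<Sum>i\<le>Suc n. d * (c ^ i * f i) - cst (of_nat i * \<kappa>) * (c ^ (i - 1) * f i))
      = d * (\<Sum>i\<le>Suc n. c ^ i * f i) - (\<Sum>i\<le>Suc n. cst (of_nat i * \<kappa>) * (c ^ (i - 1) * f i))"
    by (simp only: sum_subtractf sum_distrib_left)
  also have "(\<Sum>i\<le>Suc n. cst (of_nat i * \<kappa>) * (c ^ (i - 1) * f i)) = (\<Sum>i\<le>n. c ^ i * ?g i)"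
    unfolding sum.atMost_Suc_shift by (simp add: cst_mult_assoc)
  finally have step: "d * (\<Sum>i\<le>Suc n. c ^ i * f i) - (\<Sum>i\<le>n. c ^ i * ?g i) \<in> K" .
  have "d ^ n * (\<Sum>i\<le>n. c ^ i * ?g i) - cst (fact n * \<kappa> ^ n) * ?g n \<in> K"
    by (rule Suc.IH) (intro subspD[OF V] Suc.prems)
  moreover have "d ^ n * (d * (\<Sum>i\<le>Suc n. c ^ i * f i) - (\<Sum>i\<le>n. c ^ i * ?g i)) \<in> K"
    by (intro left_idealD[OF K] step)
  ultimately have "d ^ n * (d * (\<Sum>i\<le>Suc n. c ^ i * f i)) - cst (fact n * \<kappa> ^ n) * ?g n \<in> K"
    using left_idealD(2)[OF K] by (fastforce simp: right_diff_distrib)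
  moreover have "d ^ n * (d * (\<Sum>i\<le>Suc n. c ^ i * f i)) = d ^ Suc n * (\<Sum>i\<le>Suc n. c ^ i * f i)"
    by (simp only: power_Suc2 mult.assoc)
  moreover have "cst (fact n * \<kappa> ^ n) * ?g n = cst (fact (Suc n) * \<kappa> ^ Suc n) * f (Suc n)"
    unfolding mult.assoc[symmetric] cst_mult[symmetric] by (simp add: algebra_simps)
  ultimately show ?case by simp
qed

text \<open>The elements \<open>x\<close> for which some left multiple lies in \<open>V\<close> modulo \<open>K\<close> without vanishing
  modulo \<open>K\<close>.\<close>

definition reaches :: "'u set \<Rightarrow> 'u \<Rightarrow> 'u set \<Rightarrow> bool" where
  "reaches K x V \<longleftrightarrow> (\<exists>q. \<exists>v\<in>V. v \<notin> K \<and> q * x - v \<in> K)"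

lemma reaches_trans:
  assumes K: "left_ideal K" and "reaches K x V" and "\<And>v. v \<in> V \<Longrightarrow> v \<notin> K \<Longrightarrow> reaches K v W"
  shows "reaches K x W"
proof -
  obtain q v where v: "v \<in> V" "v \<notin> K" "q * x - v \<in> K" using assms by (auto simp: reaches_def)
  then obtain q' w where w: "w \<in> W" "w \<notin> K" "q' * v - w \<in> K"
    using assms(3) unfolding reaches_def by blast
  have "q' * (q * x - v) \<in> K" by (intro left_idealD(3)[OF K] v)
  then have "(q' * q) * x - w \<in> K"
    using left_idealD(2)[OF K _ w(3)] by (fastforce simp: right_diff_distrib mult.assoc)
  then show ?thesis using w by (auto simp: reaches_def)
qed

text \<open>Discard the leading coefficients that lie in \<open>K\<close>; the first one outside \<open>K\<close> is isolated by a
  power of \<open>d\<close>.\<close>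

lemma reaches_adjoin:
  assumes K: "left_ideal K" and V: "subsp V"
    and ann: "\<And>x. x \<in> V \<Longrightarrow> d * x \<in> K"
    and comm: "\<And>x. d * (c * x) - c * (d * x) - cst \<kappa> * x \<in> K" and \<kappa>: "\<kappa> \<noteq> 0"
    and x: "x \<in> adjoin {c} V" "x \<notin> K"
  shows "reaches K x V"
proof -
  obtain n f where f: "\<forall>i. f i \<in> V" and xs: "x = (\<Sum>i\<le>n. c ^ i * f i)"
    using adjoin_single_power_sum[OF V x(1)] by blast
  have "reaches K (\<Sum>i\<le>n. c ^ i * f i) V" if "(\<Sum>i\<le>n. c ^ i * f i) \<notin> K" for n
    using that
  proof (induction n)
    case 0
    then show ?case
      using f left_idealD(1)[OF K] by (auto simp: reaches_def intro!: exI[of _ 1] bexI[of _ "f 0"])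
  next
    case (Suc n)
    show ?case
    proof (cases "f (Suc n) \<in> K")
      case True
      then have top: "c ^ Suc n * f (Suc n) \<in> K" by (intro left_idealD(3)[OF K])
      have "reaches K (\<Sum>i\<le>n. c ^ i * f i) V"
        using Suc.prems left_idealD(2)[OF K _ top] by (intro Suc.IH) (auto simp: sum.atMost_Suc)
      then obtain q v where v: "v \<in> V" "v \<notin> K" "q * (\<Sum>i\<le>n. c ^ i * f i) - v \<in> K"
        by (auto simp: reaches_def)
      have "q * (\<Sum>i\<le>Suc n. c ^ i * f i) - v \<in> K"
        using left_idealD(2)[OF K v(3) left_idealD(3)[OF K top, of q]]
        by (simp add: distrib_left algebra_simps)
      then show ?thesis using v by (auto simp: reaches_def)
    next
      case False
      have "d ^ Suc n * (\<Sum>i\<le>Suc n. c ^ i * f i) - cst (fact (Suc n) * \<kappa> ^ Suc n) * f (Suc n) \<in> K"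
        using f by (intro ladder[OF K ann comm _ V]) auto
      moreover have "cst (fact (Suc n) * \<kappa> ^ Suc n) * f (Suc n) \<notin> K"
        using False cst_in_iff[OF K, of "fact (Suc n) * \<kappa> ^ Suc n"] \<kappa>
        by (simp del: fact_Suc power_Suc)
      moreover have "cst (fact (Suc n) * \<kappa> ^ Suc n) * f (Suc n) \<in> V"
        using f by (intro subspD[OF V]) auto
      ultimately show ?thesis unfolding reaches_def by blast
    qed
  qed
  then show ?thesis using x xs by simp
qed

lemma reaches_chain:
  assumes K: "left_ideal K" and V: "subsp V"
    and ann: "\<And>k x. x \<in> chain C V k \<Longrightarrow> D k * x \<in> K"
    and comm: "\<And>k x. D k * (C k * x) - C k * (D k * x) - cst (\<kappa> k) * x \<in> K" and \<kappa>: "\<And>k. \<kappa> k \<noteq> 0"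
    and x: "x \<in> chain C V k" "x \<notin> K"
  shows "reaches K x V"
  using x
proof (induction k arbitrary: x)
  case 0
  then show ?case
    using left_idealD(1)[OF K] by (auto simp: reaches_def intro!: exI[of _ 1] bexI[of _ x])
next
  case (Suc k)
  have "reaches K x (chain C V k)"
    by (rule reaches_adjoin[OF K subsp_chain[OF V] ann comm \<kappa>]) (use Suc.prems in auto)
  then show ?case by (rule reaches_trans[OF K]) (rule Suc.IH)
qed


section \<open>Pairing words in negative L with words in positive M\<close>

definition L_word :: "nat list \<Rightarrow> 'u" where "L_word ls = prod_list (map (\<lambda>l. L (- int l)) ls)"

definition M_word :: "nat list \<Rightarrow> 'u" where "M_word ms = prod_list (map (\<lambda>m. M (int m)) ms)"

lemma L_word_simps [simp]: "L_word [] = 1" "L_word (l # ls) = L (- int l) * L_word ls"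
  by (simp_all add: L_word_def)

lemma M_word_simps [simp]: "M_word [] = 1" "M_word (m # ms) = M (int m) * M_word ms"
  by (simp_all add: M_word_def)

definition remove_nth :: "nat \<Rightarrow> 'b list \<Rightarrow> 'b list" where
  "remove_nth i xs = take i xs @ drop (Suc i) xs"

lemma remove_nth_simps [simp]:
  "remove_nth 0 (x # xs) = xs" "remove_nth (Suc i) (x # xs) = x # remove_nth i xs"
  by (simp_all add: remove_nth_def)

lemma length_remove_nth: "i < length xs \<Longrightarrow> length (remove_nth i xs) = length xs - 1"
  by (simp add: remove_nth_def)

lemma mset_remove_nth: "i < length xs \<Longrightarrow> add_mset (xs ! i) (mset (remove_nth i xs)) = mset xs"
  by (metis id_take_nth_drop mset.simps(2) mset_append remove_nth_def union_mset_add_mset_right)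

lemma M_left_commute: "M m * (M n * x) = M n * (M m * x)"
  unfolding mult.assoc[symmetric] MM[of m n] ..

text \<open>Each \<open>M\<close> in the word contributes its commutator with \<open>L\<close>, which is again an \<open>M\<close> and commutes
  with the others; hence the formula is exact, with no terms of lower order.\<close>

lemma M_word_L:
  "M_word ms * L k = L k * M_word ms
     + (\<Sum>i<length ms. cst (- of_nat (ms ! i)) * (M (int (ms ! i) + k) * M_word (remove_nth i ms)))"
proof (induction ms)
  case Nil
  then show ?case by simp
next
  case (Cons m ms)
  let ?t = "\<lambda>i. cst (- of_nat (ms ! i)) * (M (int (ms ! i) + k) * M_word (remove_nth i ms))"
  have "M (int m) * ?t i = cst (- of_nat (ms ! i)) * (M (int (ms ! i) + k) * (M (int m) * M_word (remove_nth i ms)))" for i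
    by (simp only: cst_mult_assoc M_left_commute[of "int m" "int (ms ! i) + k"])
  moreover have "M_word (m # ms) * L k = M (int m) * (L k * M_word ms) + M (int m) * (\<Sum>i<length ms. ?t i)"
    by (simp only: M_word_simps mult.assoc Cons.IH distrib_left)
  moreover have "M (int m) * (L k * M_word ms)
      = L k * (M (int m) * M_word ms) + cst (- of_nat m) * (M (int m + k) * M_word ms)"
    unfolding mult.assoc[symmetric] LM'[of "int m" k] by (simp add: distrib_right add.commute mult.assoc)
  ultimately show ?case
    by (simp add: sum_distrib_left add.assoc sum.lessThan_Suc_shift del: sum.lessThan_Suc)
qed

lemma M_zero_central: "M 0 * x = x * M 0"
proof -
  have "x \<in> {x. M 0 * x = x * M 0}"
  proof (rule letters_generate)
    fix n x
    assume "x \<in> {x. M 0 * x = x * M 0}"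
    then have x: "M 0 * x = x * M 0" by simp
    have *: "g * x \<in> {x. M 0 * x = x * M 0}" if g: "M 0 * g = g * M 0" for g
    proof -
      have "M 0 * (g * x) = g * (M 0 * x)" by (simp only: mult.assoc[symmetric] g)
      then show ?thesis by (simp only: x mult.assoc mem_Collect_eq)
    qed
    show "L n * x \<in> {x. M 0 * x = x * M 0}" by (rule *) (use LM[of n 0] in simp)
    show "M n * x \<in> {x. M 0 * x = x * M 0}" by (rule *) (rule MM)
    show "Y n * x \<in> {x. M 0 * x = x * M 0}" by (rule *) (rule MY)
  next
    fix a x
    assume "x \<in> {x. M 0 * x = x * M 0}"
    then show "cst a * x \<in> {x. M 0 * x = x * M 0}"
      by (simp add: cst_mult_assoc mult.assoc)
  qed (auto simp: distrib_left distrib_right)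
  then show ?thesis by simp
qed

end

text \<open>A left ideal \<open>K\<close> that contains the relations of a highest weight vector with central value
  \<open>\<xi>\<close>. Both the annihilator of the Whittaker generator and that of the highest weight vector of a
  Verma module are of this kind.\<close>

locale sv_left_ideal = sv_enveloping cst L M Y
  for cst :: "complex \<Rightarrow> 'u::ring_1" and L M Y :: "int \<Rightarrow> 'u" +
  fixes K :: "'u set" and \<xi> :: complex
  assumes K: "left_ideal K"
    and L_pos: "\<And>n. n \<ge> 1 \<Longrightarrow> L n \<in> K" and M_pos: "\<And>n. n \<ge> 1 \<Longrightarrow> M n \<in> K"
    and Y_pos: "\<And>n. n \<ge> 0 \<Longrightarrow> Y n \<in> K"
    and M_zero: "M 0 - cst \<xi> \<in> K" and \<xi>: "\<xi> \<noteq> 0"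
begin

lemma M_zero_acts: "M 0 * x - cst \<xi> * x \<in> K"
proof -
  have "M 0 * x - cst \<xi> * x = x * (M 0 - cst \<xi>)"
    unfolding right_diff_distrib M_zero_central[of x] cst_central[of x] ..
  then show ?thesis using left_idealD(3)[OF K M_zero] by simp
qed

text \<open>The form in which the nonvanishing of \<open>\<xi>\<close> is used: two letters whose bracket is a multiple of
  \<open>M\<^sub>0\<close> satisfy the Heisenberg relation modulo \<open>K\<close>.\<close>

lemma commutator_M_zero:
  assumes "d * c = c * d + cst a * M 0"
  shows "d * (c * x) - c * (d * x) - cst (a * \<xi>) * x \<in> K"
proof -
  have "d * (c * x) - c * (d * x) - cst (a * \<xi>) * x = cst a * (M 0 * x - cst \<xi> * x)"
    unfolding mult.assoc[symmetric] assms cst_mult by (simp add: distrib_right right_diff_distrib mult.assoc)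
  then show ?thesis using left_idealD(3)[OF K M_zero_acts] by simp
qed

lemma M_word_commute: "M_word ms * M m = M m * M_word ms"
proof (induction ms)
  case (Cons k ms)
  have "M_word (k # ms) * M m = M (int k) * (M_word ms * M m)" by (simp add: mult.assoc)
  also have "\<dots> = M (int k) * (M m * M_word ms)" by (simp only: Cons.IH)
  also have "\<dots> = M m * M_word (k # ms)" by (simp only: M_left_commute[of "int k"] M_word_simps)
  finally show ?case .
qed simp

text \<open>Every commutator of an \<open>M\<close> with an \<open>L\<close> consumes the \<open>L\<close> and leaves one \<open>M\<close>. With more \<open>M\<close>s than
  \<open>L\<close>s, some unused \<open>M\<close> of positive degree arrives at \<open>z\<close>.\<close>

lemma M_word_L_word_shorter:
  assumes z: "\<And>n. n \<ge> 1 \<Longrightarrow> M n * z \<in> K" and "0 \<notin> set ms"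
    and "length ls < length ms"
  shows "M_word ms * (L_word ls * z) \<in> K"
  using assms(2,3)
proof (induction ls arbitrary: ms)
  case Nil
  obtain m ms' where ms: "ms = m # ms'" using Nil by (cases ms) auto
  have "M_word ms * z = M_word ms' * (M (int m) * z)"
    unfolding ms M_word_simps by (simp only: mult.assoc[symmetric] M_word_commute)
  moreover have "M (int m) * z \<in> K" using z Nil ms by simp
  ultimately show ?case using left_idealD(3)[OF K] by simp
next
  case (Cons l ls)
  have "M_word ms * (L_word (l # ls) * z) = (M_word ms * L (- int l)) * (L_word ls * z)"
    by (simp add: mult.assoc)
  also have "\<dots> = L (- int l) * (M_word ms * (L_word ls * z)) +
    (\<Sum>i<length ms. cst (- of_nat (ms ! i)) * (M (int (ms ! i) - int l) * (M_word (remove_nth i ms) * (L_word ls * z))))"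
    unfolding M_word_L by (simp add: distrib_right mult.assoc sum_distrib_right)
  also have "\<dots> \<in> K"
  proof (rule left_idealD(2)[OF K])
    show "L (- int l) * (M_word ms * (L_word ls * z)) \<in> K"
      by (rule left_idealD(3)[OF K], rule Cons.IH) (use Cons.prems in auto)
    have "M_word (remove_nth i ms) * (L_word ls * z) \<in> K" if "i < length ms" for i
      by (rule Cons.IH)
        (use Cons.prems that in \<open>auto simp: length_remove_nth remove_nth_def dest: in_set_takeD in_set_dropD\<close>)
    then show "(\<Sum>i<length ms. cst (- of_nat (ms ! i)) * (M (int (ms ! i) - int l) * (M_word (remove_nth i ms) * (L_word ls * z)))) \<in> K"
      by (intro left_ideal_sum[OF K] left_idealD(3)[OF K, of _ "cst a" for a] left_idealD(3)[OF K, of _ "M n" for n]) simp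
  qed
  finally show ?case .
qed

text \<open>With as many \<open>M\<close>s as \<open>L\<close>s, a nonzero contribution has to match them bijectively. A pair whose
  \<open>M\<close> has the larger degree leaves a positive \<open>M\<close>, which kills the term; since the total degree of
  the \<open>M\<close>s is not smaller, all pairs have equal degrees and produce \<open>M\<^sub>0\<close>. So \<open>N\<close> counts the
  degree-preserving matchings.\<close>

lemma M_word_L_word:
  assumes z: "\<And>n. n \<ge> 1 \<Longrightarrow> M n * z \<in> K" and "0 \<notin> set ms"
    and "length ms = length ls" and "sum_list ls \<le> sum_list ms"
  shows "\<exists>N::nat. M_word ms * (L_word ls * z) - cst (of_nat N * (\<Prod>l\<leftarrow>ls. - \<xi> * of_nat l)) * z \<in> K
    \<and> (N > 0 \<longleftrightarrow> mset ms = mset ls)"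
  using assms(2-)
proof (induction ls arbitrary: ms)
  case Nil
  then show ?case by (intro exI[of _ 1]) (simp add: cst_1 left_idealD(1)[OF K])
next
  case (Cons l ls)
  let ?p = "\<Prod>l\<leftarrow>ls. - \<xi> * of_nat l"
  let ?P = "\<lambda>i. M_word (remove_nth i ms) * (L_word ls * z)"
  have rem: "0 \<notin> set (remove_nth i ms)" for i
    using Cons.prems by (auto simp: remove_nth_def dest: in_set_takeD in_set_dropD)
  have sum_rem: "sum_list ms = ms ! i + sum_list (remove_nth i ms)" if "i < length ms" for i
    using mset_remove_nth[OF that] by (metis sum_mset.add_mset sum_mset_sum_list)
  have "\<exists>n::nat. cst (- of_nat (ms ! i)) * (M (int (ms ! i) - int l) * ?P i)
      - cst (of_nat n * (- \<xi> * of_nat l) * ?p) * z \<in> K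
      \<and> (n > 0 \<longleftrightarrow> ms ! i = l \<and> mset (remove_nth i ms) = mset ls)" if i: "i < length ms" for i
  proof -
    have len: "length (remove_nth i ms) = length ls"
      using i Cons.prems by (simp add: length_remove_nth)
    consider "ms ! i > l" | "ms ! i = l" | "ms ! i < l" by linarith
    then show ?thesis
    proof cases
      case 1
      \<comment> \<open>The commutator is a positive \<open>M\<close>; with the remaining ones there are more \<open>M\<close>s than \<open>L\<close>s.\<close>
      have "M_word ((ms ! i - l) # remove_nth i ms) * (L_word ls * z) \<in> K"
        using 1 rem len by (intro M_word_L_word_shorter z) auto
      then have "M (int (ms ! i) - int l) * ?P i \<in> K"
        using 1 by (simp add: mult.assoc of_nat_diff)
      then show ?thesis
        using 1 left_idealD(3)[OF K] by (intro exI[of _ 0]) simp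
    next
      case 2
      have "sum_list ls \<le> sum_list (remove_nth i ms)"
        using sum_rem[OF i] 2 Cons.prems by simp
      then obtain N where N: "?P i - cst (of_nat N * ?p) * z \<in> K" "N > 0 \<longleftrightarrow> mset (remove_nth i ms) = mset ls"
        using Cons.IH[OF rem len] by blast
      have "M 0 * ?P i - cst \<xi> * (cst (of_nat N * ?p) * z) \<in> K"
        using left_ideal_trans[OF K M_zero_acts] left_idealD(3)[OF K N(1), of "cst \<xi>"]
        by (simp add: right_diff_distrib)
      then have "cst (- of_nat l) * (M 0 * ?P i - cst \<xi> * (cst (of_nat N * ?p) * z)) \<in> K"
        by (rule left_idealD(3)[OF K])
      moreover have "cst (- of_nat l) * (cst \<xi> * (cst (of_nat N * ?p) * z)) = cst (of_nat N * (- \<xi> * of_nat l) * ?p) * z"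
        unfolding mult.assoc[symmetric] cst_mult[symmetric] by (simp add: algebra_simps)
      ultimately show ?thesis
        using 2 N(2) by (intro exI[of _ N]) (simp add: right_diff_distrib)
    next
      case 3
      \<comment> \<open>A negative \<open>M\<close> splits off, and the remaining degrees are too large to be matched.\<close>
      have sum: "sum_list ls < sum_list (remove_nth i ms)"
        using sum_rem[OF i] 3 Cons.prems by simp
      then have ne: "mset (remove_nth i ms) \<noteq> mset ls"
        by (metis less_irrefl sum_mset_sum_list)
      obtain N where N: "?P i - cst (of_nat N * ?p) * z \<in> K" "N > 0 \<longleftrightarrow> mset (remove_nth i ms) = mset ls"
        using Cons.IH[OF rem len] sum by auto
      then have "?P i \<in> K" using ne by simp
      then show ?thesis
        using 3 left_idealD(3)[OF K] by (intro exI[of _ 0]) simp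
    qed
  qed
  then obtain n where n: "\<And>i. i < length ms \<Longrightarrow> cst (- of_nat (ms ! i)) * (M (int (ms ! i) - int l) * ?P i)
      - cst (of_nat (n i) * (- \<xi> * of_nat l) * ?p) * z \<in> K"
    "\<And>i. i < length ms \<Longrightarrow> (n i > 0 \<longleftrightarrow> ms ! i = l \<and> mset (remove_nth i ms) = mset ls)"
    by metis
  let ?N = "\<Sum>i<length ms. n i"
  have "M_word ms * (L_word (l # ls) * z) = (M_word ms * L (- int l)) * (L_word ls * z)"
    by (simp add: mult.assoc)
  also have "\<dots> = L (- int l) * (M_word ms * (L_word ls * z)) +
    (\<Sum>i<length ms. cst (- of_nat (ms ! i)) * (M (int (ms ! i) - int l) * ?P i))"
    unfolding M_word_L by (simp add: distrib_right mult.assoc sum_distrib_right)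
  finally have split: "M_word ms * (L_word (l # ls) * z) = L (- int l) * (M_word ms * (L_word ls * z)) +
    (\<Sum>i<length ms. cst (- of_nat (ms ! i)) * (M (int (ms ! i) - int l) * ?P i))" .
  have cst_N: "cst (of_nat ?N * w) = (\<Sum>i<length ms. cst (of_nat (n i) * w))" for w
    by (simp add: sum_distrib_right cst_sum)
  have cst_Nz: "cst (of_nat ?N * (\<Prod>l\<leftarrow>l # ls. - \<xi> * of_nat l)) * z
      = (\<Sum>i<length ms. cst (of_nat (n i) * (- \<xi> * of_nat l) * ?p) * z)"
    unfolding cst_N list.map prod_list.Cons sum_distrib_right mult.assoc ..
  have "M_word ms * (L_word (l # ls) * z) - cst (of_nat ?N * (\<Prod>l\<leftarrow>l # ls. - \<xi> * of_nat l)) * z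
      = L (- int l) * (M_word ms * (L_word ls * z)) +
    (\<Sum>i<length ms. cst (- of_nat (ms ! i)) * (M (int (ms ! i) - int l) * ?P i)
       - cst (of_nat (n i) * (- \<xi> * of_nat l) * ?p) * z)"
    unfolding split cst_Nz sum_subtractf by (rule add_diff_eq[symmetric])
  also have "\<dots> \<in> K"
  proof (rule left_idealD(2)[OF K])
    show "L (- int l) * (M_word ms * (L_word ls * z)) \<in> K"
      by (rule left_idealD(3)[OF K], rule M_word_L_word_shorter[OF z]) (use Cons.prems in auto)
  qed (rule left_ideal_sum[OF K], rule n(1), simp)
  finally have "M_word ms * (L_word (l # ls) * z) - cst (of_nat ?N * (\<Prod>l\<leftarrow>l # ls. - \<xi> * of_nat l)) * z \<in> K" .
  moreover have "?N > 0 \<longleftrightarrow> mset ms = mset (l # ls)"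
  proof -
    have "?N = 0 \<longleftrightarrow> (\<forall>i<length ms. n i = 0)" by auto
    then have "?N > 0 \<longleftrightarrow> (\<exists>i<length ms. ms ! i = l \<and> mset (remove_nth i ms) = mset ls)"
      using n(2) by (metis gr0I less_numeral_extra(3))
    also have "\<dots> \<longleftrightarrow> mset ms = mset (l # ls)"
    proof
      assume "\<exists>i<length ms. ms ! i = l \<and> mset (remove_nth i ms) = mset ls"
      then show "mset ms = mset (l # ls)" using mset_remove_nth[of _ ms] by force
    next
      assume eq: "mset ms = mset (l # ls)"
      then have "l \<in> set ms" by (metis list.set_intros(1) mset_eq_setD)
      then obtain i where i: "i < length ms" "ms ! i = l" by (auto simp: in_set_conv_nth)
      moreover have "add_mset l (mset (remove_nth i ms)) = add_mset l (mset ls)"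
        using mset_remove_nth[OF i(1)] unfolding i(2) eq by simp
      ultimately show "\<exists>i<length ms. ms ! i = l \<and> mset (remove_nth i ms) = mset ls" by auto
    qed
    finally show ?thesis .
  qed
  ultimately show ?case by (intro exI[of _ ?N] conjI)
qed


section \<open>Normally ordered products modulo a left ideal\<close>

text \<open>Since \<open>K\<close> is contained in \<open>L0_span\<close>, all the following spaces contain \<open>K\<close>, and they are to be
  read modulo \<open>K\<close>.\<close>

definition L0_span :: "'u set" where
  "L0_span = adjoin {L 0} {cst a + k | a k. k \<in> K}"

abbreviation M_chain :: "nat \<Rightarrow> 'u set" where
  "M_chain \<equiv> chain (\<lambda>k. M (- (int k + 1))) L0_span"

definition M_span :: "'u set" where "M_span = (\<Union>k. M_chain k)"

abbreviation Y_chain :: "nat \<Rightarrow> 'u set" where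
  "Y_chain \<equiv> chain (\<lambda>k. Y (- (int k + 1))) M_span"

definition Y_span :: "'u set" where "Y_span = (\<Union>k. Y_chain k)"

lemma subsp_consts: "subsp {cst a + k | a k. k \<in> K}"
  unfolding subsp_def
proof (intro conjI ballI allI)
  show "0 \<in> {cst a + k | a k. k \<in> K}"
    using left_idealD(1)[OF K] by (auto intro!: exI[of _ 0])
next
  fix x y assume "x \<in> {cst a + k | a k. k \<in> K}" "y \<in> {cst a + k | a k. k \<in> K}"
  then obtain a k b l where "x = cst a + k" "k \<in> K" "y = cst b + l" "l \<in> K" by blast
  then have "x + y = cst (a + b) + (k + l)" "k + l \<in> K"
    using left_idealD(2)[OF K] by (auto simp: cst_add algebra_simps)
  then show "x + y \<in> {cst a + k | a k. k \<in> K}" by blast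
next
  fix b x assume "x \<in> {cst a + k | a k. k \<in> K}"
  then obtain a k where "x = cst a + k" "k \<in> K" by blast
  then have "cst b * x = cst (b * a) + cst b * k" "cst b * k \<in> K"
    using left_idealD(3)[OF K] by (auto simp: cst_mult distrib_left)
  then show "cst b * x \<in> {cst a + k | a k. k \<in> K}" by blast
qed

lemma subsp_L0_span: "subsp L0_span"
  unfolding L0_span_def by (intro subsp_adjoin subsp_consts)

lemma subsp_M_span: "subsp M_span"
  unfolding M_span_def by (intro subsp_Union_chain subsp_L0_span)

lemma subsp_Y_span: "subsp Y_span"
  unfolding Y_span_def by (intro subsp_Union_chain subsp_M_span)

text \<open>Positive letters lie in \<open>K\<close>, \<open>M\<^sub>0\<close> is a scalar modulo \<open>K\<close>, and commuting with \<open>L\<^sub>0\<close> rescales a letter.\<close>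

lemma L0_span_closed:
  assumes "X \<in> {L n | n. n \<ge> 0} \<union> {M n | n. n \<ge> 0} \<union> {Y n | n. n \<ge> 0}" "x \<in> L0_span"
  shows "X * x \<in> L0_span"
  unfolding L0_span_def
proof (rule adjoin_closed[OF subsp_consts _ _ assms(2)[unfolded L0_span_def] assms(1)])
  fix X x
  assume X: "X \<in> {L n | n. n \<ge> 0} \<union> {M n | n. n \<ge> 0} \<union> {Y n | n. n \<ge> 0}"
    and "x \<in> {cst a + k | a k. k \<in> K}"
  then obtain a k where x: "x = cst a + k" "k \<in> K" by blast
  have split: "X * x = cst a * X + X * k" unfolding x by (simp add: distrib_left cst_central)
  have k: "X * k \<in> K" using x left_idealD(3)[OF K] by blast
  show "X * x \<in> adjoin {L 0} {cst a + k | a k. k \<in> K}"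
  proof (cases "X = L 0")
    case True
    have "x \<in> adjoin {L 0} {cst a + k | a k. k \<in> K}" using x by (intro adjoin_base) blast
    then show ?thesis unfolding True by (rule adjoin_mult[rotated]) simp
  next
    case False
    have "X \<in> {cst a + k | a k. k \<in> K}"
    proof (cases "X = M 0")
      case True
      then have "X = cst \<xi> + (M 0 - cst \<xi>)" by simp
      then show ?thesis using M_zero by blast
    next
      case nM: False
      have "X \<in> K"
      proof -
        consider n where "X = L n" "n \<ge> 1" | n where "X = M n" "n \<ge> 1" | n where "X = Y n" "n \<ge> 0"
        proof -
          have "n \<ge> 1" if "X = L n \<or> X = M n" "n \<ge> 0" for n
            using that False nM by (cases "n = 0") auto
          then show ?thesis using that X by blast
        qed
        then show ?thesis using L_pos M_pos Y_pos by cases auto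
      qed
      then show ?thesis by (intro CollectI exI[of _ 0] exI[of _ X]) simp
    qed
    moreover have "X * k \<in> {cst a + k | a k. k \<in> K}"
      using k by (intro CollectI exI[of _ 0] exI[of _ "X * k"]) simp
    ultimately show ?thesis
      unfolding split by (intro adjoin_base subspD(2)[OF subsp_consts] subspD(3)[OF subsp_consts])
  qed
next
  fix X g
  assume "X \<in> {L n | n. n \<ge> 0} \<union> {M n | n. n \<ge> 0} \<union> {Y n | n. n \<ge> 0}" "g \<in> {L 0}"
  then show "\<exists>a Z. Z \<in> {L n | n. n \<ge> 0} \<union> {M n | n. n \<ge> 0} \<union> {Y n | n. n \<ge> 0} \<and> X * g = g * X + cst a * Z"
    using LL[of _ 0] LM'[of _ 0] LY'[of _ 0] by fastforce
qed

text \<open>The letters named here span, together with the \<open>M\<close>s, a subalgebra, so moving one of them to the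
  right through negative \<open>M\<close>s never leaves the set. The set grows along the chain because at step
  \<open>k\<close> only the \<open>M\<close>s of degree at least \<open>-k\<close> have been adjoined.\<close>

lemma M_span_closed:
  assumes "X \<in> {L n | n. n \<ge> 0} \<union> {M n | n. True} \<union> {Y n | n. n \<ge> 0}" "x \<in> M_span"
  shows "X * x \<in> M_span"
proof -
  let ?X = "\<lambda>k. {L n | n. n \<ge> 0} \<union> {M n | n. n \<ge> - int k} \<union> {Y n | n. n \<ge> 0}"
  have "M n \<in> (\<Union>k. ?X k)" for n by (intro UN_I[of "nat (- n)"]) auto
  then have X: "X \<in> (\<Union>k. ?X k)" using assms(1) by blast
  show ?thesis
    unfolding M_span_def
  proof (rule Union_chain_closed[where \<X> = ?X, OF subsp_L0_span _ _ _ _ X assms(2)[unfolded M_span_def]])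
    show "X * x \<in> L0_span" if "X \<in> ?X 0" "x \<in> L0_span" for X x
      using that by (intro L0_span_closed) simp_all
    show "?X (Suc k) \<subseteq> insert (M (- (int k + 1))) (?X k)" for k
    proof
      fix X assume X: "X \<in> ?X (Suc k)"
      have "n = - (int k + 1) \<or> n \<ge> - int k" if "n \<ge> - int (Suc k)" for n using that by auto
      then show "X \<in> insert (M (- (int k + 1))) (?X k)" using X by blast
    qed
    show "?X j \<subseteq> ?X k" if "j \<le> k" for j k using that by (intro Un_mono) auto
    fix k X assume X: "X \<in> ?X (Suc k)"
    let ?c = "M (- (int k + 1))"
    consider n where "X = L n" "n \<ge> 0" | n where "X = M n" | n where "X = Y n" using X by blast
    then show "\<exists>a Z. Z \<in> ?X (Suc k) \<and> X * ?c = ?c * X + cst a * Z"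
    proof cases
      case 1
      moreover have "M (n + - (int k + 1)) \<in> ?X (Suc k)" using 1 by (intro UnI1 UnI2) auto
      ultimately show ?thesis using LM[of n "- (int k + 1)"] by blast
    next
      case 2
      then have "X * ?c = ?c * X + cst 0 * X" using MM[of n "- (int k + 1)"] by simp
      then show ?thesis using X by blast
    next
      case 3
      then have "X * ?c = ?c * X + cst 0 * X" using MY[of "- (int k + 1)" n] by simp
      then show ?thesis using X by blast
    qed
  qed
qed

lemma Y_span_closed:
  assumes "X \<in> {L n | n. n \<ge> 0} \<union> {M n | n. True} \<union> {Y n | n. True}" "x \<in> Y_span"
  shows "X * x \<in> Y_span"
proof -
  let ?X = "\<lambda>k. {L n | n. n \<ge> 0} \<union> {M n | n. True} \<union> {Y n | n. n \<ge> - int k}"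
  have "Y n \<in> (\<Union>k. ?X k)" for n by (intro UN_I[of "nat (- n)"]) auto
  then have X: "X \<in> (\<Union>k. ?X k)" using assms(1) by blast
  show ?thesis
    unfolding Y_span_def
  proof (rule Union_chain_closed[where \<X> = ?X, OF subsp_M_span _ _ _ _ X assms(2)[unfolded Y_span_def]])
    show "X * x \<in> M_span" if "X \<in> ?X 0" "x \<in> M_span" for X x
      using that by (intro M_span_closed) simp_all
    show "?X (Suc k) \<subseteq> insert (Y (- (int k + 1))) (?X k)" for k
    proof
      fix X assume X: "X \<in> ?X (Suc k)"
      have "n = - (int k + 1) \<or> n \<ge> - int k" if "n \<ge> - int (Suc k)" for n using that by auto
      then show "X \<in> insert (Y (- (int k + 1))) (?X k)" using X by blast
    qed
    show "?X j \<subseteq> ?X k" if "j \<le> k" for j k using that by (intro Un_mono) auto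
    fix k X assume X: "X \<in> ?X (Suc k)"
    let ?c = "Y (- (int k + 1))"
    consider n where "X = L n" "n \<ge> 0" | n where "X = M n" | n where "X = Y n" using X by blast
    then show "\<exists>a Z. Z \<in> ?X (Suc k) \<and> X * ?c = ?c * X + cst a * Z"
    proof cases
      case 1
      moreover have "Y (n + - (int k + 1)) \<in> ?X (Suc k)" using 1 by (intro UnI2) auto
      ultimately show ?thesis using LY[of n "- (int k + 1)"] by blast
    next
      case 2
      then have "X * ?c = ?c * X + cst 0 * X" using MY[of n "- (int k + 1)"] by simp
      then show ?thesis using X by blast
    next
      case 3
      moreover have "M (n + - (int k + 1) + 1) \<in> ?X (Suc k)" by (intro UnI1 UnI2) auto
      ultimately show ?thesis using YY[of n "- (int k + 1)"] by blast
    qed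
  qed
qed

text \<open>The easy half of the Poincare-Birkhoff-Witt theorem: the normally ordered products span,
  since they contain \<open>1\<close> and are stable under left multiplication by every letter.\<close>

lemma adjoin_L_neg_UNIV: "x \<in> adjoin {L (- int n) | n. n \<ge> 1} Y_span"
proof -
  let ?G = "{L (- int n) | n. n \<ge> 1}"
  let ?X = "{L n | n. True} \<union> {M n | n. True} \<union> {Y n | n. True}"
  have closed: "X * x \<in> adjoin ?G Y_span" if "X \<in> ?X" "x \<in> adjoin ?G Y_span" for X x
  proof (rule adjoin_closed[OF subsp_Y_span _ _ that(2) that(1)])
    fix X x assume X: "X \<in> ?X" and x: "x \<in> Y_span"
    show "X * x \<in> adjoin ?G Y_span"
    proof (cases "X \<in> ?G")
      case True
      then show ?thesis using x by (auto intro: adjoin_mult adjoin_base)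
    next
      case False
      have "X \<in> {L n | n. n \<ge> 0} \<union> {M n | n. True} \<union> {Y n | n. True}"
      proof -
        have "n \<ge> 0" if "X = L n" for n
        proof (rule ccontr)
          assume "\<not> n \<ge> 0"
          then have "n = - int (nat (- n))" "nat (- n) \<ge> 1" by auto
          then have "X = L (- int (nat (- n)))" using that by simp
          then show False using False \<open>nat (- n) \<ge> 1\<close> by blast
        qed
        then show ?thesis using X by blast
      qed
      then show ?thesis using Y_span_closed x by (blast intro: adjoin_base)
    qed
  next
    fix X g assume X: "X \<in> ?X" and "g \<in> ?G"
    then obtain k where g: "g = L (- int k)" by blast
    consider n where "X = L n" | n where "X = M n" | n where "X = Y n" using X by blast
    then show "\<exists>a Z. Z \<in> ?X \<and> X * g = g * X + cst a * Z"
    proof cases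
      case (1 n)
      show ?thesis unfolding g 1 by (intro exI conjI, rule_tac[2] LL) blast
    next
      case (2 n)
      show ?thesis unfolding g 2 by (intro exI conjI, rule_tac[2] LM') blast
    next
      case (3 n)
      show ?thesis unfolding g 3 by (intro exI conjI, rule_tac[2] LY') blast
    qed
  qed
  show ?thesis
  proof (rule letters_generate)
    have "1 \<in> {cst a + k | a k. k \<in> K}"
      using left_idealD(1)[OF K] by (intro CollectI exI[of _ 1] exI[of _ 0]) (simp add: cst_1)
    then have "1 \<in> L0_span" unfolding L0_span_def by (rule adjoin_base)
    then have "1 \<in> M_span" unfolding M_span_def by (intro UN_I[of 0]) simp_all
    then have "1 \<in> Y_span" unfolding Y_span_def by (intro UN_I[of 0]) simp_all
    then show "1 \<in> adjoin ?G Y_span" by (rule adjoin_base)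
  next
    fix n x assume x: "x \<in> adjoin ?G Y_span"
    show "L n * x \<in> adjoin ?G Y_span" "M n * x \<in> adjoin ?G Y_span" "Y n * x \<in> adjoin ?G Y_span"
      by (rule closed[OF _ x]; blast)+
  qed (auto intro: adjoin_add subspD(3)[OF subsp_adjoin[OF subsp_Y_span]])
qed

lemma L0_span_annihilated:
  assumes "X \<in> {L n | n. n \<ge> 1} \<union> {M n | n. n \<ge> 1} \<union> {Y n | n. n \<ge> 0}" "x \<in> L0_span"
  shows "X * x \<in> K"
proof (rule adjoin_annihilated[OF K _ _ assms(2)[unfolded L0_span_def] assms(1)])
  fix X x
  assume "X \<in> {L n | n. n \<ge> 1} \<union> {M n | n. n \<ge> 1} \<union> {Y n | n. n \<ge> 0}"
    and "x \<in> {cst a + k | a k. k \<in> K}"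
  then obtain a k where "X \<in> K" "x = cst a + k" "k \<in> K" using L_pos M_pos Y_pos by blast
  then show "X * x \<in> K"
    by (auto simp: distrib_left cst_central intro!: left_idealD(2)[OF K] left_idealD(3)[OF K])
next
  fix X g
  assume "X \<in> {L n | n. n \<ge> 1} \<union> {M n | n. n \<ge> 1} \<union> {Y n | n. n \<ge> 0}" "g \<in> {L 0}"
  then show "\<exists>a Z. Z \<in> {L n | n. n \<ge> 1} \<union> {M n | n. n \<ge> 1} \<union> {Y n | n. n \<ge> 0} \<and> X * g = g * X + cst a * Z"
    using LL[of _ 0] LM'[of _ 0] LY'[of _ 0] by fastforce
qed

text \<open>A letter of degree above \<open>k\<close> stays of positive degree after one commutator with an \<open>M\<close> of
  degree at least \<open>-k\<close>, and it is then an \<open>M\<close>, which commutes with the rest.\<close>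

lemma M_chain_annihilated:
  assumes "X \<in> {L n | n. n > int k} \<union> {M n | n. n \<ge> 1} \<union> {Y n | n. n \<ge> 0}" "x \<in> M_chain k"
  shows "X * x \<in> K"
proof -
  let ?X = "\<lambda>k. {L n | n. n > int k} \<union> {M n | n. n \<ge> 1} \<union> {Y n | n. n \<ge> 0}"
  show ?thesis
  proof (rule chain_annihilated[where \<X> = ?X, OF K _ _ _ assms])
    show "X * x \<in> K" if "X \<in> ?X 0" "x \<in> L0_span" for X x
      using that by (intro L0_span_annihilated) fastforce+
    show "?X (Suc k) \<subseteq> ?X k" for k by fastforce
    fix k X assume X: "X \<in> ?X (Suc k)"
    let ?c = "M (- (int k + 1))"
    consider n where "X = L n" "n > int (Suc k)" | n where "X = M n" | n where "X = Y n" using X by blast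
    then show "\<exists>a Z. Z \<in> ?X (Suc k) \<and> X * ?c = ?c * X + cst a * Z"
    proof cases
      case 1
      moreover have "M (n + - (int k + 1)) \<in> ?X (Suc k)" using 1 by (intro UnI1 UnI2) auto
      ultimately show ?thesis using LM[of n "- (int k + 1)"] by blast
    next
      case 2
      then have "X * ?c = ?c * X + cst 0 * X" using MM[of n "- (int k + 1)"] by simp
      then show ?thesis using X by blast
    next
      case 3
      then have "X * ?c = ?c * X + cst 0 * X" using MY[of "- (int k + 1)" n] by simp
      then show ?thesis using X by blast
    qed
  qed
qed

lemma Y_chain_annihilated:
  assumes "X \<in> {M n | n. n \<ge> 1} \<union> {Y n | n. n \<ge> int k}" "x \<in> Y_chain k"
  shows "X * x \<in> K"
proof -
  let ?X = "\<lambda>k. {M n | n. n \<ge> 1} \<union> {Y n | n. n \<ge> int k}"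
  show ?thesis
  proof (rule chain_annihilated[where \<X> = ?X, OF K _ _ _ assms])
    fix X x assume X: "X \<in> ?X 0" and "x \<in> M_span"
    then obtain k where "x \<in> M_chain k" by (auto simp: M_span_def)
    then show "X * x \<in> K" by (rule M_chain_annihilated[rotated]) (use X in auto)
  next
    show "?X (Suc k) \<subseteq> ?X k" for k by fastforce
    fix k X assume X: "X \<in> ?X (Suc k)"
    let ?c = "Y (- (int k + 1))"
    consider n where "X = M n" | n where "X = Y n" "n \<ge> int (Suc k)" using X by blast
    then show "\<exists>a Z. Z \<in> ?X (Suc k) \<and> X * ?c = ?c * X + cst a * Z"
    proof cases
      case 1
      then have "X * ?c = ?c * X + cst 0 * X" using MY[of n "- (int k + 1)"] by simp
      then show ?thesis using X by blast
    next
      case 2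
      moreover have "M (n + - (int k + 1) + 1) \<in> ?X (Suc k)" using 2 by (intro UnI1) auto
      ultimately show ?thesis using YY[of n "- (int k + 1)"] by blast
    qed
  qed
qed

text \<open>\<open>[L\<^sub>n, M\<^bsub>-n\<^esub>] = -n M\<^sub>0\<close>, and \<open>L\<^sub>n\<close> annihilates the words in \<open>M\<^bsub>-1\<^esub>, \<dots>, M\<^bsub>-n+1\<^esub>\<close>: the letters
  \<open>M\<^bsub>-n\<^esub>\<close> are removed in the order of decreasing \<open>n\<close>.\<close>

lemma reaches_M_span:
  assumes "x \<in> M_span" "x \<notin> K"
  shows "reaches K x L0_span"
proof -
  obtain k where k: "x \<in> M_chain k" using assms(1) by (auto simp: M_span_def)
  show ?thesis
  proof (rule reaches_chain[where D = "\<lambda>k. L (int k + 1)" and \<kappa> = "\<lambda>k. - of_nat (Suc k) * \<xi>",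
        OF K subsp_L0_span _ _ _ k assms(2)])
    show "L (int k + 1) * x \<in> K" if "x \<in> M_chain k" for k x
      using that by (rule M_chain_annihilated[rotated]) force
    show "L (int k + 1) * (M (- (int k + 1)) * x) - M (- (int k + 1)) * (L (int k + 1) * x)
        - cst (- of_nat (Suc k) * \<xi>) * x \<in> K" for k x
      using LM[of "int k + 1" "- (int k + 1)"] by (intro commutator_M_zero) (simp add: add.commute)
    show "- of_nat (Suc k) * \<xi> \<noteq> 0" for k using \<xi> by (simp del: of_nat_Suc)
  qed
qed

text \<open>The letter \<open>Y\<close> of index \<open>k\<close> has degree \<open>k + 1/2\<close>, so that it is paired with the one of index
  \<open>-(k + 1)\<close>; their bracket is \<open>-(2k + 1) M\<^sub>0\<close>.\<close>

lemma reaches_Y_span: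
  assumes "x \<in> Y_span" "x \<notin> K"
  shows "reaches K x M_span"
proof -
  obtain k where k: "x \<in> Y_chain k" using assms(1) by (auto simp: Y_span_def)
  show ?thesis
  proof (rule reaches_chain[where D = "\<lambda>k. Y (int k)" and \<kappa> = "\<lambda>k. of_int (- (int k + 1) - int k) * \<xi>",
        OF K subsp_M_span _ _ _ k assms(2)])
    show "Y (int k) * x \<in> K" if "x \<in> Y_chain k" for k x
      using that by (rule Y_chain_annihilated[rotated]) force
    show "Y (int k) * (Y (- (int k + 1)) * x) - Y (- (int k + 1)) * (Y (int k) * x)
        - cst (of_int (- (int k + 1) - int k) * \<xi>) * x \<in> K" for k x
      using YY[of "int k" "- (int k + 1)"] by (intro commutator_M_zero) simp
    have "- (int k + 1) - int k \<noteq> 0" for k by linarith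
    then show "of_int (- (int k + 1) - int k) * \<xi> \<noteq> 0" for k
      using \<xi> by (simp only: mult_eq_0_iff of_int_eq_0_iff not_False_eq_True de_Morgan_disj)
  qed
qed

section \<open>Removing the negative L\<close>

text \<open>A chain does not suffice for the letters \<open>L\<close>: the positive \<open>M\<close>s dual to them do not annihilate
  the words in shorter \<open>L\<close>s. The leading coefficients are instead read off from an expansion along
  sorted words, and this space records the number of \<open>L\<close>s.\<close>

inductive_set L_sorted_span :: "nat \<Rightarrow> 'u set" for r where
  L_sorted_span_zero: "0 \<in> L_sorted_span r"
| L_sorted_span_add: "x \<in> L_sorted_span r \<Longrightarrow> y \<in> L_sorted_span r \<Longrightarrow> x + y \<in> L_sorted_span r"
| L_sorted_span_word: "sorted ls \<Longrightarrow> 0 \<notin> set ls \<Longrightarrow> length ls \<le> r \<Longrightarrow> z \<in> Y_span \<Longrightarrow> L_word ls * z \<in> L_sorted_span r"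

lemma L_sorted_span_mono: "x \<in> L_sorted_span r \<Longrightarrow> r \<le> s \<Longrightarrow> x \<in> L_sorted_span s"
  by (induction rule: L_sorted_span.induct) (auto intro: L_sorted_span.intros)

lemma L_sorted_span_cst: "x \<in> L_sorted_span r \<Longrightarrow> cst a * x \<in> L_sorted_span r"
proof (induction rule: L_sorted_span.induct)
  case (L_sorted_span_word ls z)
  then have "L_word ls * (cst a * z) \<in> L_sorted_span r"
    by (intro L_sorted_span.L_sorted_span_word subspD(3)[OF subsp_Y_span])
  then show ?case by (simp only: cst_mult_assoc)
qed (auto simp: distrib_left intro: L_sorted_span.intros)

text \<open>Sorting by exchanges of neighbours changes a word only by words with one letter less.\<close>

lemma L_neg_mult_sorted_word:
  assumes "sorted ls" "0 \<notin> set ls" "length ls = r" "a \<ge> 1" "z \<in> Y_span"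
  shows "L (- int a) * (L_word ls * z) - L_word (insort a ls) * z \<in> L_sorted_span r"
  using assms
proof (induction r arbitrary: ls a z rule: less_induct)
  case (less r)
  have IH: "L (- int b) * x \<in> L_sorted_span (Suc s)" if "x \<in> L_sorted_span s" "s < r" "b \<ge> 1" for x s b
    using that
  proof (induction rule: L_sorted_span.induct)
    case (L_sorted_span_word ks w)
    have "L (- int b) * (L_word ks * w) - L_word (insort b ks) * w \<in> L_sorted_span (Suc s)"
      by (rule L_sorted_span_mono[OF less.IH[of "length ks"]]) (use L_sorted_span_word in auto)
    moreover have "L_word (insort b ks) * w \<in> L_sorted_span (Suc s)"
      using L_sorted_span_word
      by (intro L_sorted_span.L_sorted_span_word) (auto simp: sorted_insort set_insort_key)
    ultimately show ?case by (metis L_sorted_span_add diff_add_cancel)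
  qed (auto simp: distrib_left intro: L_sorted_span.intros)
  show ?case
  proof (cases "ls = [] \<or> a \<le> hd ls")
    case True
    then have "insort a ls = a # ls" by (cases ls) auto
    then show ?thesis by (simp add: mult.assoc L_sorted_span_zero)
  next
    case False
    then obtain b ks where ls: "ls = b # ks" and ba: "b < a" by (cases ls) auto
    have ks: "sorted ks" "0 \<notin> set ks" "length ks = r - 1" "r - 1 < r" "b \<ge> 1" "Suc (r - 1) = r"
      using less.prems ls by auto
    let ?X = "L_word ks * z"
    let ?c = "cst (of_int (- int b - - int a))"
    have comm: "L (- int a) * L (- int b) = L (- int b) * L (- int a) + ?c * L (- int (a + b))"
      using LL[of "- int a" "- int b"] by simp
    have "L (- int a) * (L_word ls * z) - L_word (insort a ls) * z
      = L (- int a) * L (- int b) * ?X - L (- int b) * (L_word (insort a ks) * z)"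
      using ba by (simp add: ls mult.assoc)
    also have "\<dots> = L (- int b) * (L (- int a) * ?X - L_word (insort a ks) * z) + ?c * (L (- int (a + b)) * ?X)"
      unfolding comm by (simp add: distrib_right right_diff_distrib mult.assoc)
    also have "\<dots> \<in> L_sorted_span r"
    proof (rule L_sorted_span_add)
      have "L (- int a) * ?X - L_word (insort a ks) * z \<in> L_sorted_span (r - 1)"
        by (rule less.IH) (use ks less.prems in auto)
      then show "L (- int b) * (L (- int a) * ?X - L_word (insort a ks) * z) \<in> L_sorted_span r"
        using IH[of _ "r - 1" b] ks by simp
      have "?X \<in> L_sorted_span (r - 1)" using ks less.prems by (intro L_sorted_span_word) auto
      then have "L (- int (a + b)) * ?X \<in> L_sorted_span r"
        using IH[of _ "r - 1" "a + b"] ks by simp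
      then show "?c * (L (- int (a + b)) * ?X) \<in> L_sorted_span r" by (rule L_sorted_span_cst)
    qed
    finally show ?thesis .
  qed
qed

lemma L_neg_mult_sorted_span:
  assumes "x \<in> L_sorted_span r" "a \<ge> 1"
  shows "L (- int a) * x \<in> L_sorted_span (Suc r)"
  using assms(1)
proof (induction rule: L_sorted_span.induct)
  case (L_sorted_span_word ls z)
  have "L (- int a) * (L_word ls * z) - L_word (insort a ls) * z \<in> L_sorted_span (Suc r)"
    by (rule L_sorted_span_mono[OF L_neg_mult_sorted_word[of ls "length ls"]]) (use assms L_sorted_span_word in auto)
  moreover have "L_word (insort a ls) * z \<in> L_sorted_span (Suc r)"
    using L_sorted_span_word assms
    by (intro L_sorted_span.L_sorted_span_word) (auto simp: sorted_insort set_insort_key)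
  ultimately show ?case by (metis L_sorted_span_add diff_add_cancel)
qed (auto simp: distrib_left intro: L_sorted_span.intros)

lemma exists_L_sorted_span: "\<exists>r. x \<in> L_sorted_span r"
  using adjoin_L_neg_UNIV[of x]
proof (induction rule: adjoin.induct)
  case (adjoin_base z)
  then have "L_word [] * z \<in> L_sorted_span 0" by (intro L_sorted_span_word) auto
  then show ?case by auto
next
  case (adjoin_add x y)
  then obtain r s where "x \<in> L_sorted_span r" "y \<in> L_sorted_span s" by blast
  then have "x \<in> L_sorted_span (max r s)" "y \<in> L_sorted_span (max r s)"
    by (auto intro: L_sorted_span_mono)
  then show ?case by (blast intro: L_sorted_span_add)
next
  case (adjoin_mult g x)
  then show ?case using L_neg_mult_sorted_span by blast
qed

lemma sorted_L_words_expansion: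
  "\<exists>\<Lambda> f. finite \<Lambda> \<and> (\<forall>ls\<in>\<Lambda>. sorted ls \<and> 0 \<notin> set ls) \<and> (\<forall>ls. f ls \<in> Y_span)
     \<and> x = (\<Sum>ls\<in>\<Lambda>. L_word ls * f ls)"
proof -
  obtain r where "x \<in> L_sorted_span r" using exists_L_sorted_span by blast
  then show ?thesis
  proof (induction rule: L_sorted_span.induct)
    case L_sorted_span_zero
    then show ?case
      using subspD(1)[OF subsp_Y_span] by (intro exI[of _ "{}"] exI[of _ "\<lambda>_. 0"]) auto
  next
    case (L_sorted_span_add x y)
    then obtain \<Lambda> f \<Lambda>' g
      where f: "finite \<Lambda>" "\<forall>ls\<in>\<Lambda>. sorted ls \<and> 0 \<notin> set ls" "\<forall>ls. f ls \<in> Y_span" "x = (\<Sum>ls\<in>\<Lambda>. L_word ls * f ls)"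
        and g: "finite \<Lambda>'" "\<forall>ls\<in>\<Lambda>'. sorted ls \<and> 0 \<notin> set ls" "\<forall>ls. g ls \<in> Y_span" "y = (\<Sum>ls\<in>\<Lambda>'. L_word ls * g ls)"
      by blast
    let ?h = "\<lambda>ls. (if ls \<in> \<Lambda> then f ls else 0) + (if ls \<in> \<Lambda>' then g ls else 0)"
    have "x = (\<Sum>ls\<in>\<Lambda> \<union> \<Lambda>'. L_word ls * (if ls \<in> \<Lambda> then f ls else 0))"
      unfolding f(4) using f(1) g(1) by (intro sum.mono_neutral_cong_left) auto
    moreover have "y = (\<Sum>ls\<in>\<Lambda> \<union> \<Lambda>'. L_word ls * (if ls \<in> \<Lambda>' then g ls else 0))"
      unfolding g(4) using f(1) g(1) by (intro sum.mono_neutral_cong_left) auto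
    ultimately have "x + y = (\<Sum>ls\<in>\<Lambda> \<union> \<Lambda>'. L_word ls * ?h ls)"
      by (simp add: distrib_left sum.distrib)
    moreover have "\<forall>ls. ?h ls \<in> Y_span"
      using f(3) g(3) by (auto intro!: subspD(2)[OF subsp_Y_span] subspD(1)[OF subsp_Y_span])
    ultimately show ?case using f(1,2) g(1,2)
      by (intro exI[of _ "\<Lambda> \<union> \<Lambda>'"] exI[of _ ?h]) auto
  next
    case (L_sorted_span_word ls z)
    then show ?case by (intro exI[of _ "{ls}"] exI[of _ "\<lambda>_. z"]) auto
  qed
qed

text \<open>Among the words whose coefficient is outside \<open>K\<close>, take one of maximal length and, among these,
  of maximal degree. The word in the \<open>M\<close>s with the same indices annihilates all other terms:
  shorter words and those of smaller degree by counting, those of the same length and degree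
  because sorted words with equal multisets coincide.\<close>

lemma reaches_Y_span_from_any:
  assumes x: "x \<notin> K"
  shows "reaches K x Y_span"
proof -
  obtain \<Lambda> f where fin: "finite \<Lambda>" and \<Lambda>: "\<And>ls. ls \<in> \<Lambda> \<Longrightarrow> sorted ls \<and> 0 \<notin> set ls"
    and f: "\<And>ls. f ls \<in> Y_span" and xs: "x = (\<Sum>ls\<in>\<Lambda>. L_word ls * f ls)"
    using sorted_L_words_expansion[of x] by blast
  have ann: "M n * f ls \<in> K" if "n \<ge> 1" for n ls
  proof -
    obtain k where "f ls \<in> Y_chain k" using f[of ls] by (auto simp: Y_span_def)
    then show ?thesis by (rule Y_chain_annihilated[rotated]) (use that in blast)
  qed
  define S where "S = {ls \<in> \<Lambda>. f ls \<notin> K}"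
  have "S \<noteq> {}"
  proof
    assume "S = {}"
    then have "x \<in> K" unfolding xs S_def
      by (intro left_ideal_sum[OF K] left_idealD(3)[OF K]) auto
    then show False using x by simp
  qed
  have finS: "finite S" using fin by (simp add: S_def)
  define r where "r = Max (length ` S)"
  define T where "T = {ls \<in> S. length ls = r}"
  have "r \<in> length ` S" unfolding r_def using finS \<open>S \<noteq> {}\<close> by (intro Max_in) auto
  then have "T \<noteq> {}" by (auto simp: T_def)
  have finT: "finite T" using finS by (simp add: T_def)
  have "Max (sum_list ` T) \<in> sum_list ` T" using finT \<open>T \<noteq> {}\<close> by (intro Max_in) auto
  then obtain ms where ms: "ms \<in> T" "sum_list ms = Max (sum_list ` T)" by auto
  have msS: "ms \<in> S" "length ms = r" "ms \<in> \<Lambda>" "f ms \<notin> K" "sorted ms" "0 \<notin> set ms"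
    using ms \<Lambda> by (auto simp: T_def S_def)
  have rest: "M_word ms * (L_word ls * f ls) \<in> K" if ls: "ls \<in> \<Lambda> - {ms}" for ls
  proof (cases "ls \<in> S")
    case False
    then show ?thesis using ls by (intro left_idealD(3)[OF K]) (auto simp: S_def)
  next
    case True
    then have "length ls \<le> r" unfolding r_def using finS by (intro Max_ge) auto
    show ?thesis
    proof (cases "length ls = r")
      case False
      then show ?thesis
        using \<open>length ls \<le> r\<close> msS by (intro M_word_L_word_shorter ann) auto
    next
      case eq: True
      then have "sum_list ls \<le> sum_list ms"
        unfolding ms(2) using finT True by (intro Max_ge) (auto simp: T_def)
      then obtain N :: nat where N: "M_word ms * (L_word ls * f ls) - cst (of_nat N * (\<Prod>l\<leftarrow>ls. - \<xi> * of_nat l)) * f ls \<in> K"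
        "N > 0 \<longleftrightarrow> mset ms = mset ls"
        using M_word_L_word[OF ann msS(6), of ls] eq msS by blast
      have "mset ms \<noteq> mset ls"
        using ls msS(5) \<Lambda>[of ls] by (metis Diff_iff insertI1 properties_for_sort sorted_sort_id)
      then show ?thesis using N by simp
    qed
  qed
  obtain N :: nat where N: "M_word ms * (L_word ms * f ms) - cst (of_nat N * (\<Prod>l\<leftarrow>ms. - \<xi> * of_nat l)) * f ms \<in> K"
    "N > 0"
    using M_word_L_word[OF ann msS(6), of ms] by blast
  let ?a = "of_nat N * (\<Prod>l\<leftarrow>ms. - \<xi> * of_nat l)"
  have "?a \<noteq> 0" using N(2) \<xi> msS(6) by (auto simp: prod_list_zero_iff)
  then have "cst ?a * f ms \<notin> K" using msS(4) cst_in_iff[OF K] by blast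
  moreover have "cst ?a * f ms \<in> Y_span" using f by (rule subspD(3)[OF subsp_Y_span])
  moreover have "M_word ms * x - cst ?a * f ms
      = (M_word ms * (L_word ms * f ms) - cst ?a * f ms) + (\<Sum>ls\<in>\<Lambda> - {ms}. M_word ms * (L_word ls * f ls))"
    unfolding xs sum.remove[OF fin msS(3)] by (simp add: distrib_left sum_distrib_left)
  moreover have "\<dots> \<in> K" using N(1) rest by (intro left_idealD(2)[OF K] left_ideal_sum[OF K])
  ultimately show ?thesis unfolding reaches_def by metis
qed

text \<open>The three removals in turn: first the \<open>L\<close>s, then the \<open>Y\<close>s, then the \<open>M\<close>s.\<close>

theorem reaches_L0_span: "x \<notin> K \<Longrightarrow> reaches K x L0_span"
  by (blast intro: reaches_trans[OF K] reaches_Y_span_from_any reaches_Y_span reaches_M_span)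

lemma L0_span_polynomial:
  assumes "z \<in> L0_span"
  shows "\<exists>n a. z - (\<Sum>i\<le>n. cst (a i) * L 0 ^ i) \<in> K"
proof -
  obtain n f where f: "\<forall>i. f i \<in> {cst a + k | a k. k \<in> K}" and z: "z = (\<Sum>i\<le>n. L 0 ^ i * f i)"
    using adjoin_single_power_sum[OF subsp_consts assms[unfolded L0_span_def]] by blast
  then have "\<forall>i. \<exists>a k. f i = cst a + k \<and> k \<in> K" by blast
  then obtain a k where ak: "\<And>i. f i = cst (a i) + k i" "\<And>i. k i \<in> K" by metis
  have "z - (\<Sum>i\<le>n. cst (a i) * L 0 ^ i) = (\<Sum>i\<le>n. L 0 ^ i * k i)"
    unfolding z sum_subtractf[symmetric] ak(1) by (simp add: distrib_left cst_central)
  also have "\<dots> \<in> K" by (intro left_ideal_sum[OF K] left_idealD(3)[OF K] ak)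
  finally show ?thesis by blast
qed

end

section \<open>The Whittaker and Verma left ideals\<close>

definition left_hull :: "'u::ring_1 set \<Rightarrow> 'u set" where
  "left_hull S = \<Inter>{K. left_ideal K \<and> S \<subseteq> K}"

lemma left_hull_superset: "S \<subseteq> left_hull S"
  by (auto simp: left_hull_def)

lemma left_hull_minimal: "left_ideal K \<Longrightarrow> S \<subseteq> K \<Longrightarrow> left_hull S \<subseteq> K"
  by (auto simp: left_hull_def)

lemma left_ideal_left_hull: "left_ideal (left_hull S)"
  unfolding left_ideal_def left_hull_def by (auto intro: left_idealD)

lemma left_ideal_add_multiples:
  assumes K: "left_ideal K"
  shows "left_ideal {a * h + k | a k. k \<in> K}"
  unfolding left_ideal_def
proof (intro conjI ballI allI)
  show "0 \<in> {a * h + k | a k. k \<in> K}"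
    using left_idealD(1)[OF K] by (intro CollectI exI[of _ 0]) auto
next
  fix x y assume "x \<in> {a * h + k | a k. k \<in> K}" "y \<in> {a * h + k | a k. k \<in> K}"
  then obtain a k b l where "x = a * h + k" "y = b * h + l" "k \<in> K" "l \<in> K" by blast
  then have "x + y = (a + b) * h + (k + l)" "k + l \<in> K"
    using left_idealD(2)[OF K] by (auto simp: algebra_simps)
  then show "x + y \<in> {a * h + k | a k. k \<in> K}" by blast
next
  fix b x assume "x \<in> {a * h + k | a k. k \<in> K}"
  then obtain a k where "x = a * h + k" "k \<in> K" by blast
  then have "b * x = (b * a) * h + b * k" "b * k \<in> K"
    using left_idealD(3)[OF K] by (auto simp: algebra_simps)
  then show "b * x \<in> {a * h + k | a k. k \<in> K}" by blast
qed

context sv_enveloping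
begin

definition positive_letters :: "'u set" where
  "positive_letters = {L n | n. n \<ge> 1} \<union> {M n | n. n \<ge> 1} \<union> {Y n | n. n \<ge> 0}"

definition whittaker_ideal :: "complex \<Rightarrow> 'u set" where
  "whittaker_ideal \<xi> = left_hull (insert (M 0 - cst \<xi>) positive_letters)"

definition verma_ideal :: "complex \<Rightarrow> complex \<Rightarrow> 'u set" where
  "verma_ideal \<xi> \<zeta> = left_hull (insert (L 0 - cst \<zeta>) (insert (M 0 - cst \<xi>) positive_letters))"

lemma left_ideal_whittaker: "left_ideal (whittaker_ideal \<xi>)"
  unfolding whittaker_ideal_def by (rule left_ideal_left_hull)

lemma left_ideal_verma: "left_ideal (verma_ideal \<xi> \<zeta>)"
  unfolding verma_ideal_def by (rule left_ideal_left_hull)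

lemma sv_left_idealI:
  assumes "\<xi> \<noteq> 0" "left_ideal K" "M 0 - cst \<xi> \<in> K" "positive_letters \<subseteq> K"
  shows "sv_left_ideal cst L M Y K \<xi>"
proof (intro sv_left_ideal.intro sv_enveloping_axioms sv_left_ideal_axioms.intro)
  show "L n \<in> K" if "n \<ge> 1" for n using assms(4) that unfolding positive_letters_def by blast
  show "M n \<in> K" if "n \<ge> 1" for n using assms(4) that unfolding positive_letters_def by blast
  show "Y n \<in> K" if "n \<ge> 0" for n using assms(4) that unfolding positive_letters_def by blast
qed (rule assms)+

lemma sv_left_ideal_whittaker:
  assumes "\<xi> \<noteq> 0" shows "sv_left_ideal cst L M Y (whittaker_ideal \<xi>) \<xi>"
  using left_hull_superset[of "insert (M 0 - cst \<xi>) positive_letters"]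
  by (intro sv_left_idealI assms left_ideal_whittaker) (simp_all add: whittaker_ideal_def)

lemma sv_left_ideal_verma:
  assumes "\<xi> \<noteq> 0" shows "sv_left_ideal cst L M Y (verma_ideal \<xi> \<zeta>) \<xi>"
  using left_hull_superset[of "insert (L 0 - cst \<zeta>) (insert (M 0 - cst \<xi>) positive_letters)"]
  by (intro sv_left_idealI assms left_ideal_verma) (simp_all add: verma_ideal_def)

lemma whittaker_ideal_subset_verma_ideal: "whittaker_ideal \<xi> \<subseteq> verma_ideal \<xi> \<zeta>"
  unfolding whittaker_ideal_def verma_ideal_def
  using left_hull_superset[of "insert (L 0 - cst \<zeta>) (insert (M 0 - cst \<xi>) positive_letters)"]
  by (intro left_hull_minimal left_ideal_left_hull) simp

lemma L0_in_verma_ideal: "L 0 - cst \<zeta> \<in> verma_ideal \<xi> \<zeta>"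
  using left_hull_superset[of "insert (L 0 - cst \<zeta>) (insert (M 0 - cst \<xi>) positive_letters)"]
  by (simp add: verma_ideal_def)

lemma verma_ideal_eq: "verma_ideal \<xi> \<zeta> = {a * (L 0 - cst \<zeta>) + k | a k. k \<in> whittaker_ideal \<xi>}"
proof
  let ?h = "L 0 - cst \<zeta>"
  show "verma_ideal \<xi> \<zeta> \<subseteq> {a * ?h + k | a k. k \<in> whittaker_ideal \<xi>}"
    unfolding verma_ideal_def
  proof (rule left_hull_minimal[OF left_ideal_add_multiples[OF left_ideal_whittaker]], intro insert_subsetI)
    show "?h \<in> {a * ?h + k | a k. k \<in> whittaker_ideal \<xi>}"
      using left_idealD(1)[OF left_ideal_whittaker] by (intro CollectI exI[of _ 1] exI[of _ 0]) auto
    have "x \<in> {a * ?h + k | a k. k \<in> whittaker_ideal \<xi>}" if "x \<in> whittaker_ideal \<xi>" for x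
      using that by (intro CollectI exI[of _ 0] exI[of _ x]) auto
    moreover have "insert (M 0 - cst \<xi>) positive_letters \<subseteq> whittaker_ideal \<xi>"
      unfolding whittaker_ideal_def by (rule left_hull_superset)
    ultimately show "M 0 - cst \<xi> \<in> {a * ?h + k | a k. k \<in> whittaker_ideal \<xi>}"
      "positive_letters \<subseteq> {a * ?h + k | a k. k \<in> whittaker_ideal \<xi>}" by auto
  qed
  show "{a * ?h + k | a k. k \<in> whittaker_ideal \<xi>} \<subseteq> verma_ideal \<xi> \<zeta>"
    using whittaker_ideal_subset_verma_ideal[of \<xi> \<zeta>]
    by (auto intro!: left_idealD(2)[OF left_ideal_verma] left_idealD(3)[OF left_ideal_verma L0_in_verma_ideal])
qed

text \<open>Every generator \<open>x\<close> of the ideal satisfies \<open>x L\<^sub>0 = (L\<^sub>0 + a) x\<close> for a scalar \<open>a\<close>.\<close>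

lemma whittaker_ideal_right_mult:
  assumes "x \<in> whittaker_ideal \<xi>"
  shows "x * (L 0 - cst \<zeta>) \<in> whittaker_ideal \<xi>"
proof -
  let ?h = "L 0 - cst \<zeta>" and ?J = "whittaker_ideal \<xi>"
  have J: "left_ideal ?J" by (rule left_ideal_whittaker)
  have sup: "insert (M 0 - cst \<xi>) positive_letters \<subseteq> ?J"
    unfolding whittaker_ideal_def by (rule left_hull_superset)
  have "left_ideal {x. x * ?h \<in> ?J}"
    using left_idealD(1-3)[OF J] by (simp add: left_ideal_def distrib_right mult.assoc)
  moreover have "insert (M 0 - cst \<xi>) positive_letters \<subseteq> {x. x * ?h \<in> ?J}"
  proof
    fix x assume x: "x \<in> insert (M 0 - cst \<xi>) positive_letters"
    have "\<exists>a. x * L 0 = L 0 * x + cst a * x"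
    proof (cases "x = M 0 - cst \<xi>")
      case True
      have "x * L 0 = L 0 * x + cst 0 * x"
        unfolding True using LM[of 0 0] by (simp add: left_diff_distrib right_diff_distrib cst_central[of "L 0"])
      then show ?thesis by blast
    next
      case False
      then consider n where "x = L n" | n where "x = M n" | n where "x = Y n"
        using x by (auto simp: positive_letters_def)
      then show ?thesis
      proof cases
        case 1 then show ?thesis using LL[of _ 0] by auto
      next
        case 2 then show ?thesis using LM'[of _ 0] by auto
      next
        case 3 then show ?thesis using LY'[of _ 0] by auto
      qed
    qed
    then obtain a where "x * L 0 = L 0 * x + cst a * x" by blast
    then have "x * ?h = (L 0 + cst a - cst \<zeta>) * x"
      by (simp add: left_diff_distrib right_diff_distrib distrib_right cst_central[of x])
    then show "x \<in> {x. x * ?h \<in> ?J}" using left_idealD(3)[OF J] x sup by auto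
  qed
  ultimately have "?J \<subseteq> {x. x * ?h \<in> ?J}"
    by (subst whittaker_ideal_def, intro left_hull_minimal)
  then show ?thesis using assms by blast
qed

lemma verma_ideal_evaluate:
  "(\<Sum>i\<le>n. cst (a i) * L 0 ^ i) - cst (\<Sum>i\<le>n. a i * \<zeta> ^ i) \<in> verma_ideal \<xi> \<zeta>"
proof -
  let ?K = "verma_ideal \<xi> \<zeta>"
  have K: "left_ideal ?K" by (rule left_ideal_verma)
  have pow: "L 0 ^ i - cst (\<zeta> ^ i) \<in> ?K" for i
  proof (induction i)
    case 0
    then show ?case by (simp add: cst_1 left_idealD(1)[OF K])
  next
    case (Suc i)
    have "L 0 ^ Suc i - cst (\<zeta> ^ Suc i) = L 0 ^ i * (L 0 - cst \<zeta>) + cst \<zeta> * (L 0 ^ i - cst (\<zeta> ^ i))"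
      by (simp add: right_diff_distrib cst_central[of "L 0 ^ i"] cst_mult power_commutes)
    then show ?case
      using Suc left_idealD(2)[OF K left_idealD(3)[OF K L0_in_verma_ideal] left_idealD(3)[OF K]] by simp
  qed
  have "(\<Sum>i\<le>n. cst (a i) * L 0 ^ i) - cst (\<Sum>i\<le>n. a i * \<zeta> ^ i)
      = (\<Sum>i\<le>n. cst (a i) * (L 0 ^ i - cst (\<zeta> ^ i)))"
    by (simp add: cst_sum cst_mult right_diff_distrib sum_subtractf)
  also have "\<dots> \<in> ?K" by (intro left_ideal_sum[OF K] left_idealD(3)[OF K] pow)
  finally show ?thesis .
qed

text \<open>The reduction ends with a polynomial in \<open>L\<^sub>0\<close>, which is a scalar modulo this ideal; it is nonzero
  because the reduction stays outside the ideal.\<close>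

theorem verma_ideal_maximal:
  assumes "\<xi> \<noteq> 0" "x \<notin> verma_ideal \<xi> \<zeta>"
  shows "\<exists>q. q * x - 1 \<in> verma_ideal \<xi> \<zeta>"
proof -
  let ?K = "verma_ideal \<xi> \<zeta>"
  interpret sv_left_ideal cst L M Y ?K \<xi> by (rule sv_left_ideal_verma[OF assms(1)])
  obtain q z where z: "z \<in> L0_span" "z \<notin> ?K" "q * x - z \<in> ?K"
    using reaches_L0_span[OF assms(2)] by (auto simp: reaches_def)
  obtain n a where "z - (\<Sum>i\<le>n. cst (a i) * L 0 ^ i) \<in> ?K" using L0_span_polynomial[OF z(1)] by blast
  then have zc: "z - cst (\<Sum>i\<le>n. a i * \<zeta> ^ i) \<in> ?K"
    using left_ideal_trans[OF K _ verma_ideal_evaluate] by blast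
  let ?c = "\<Sum>i\<le>n. a i * \<zeta> ^ i"
  have c: "?c \<noteq> 0" using zc z(2) by auto
  have "cst (inverse ?c) * (q * x - cst ?c) \<in> ?K"
    by (rule left_idealD(3)[OF K], rule left_ideal_trans[OF K z(3) zc])
  moreover have "cst (inverse ?c) * (q * x - cst ?c) = cst (inverse ?c) * q * x - 1"
    using c by (simp add: right_diff_distrib mult.assoc cst_mult[symmetric] cst_1)
  ultimately show ?thesis by metis
qed

text \<open>If \<open>x \<notin> J\<close>, a left multiple of \<open>x\<close> is congruent to some \<open>p(L\<^sub>0) \<notin> J\<close>. From \<open>x (L\<^sub>0 - \<zeta>) \<in> J\<close>
  follows \<open>p(L\<^sub>0) (L\<^sub>0 - \<zeta>) \<in> J\<close>, and evaluating in the Verma module of weight \<open>t\<close>, which is nonzero,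
  gives \<open>p(t) (t - \<zeta>) = 0\<close>. A polynomial with infinitely many roots is zero.\<close>

theorem whittaker_ideal_right_cancel:
  assumes \<xi>: "\<xi> \<noteq> 0" and proper: "\<And>\<zeta>. 1 \<notin> verma_ideal \<xi> \<zeta>"
    and x: "x * (L 0 - cst \<zeta>) \<in> whittaker_ideal \<xi>"
  shows "x \<in> whittaker_ideal \<xi>"
proof (rule ccontr)
  let ?J = "whittaker_ideal \<xi>" and ?h = "L 0 - cst \<zeta>"
  interpret sv_left_ideal cst L M Y ?J \<xi> by (rule sv_left_ideal_whittaker[OF \<xi>])
  assume xJ: "x \<notin> ?J"
  then obtain q z where z: "z \<in> L0_span" "z \<notin> ?J" "q * x - z \<in> ?J"
    using reaches_L0_span[OF xJ] by (auto simp: reaches_def)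
  obtain n a where p: "z - (\<Sum>i\<le>n. cst (a i) * L 0 ^ i) \<in> ?J" using L0_span_polynomial[OF z(1)] by blast
  let ?p = "\<Sum>i\<le>n. cst (a i) * L 0 ^ i"
  have "(q * x - ?p) * ?h \<in> ?J"
    by (rule whittaker_ideal_right_mult) (rule left_ideal_trans[OF K z(3) p])
  then have "q * (x * ?h) - (q * x - ?p) * ?h \<in> ?J"
    by (rule left_idealD(5)[OF K left_idealD(3)[OF K x]])
  then have ph: "?p * ?h \<in> ?J" by (simp add: left_diff_distrib mult.assoc)
  have root: "(\<Sum>i\<le>n. a i * t ^ i) = 0" if t: "t \<noteq> \<zeta>" for t
  proof (rule ccontr)
    let ?K = "verma_ideal \<xi> t" and ?c = "\<Sum>i\<le>n. a i * t ^ i"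
    assume c: "?c \<noteq> 0"
    have K': "left_ideal ?K" by (rule left_ideal_verma)
    have "?p * ?h \<in> ?K" using ph whittaker_ideal_subset_verma_ideal by blast
    moreover have "?p * (L 0 - cst t) \<in> ?K" by (rule left_idealD(3)[OF K' L0_in_verma_ideal])
    ultimately have "?p * ?h - ?p * (L 0 - cst t) \<in> ?K" by (rule left_idealD(5)[OF K'])
    also have "?p * ?h - ?p * (L 0 - cst t) = cst (t - \<zeta>) * ?p"
      using cst_add[of "t - \<zeta>" \<zeta>] by (simp add: right_diff_distrib[symmetric] cst_central[of ?p])
    finally have "?p \<in> ?K" using t cst_in_iff[OF K', of "t - \<zeta>"] by simp
    then have "cst ?c \<in> ?K"
      using left_ideal_cong[OF K' verma_ideal_evaluate[of a n t \<xi>]] by blast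
    then have "1 \<in> ?K" using cst_in_iff[OF K' c, of 1] by simp
    then show False using proper by blast
  qed
  have "\<forall>i\<le>n. a i = 0"
  proof (rule ccontr)
    assume "\<not> (\<forall>i\<le>n. a i = 0)"
    then have "finite {t. (\<Sum>i\<le>n. a i * t ^ i) = 0}" using polyfun_finite_roots[of a n] by blast
    moreover have "UNIV - {\<zeta>} \<subseteq> {t. (\<Sum>i\<le>n. a i * t ^ i) = 0}" using root by blast
    ultimately have "finite (UNIV - {\<zeta>})" by (rule finite_subset[rotated])
    then show False using infinite_UNIV_char_0[where 'a=complex] by simp
  qed
  then have "?p = 0" by simp
  then show False using p z(2) by simp
qed

end

section \<open>Straightening words in the basis\<close>

text \<open>The bracket of two basis vectors is a multiple of one basis vector. Where the bracket vanishes
  identically the index is an arbitrary value, only chosen symmetric.\<close>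

fun bracket_index :: "sv_index \<Rightarrow> sv_index \<Rightarrow> sv_index" where
  "bracket_index (Lix m) (Lix n) = Lix (m + n)"
| "bracket_index (Lix m) (Mix n) = Mix (m + n)"
| "bracket_index (Mix m) (Lix n) = Mix (m + n)"
| "bracket_index (Lix m) (Yix n) = Yix (m + n)"
| "bracket_index (Yix m) (Lix n) = Yix (m + n)"
| "bracket_index (Yix m) (Yix n) = Mix (m + n + 1)"
| "bracket_index (Mix m) (Mix n) = Mix 0"
| "bracket_index (Mix m) (Yix n) = Mix 0"
| "bracket_index (Yix m) (Mix n) = Mix 0"

fun bracket_coeff :: "sv_index \<Rightarrow> sv_index \<Rightarrow> complex" where
  "bracket_coeff (Lix m) (Lix n) = of_int (n - m)"
| "bracket_coeff (Lix m) (Mix n) = of_int n"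
| "bracket_coeff (Mix m) (Lix n) = - of_int m"
| "bracket_coeff (Lix m) (Yix n) = of_int n + (1 - of_int m) / 2"
| "bracket_coeff (Yix m) (Lix n) = - (of_int m + (1 - of_int n) / 2)"
| "bracket_coeff (Yix m) (Yix n) = of_int (n - m)"
| "bracket_coeff (Mix m) (Mix n) = 0"
| "bracket_coeff (Mix m) (Yix n) = 0"
| "bracket_coeff (Yix m) (Mix n) = 0"

lemma sv_basis_bracket_single:
  "sv_basis_bracket a b = Poly_Mapping.single (bracket_index a b) (bracket_coeff a b)"
  by (cases a; cases b) (auto simp: sv_scale_def add.commute simp flip: single_uminus)

lemma bracket_index_commute: "bracket_index b a = bracket_index a b"
  by (cases a; cases b) (auto simp: algebra_simps)

lemma bracket_coeff_commute: "bracket_coeff b a = - bracket_coeff a b"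
  by (cases a; cases b) auto

text \<open>The Jacobi identity, in the form in which an arbitrary function of the index replaces the basis
  vector. The third summand is grouped as \<open>[b, [a, c]]\<close> because this is how it arises from the two
  ways of straightening \<open>a b c\<close>.\<close>

lemma bracket_jacobi:
  "bracket_coeff a b * bracket_coeff (bracket_index a b) c * F (bracket_index (bracket_index a b) c)
   + bracket_coeff b c * bracket_coeff (bracket_index b c) a * F (bracket_index (bracket_index b c) a)
   + bracket_coeff a c * bracket_coeff b (bracket_index a c) * F (bracket_index b (bracket_index a c)) = 0"
  for F :: "sv_index \<Rightarrow> complex"
  by (cases a; cases b; cases c) (simp_all add: add_ac field_simps)

text \<open>Any order in which \<open>M\<^sub>0\<close> and \<open>L\<^sub>0\<close>, with keys \<open>0\<close> and \<open>1\<close>, separate the negative letters from the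
  positive ones would do. Positive letters are those with key at least \<open>2\<close>.\<close>

fun key :: "sv_index \<Rightarrow> int" where
  "key (Mix n) = 4 * n"
| "key (Lix n) = 4 * n + 1"
| "key (Yix n) = 4 * n + 2"

lemma key_inject: "key a = key b \<longleftrightarrow> a = b"
  by (cases a; cases b; simp; presburger?)

fun inversions :: "sv_index list \<Rightarrow> nat" where
  "inversions [] = 0"
| "inversions (x # xs) = length (filter (\<lambda>y. key y < key x) xs) + inversions xs"

lemma inversions_swap: "key b < key a \<Longrightarrow> inversions (u @ b # a # v) < inversions (u @ a # b # v)"
  by (induction u) auto

lemma unsorted_inversion:
  "\<not> sorted (map key w) \<Longrightarrow> \<exists>u a b v. w = u @ a # b # v \<and> key b < key a"
proof (induction w)
  case (Cons x xs)
  show ?case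
  proof (cases "sorted (map key xs)")
    case True
    then obtain y ys where xs: "xs = y # ys" using Cons.prems by (cases xs) auto
    have "key y < key x"
      using True Cons.prems by (auto simp: xs)
    then show ?thesis unfolding xs by (intro exI[of _ "[]"]) auto
  next
    case False
    then obtain u a b v where "xs = u @ a # b # v \<and> key b < key a" using Cons.IH by blast
    then show ?thesis by (intro exI[of _ "x # u"]) auto
  qed
qed simp

text \<open>An arbitrary choice of the pair to be exchanged; confluence shows that it does not matter.\<close>

definition an_inversion :: "sv_index list \<Rightarrow> sv_index list \<times> sv_index \<times> sv_index \<times> sv_index list" where
  "an_inversion w = (SOME (u, a, b, v). w = u @ a # b # v \<and> key b < key a)"

definition swapped :: "sv_index list \<Rightarrow> sv_index list" where
  "swapped w = (case an_inversion w of (u, a, b, v) \<Rightarrow> u @ b # a # v)"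

definition merged :: "sv_index list \<Rightarrow> sv_index list" where
  "merged w = (case an_inversion w of (u, a, b, v) \<Rightarrow> u @ bracket_index a b # v)"

definition merge_coeff :: "sv_index list \<Rightarrow> complex" where
  "merge_coeff w = (case an_inversion w of (u, a, b, v) \<Rightarrow> bracket_coeff a b)"

lemma an_inversion:
  assumes "\<not> sorted (map key w)"
  obtains u a b v where "w = u @ a # b # v" "key b < key a" "swapped w = u @ b # a # v"
    "merged w = u @ bracket_index a b # v" "merge_coeff w = bracket_coeff a b"
proof -
  obtain u a b v where t: "an_inversion w = (u, a, b, v)" by (cases "an_inversion w")
  have "\<exists>t. case t of (u, a, b, v) \<Rightarrow> w = u @ a # b # v \<and> key b < key a"
    using unsorted_inversion[OF assms] by auto
  from someI_ex[OF this] have "w = u @ a # b # v \<and> key b < key a"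
    using t by (simp add: an_inversion_def)
  then show ?thesis using that[of u a b v] t by (simp add: swapped_def merged_def merge_coeff_def)
qed

function straighten :: "(sv_index list \<Rightarrow> complex) \<Rightarrow> sv_index list \<Rightarrow> complex" where
  "straighten f w = (if sorted (map key w) then f w
     else straighten f (swapped w) + merge_coeff w * straighten f (merged w))"
  by auto
termination
proof (relation "measures [\<lambda>(f, w). length w, \<lambda>(f, w). inversions w]")
  fix f :: "sv_index list \<Rightarrow> complex" and w
  assume "\<not> sorted (map key w)"
  then obtain u a b v where *: "w = u @ a # b # v" "key b < key a" "swapped w = u @ b # a # v"
    "merged w = u @ bracket_index a b # v" by (rule an_inversion)
  show "((f, swapped w), (f, w)) \<in> measures [\<lambda>(f, w). length w, \<lambda>(f, w). inversions w]"
    using inversions_swap[OF *(2), of u v] unfolding *(3) by (simp add: *(1))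
  show "((f, merged w), (f, w)) \<in> measures [\<lambda>(f, w). length w, \<lambda>(f, w). inversions w]"
    unfolding *(4) by (simp add: *(1))
qed simp

declare straighten.simps [simp del]

lemma inversion_induct [case_names less]:
  assumes "\<And>w. (\<And>w'. length w' < length w \<or> length w' = length w \<and> inversions w' < inversions w \<Longrightarrow> P w') \<Longrightarrow> P w"
  shows "P w"
proof (induction w rule: wf_induct[OF wf_measures[of "[length, inversions]"]])
  case (1 w)
  show ?case
  proof (rule assms)
    fix w' assume "length w' < length w \<or> length w' = length w \<and> inversions w' < inversions w"
    then have "(w', w) \<in> measures [length, inversions]" by auto
    then show "P w'" using 1 by blast
  qed
qed

text \<open>Confluence, by induction on the length and the number of inversions. Two inversions of a word
  are either disjoint, and then the two exchanges commute, or they overlap in \<open>a b c\<close>; then both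
  lead to \<open>c b a\<close> and differ by the left-hand side of the Jacobi identity.\<close>

lemma straighten_inversion:
  "key b < key a \<Longrightarrow> straighten f (u @ a # b # v)
     = straighten f (u @ b # a # v) + bracket_coeff a b * straighten f (u @ bracket_index a b # v)"
proof (induction "u @ a # b # v" arbitrary: u a b v rule: inversion_induct)
  case less
  define w where "w = u @ a # b # v"
  let ?\<phi> = "straighten f"
  let ?val = "\<lambda>u a b v. ?\<phi> (u @ b # a # v) + bracket_coeff a b * ?\<phi> (u @ bracket_index a b # v)"
  have IH: "?\<phi> (u @ a # b # v) = ?val u a b v"
    if "length (u @ a # b # v) < length w \<or> length (u @ a # b # v) = length w \<and> inversions (u @ a # b # v) < inversions w"
      "key b < key a" for u a b v
    using less.hyps that unfolding w_def by blast
  have short: "?\<phi> (u @ a # b # v) = ?val u a b v" if len: "length (u @ a # b # v) < length w" for u a b v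
  proof -
    consider "key b < key a" | "key a < key b" | "a = b" using key_inject[of a b] by linarith
    then show ?thesis
    proof cases
      case 1
      then show ?thesis using IH len by blast
    next
      case 2
      have "length (u @ b # a # v) < length w" using len by simp
      from IH[OF disjI1[OF this] 2] show ?thesis
        by (simp add: bracket_coeff_commute[of b a] bracket_index_commute[of b a])
    next
      case 3
      then show ?thesis using bracket_coeff_commute[of a a] by simp
    qed
  qed
  have confluent: "?val u a b v = ?val u' a' b' v'"
    if w: "w = u @ a # b # v" "key b < key a" "w = u' @ a' # b' # v'" "key b' < key a'"
      and le: "length u \<le> length u'" for u a b v u' a' b' v'
  proof -
    have eq: "u @ a # b # v = u' @ a' # b' # v'" using w by simp
    obtain t where u': "u' = u @ t" and rest: "a # b # v = t @ a' # b' # v'"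
      using le eq by (auto simp: append_eq_append_conv2)
    consider "t = []" | "t = [a]" | s where "t = a # b # s" using rest by (cases t; cases "tl t") auto
    then show ?thesis
    proof cases
      case 1
      then show ?thesis using rest u' by simp
    next
      case 2
      \<comment> \<open>Overlapping inversions: the word contains \<open>a b c\<close> with strictly decreasing keys.\<close>
      define c where "c = b'"
      have r: "a' = b" "v = c # v'" "u' = u @ [a]" "key c < key b"
        using rest 2 u' w(4) by (auto simp: c_def)
      have len: "length (u @ x # y # v') < length w" for x y using w(1) r by simp
      have lenw: "length (u @ x # y # z # v') = length w" for x y z using w(1) r by simp
      have i1: "inversions (u @ b # a # c # v') < inversions w"
        using inversions_swap[OF w(2), of u v] w(1) r by simp
      have i2: "inversions (u @ a # c # b # v') < inversions w"
        using inversions_swap[OF r(4), of "u @ [a]" v'] w(1) r by simp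
      have ac: "key c < key a" using w(2) r(4) by simp
      have i3: "inversions (u @ b # c # a # v') < inversions w"
        using inversions_swap[OF ac, of "u @ [b]" v'] i1 by simp
      have i4: "inversions (u @ c # a # b # v') < inversions w"
        using inversions_swap[OF ac, of u "b # v'"] i2 by simp
      have e1: "?\<phi> (u @ b # a # c # v') = ?\<phi> (u @ b # c # a # v') + bracket_coeff a c * ?\<phi> (u @ b # bracket_index a c # v')"
        using IH[of "u @ [b]" a c v'] i1 lenw ac by simp
      have e2: "?\<phi> (u @ b # c # a # v') = ?\<phi> (u @ c # b # a # v') + bracket_coeff b c * ?\<phi> (u @ bracket_index b c # a # v')"
        using IH[of u b c "a # v'"] i3 lenw r by simp
      have e3: "?\<phi> (u @ a # c # b # v') = ?\<phi> (u @ c # a # b # v') + bracket_coeff a c * ?\<phi> (u @ bracket_index a c # b # v')"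
        using IH[of u a c "b # v'"] i2 lenw ac by simp
      have e4: "?\<phi> (u @ c # a # b # v') = ?\<phi> (u @ c # b # a # v') + bracket_coeff a b * ?\<phi> (u @ c # bracket_index a b # v')"
        using IH[of "u @ [c]" a b v'] i4 lenw w(2) by simp
      have "?val u a b v - ?val u' a' b' v'
        = bracket_coeff a b * (?\<phi> (u @ bracket_index a b # c # v') - ?\<phi> (u @ c # bracket_index a b # v'))
        + bracket_coeff b c * (?\<phi> (u @ bracket_index b c # a # v') - ?\<phi> (u @ a # bracket_index b c # v'))
        + bracket_coeff a c * (?\<phi> (u @ b # bracket_index a c # v') - ?\<phi> (u @ bracket_index a c # b # v'))"
        unfolding r c_def[symmetric] append_assoc append.simps e1 e2 e3 e4 by (simp add: algebra_simps)
      also have "\<dots> = 0"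
        unfolding short[OF len, of "bracket_index a b" c] short[OF len, of "bracket_index b c" a]
          short[OF len, of b "bracket_index a c"]
        using bracket_jacobi[of a b c "\<lambda>x. ?\<phi> (u @ x # v')"] by (simp add: algebra_simps)
      finally show ?thesis by simp
    next
      case 3
      have r: "v = s @ a' # b' # v'" "u' = u @ a # b # s" using rest 3 u' by auto
      have i1: "inversions (u @ b # a # s @ a' # b' # v') < inversions w"
        using inversions_swap[OF w(2), of u v] w(1) r by simp
      have i2: "inversions (u @ a # b # s @ b' # a' # v') < inversions w"
        using inversions_swap[OF w(4), of u' v'] w(3) r by simp
      have e1: "?\<phi> (u @ b # a # s @ a' # b' # v') = ?\<phi> (u @ b # a # s @ b' # a' # v')
          + bracket_coeff a' b' * ?\<phi> (u @ b # a # s @ bracket_index a' b' # v')"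
        using IH[of "u @ b # a # s" a' b' v'] i1 w r by simp
      have e2: "?\<phi> (u @ a # b # s @ b' # a' # v') = ?\<phi> (u @ b # a # s @ b' # a' # v')
          + bracket_coeff a b * ?\<phi> (u @ bracket_index a b # s @ b' # a' # v')"
        using IH[of u a b "s @ b' # a' # v'"] i2 w r by simp
      have e3: "?\<phi> (u @ bracket_index a b # s @ a' # b' # v') = ?\<phi> (u @ bracket_index a b # s @ b' # a' # v')
          + bracket_coeff a' b' * ?\<phi> (u @ bracket_index a b # s @ bracket_index a' b' # v')"
        using short[of "u @ bracket_index a b # s" a' b' v'] w r by simp
      have e4: "?\<phi> (u @ a # b # s @ bracket_index a' b' # v') = ?\<phi> (u @ b # a # s @ bracket_index a' b' # v')
          + bracket_coeff a b * ?\<phi> (u @ bracket_index a b # s @ bracket_index a' b' # v')"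
        using short[of u a b "s @ bracket_index a' b' # v'"] w r by simp
      show ?thesis unfolding r append_assoc append.simps e1 e2 e3 e4 by (simp add: algebra_simps)
    qed
  qed
  have "\<not> sorted (map key w)" using less.prems by (auto simp: w_def sorted_append)
  then obtain u' a' b' v' where *: "w = u' @ a' # b' # v'" "key b' < key a'" "swapped w = u' @ b' # a' # v'"
    "merged w = u' @ bracket_index a' b' # v'" "merge_coeff w = bracket_coeff a' b'"
    by (rule an_inversion)
  have "?\<phi> w = ?val u' a' b' v'"
    using \<open>\<not> sorted (map key w)\<close> by (subst straighten.simps) (simp add: *(3-5))
  also have "\<dots> = ?val u a b v"
    using confluent[OF w_def less.prems *(1,2)] confluent[OF *(1,2) w_def less.prems] by (metis nat_le_linear)
  finally show ?case by (simp add: w_def)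
qed

lemma straighten_swap:
  "straighten f (u @ a # b # v)
     = straighten f (u @ b # a # v) + bracket_coeff a b * straighten f (u @ bracket_index a b # v)"
proof -
  consider "key b < key a" | "key a < key b" | "a = b" using key_inject[of a b] by linarith
  then show ?thesis
  proof cases
    case 1
    then show ?thesis by (rule straighten_inversion)
  next
    case 2
    from straighten_inversion[OF 2, of f u v] show ?thesis
      by (simp add: bracket_coeff_commute[of b a] bracket_index_commute[of b a])
  next
    case 3
    then show ?thesis using bracket_coeff_commute[of a a] by simp
  qed
qed

fun vacuum_weight :: "complex \<Rightarrow> complex \<Rightarrow> sv_index \<Rightarrow> complex" where
  "vacuum_weight \<xi> \<zeta> (Lix n) = (if n = 0 then \<zeta> else 0)"
| "vacuum_weight \<xi> \<zeta> (Mix n) = (if n = 0 then \<xi> else 0)"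
| "vacuum_weight \<xi> \<zeta> (Yix n) = 0"

text \<open>The vacuum expectation value of a word on the Verma module with parameters \<open>\<xi>\<close> and \<open>\<zeta>\<close>: the
  coefficient of the highest weight vector in the image of that vector.\<close>

definition vacuum :: "complex \<Rightarrow> complex \<Rightarrow> sv_index list \<Rightarrow> complex" where
  "vacuum \<xi> \<zeta> = straighten (\<lambda>w. \<Prod>a\<leftarrow>w. vacuum_weight \<xi> \<zeta> a)"

lemma vacuum_swap:
  "vacuum \<xi> \<zeta> (u @ a # b # v)
     = vacuum \<xi> \<zeta> (u @ b # a # v) + bracket_coeff a b * vacuum \<xi> \<zeta> (u @ bracket_index a b # v)"
  unfolding vacuum_def by (rule straighten_swap)

lemma vacuum_sorted: "sorted (map key w) \<Longrightarrow> vacuum \<xi> \<zeta> w = (\<Prod>a\<leftarrow>w. vacuum_weight \<xi> \<zeta> a)"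
  unfolding vacuum_def by (simp add: straighten.simps)

lemma key_bracket_positive:
  "key a \<ge> 2 \<Longrightarrow> key b \<ge> 1 \<Longrightarrow> bracket_coeff a b = 0 \<or> key (bracket_index a b) \<ge> 2"
  by (cases a; cases b) auto

lemma vacuum_weight_positive: "key x \<ge> 2 \<Longrightarrow> vacuum_weight \<xi> \<zeta> x = 0"
  by (cases x) auto

text \<open>The last letter stays positive during the straightening: it can only be exchanged with a
  larger letter, which is positive too, as is the bracket of the two.\<close>

lemma vacuum_positive: "key x \<ge> 2 \<Longrightarrow> vacuum \<xi> \<zeta> (w @ [x]) = 0"
proof (induction "w @ [x]" arbitrary: w x rule: inversion_induct)
  case less
  show ?case
  proof (cases "sorted (map key (w @ [x]))")
    case True
    show ?thesis unfolding vacuum_sorted[OF True] using less.prems by (simp add: vacuum_weight_positive)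
  next
    case False
    then obtain u a b v where inv: "w @ [x] = u @ a # b # v" "key b < key a"
      using unsorted_inversion by blast
    have swap: "inversions (u @ b # a # v) < inversions (w @ [x])"
      unfolding inv(1) by (rule inversions_swap[OF inv(2)])
    have len: "length (w @ [x]) = length u + 2 + length v" using arg_cong[OF inv(1), of length] by simp
    have eq: "vacuum \<xi> \<zeta> (w @ [x]) = vacuum \<xi> \<zeta> (u @ b # a # v) + bracket_coeff a b * vacuum \<xi> \<zeta> (u @ bracket_index a b # v)"
      unfolding inv(1) by (rule vacuum_swap)
    show ?thesis
    proof (cases v rule: rev_cases)
      case Nil
      then have x: "x = b" "w = u @ [a]" using inv(1) by auto
      have "key a \<ge> 2" using inv(2) less.prems x by simp
      have "vacuum \<xi> \<zeta> ((u @ [b]) @ [a]) = 0"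
        using less.hyps[of "u @ [b]" a] swap len Nil \<open>key a \<ge> 2\<close> by simp
      moreover have "bracket_coeff a b * vacuum \<xi> \<zeta> (u @ [bracket_index a b]) = 0"
        using less.hyps[of u "bracket_index a b"] key_bracket_positive[of a b] len Nil \<open>key a \<ge> 2\<close> less.prems x by auto
      ultimately show ?thesis using eq Nil by simp
    next
      case (snoc v' y)
      then have y: "y = x" using inv(1) by simp
      have "vacuum \<xi> \<zeta> ((u @ b # a # v') @ [x]) = 0" "vacuum \<xi> \<zeta> ((u @ bracket_index a b # v') @ [x]) = 0"
        using less.hyps[of "u @ b # a # v'" x] less.hyps[of "u @ bracket_index a b # v'" x] swap len snoc y less.prems by simp_all
      then show ?thesis using eq snoc y by simp
    qed
  qed
qed

text \<open>Straightening \<open>w\<close> inside \<open>w @ [x]\<close> reduces assertions on the last letter to increasing words \<open>w\<close>.\<close>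

lemma vacuum_step:
  assumes unsorted: "\<not> sorted (map key w)"
    and IH: "\<And>w'. length w' < length w \<or> length w' = length w \<and> inversions w' < inversions w
      \<Longrightarrow> vacuum \<xi> \<zeta> (w' @ [x]) = c * vacuum \<xi> \<zeta> w'"
  shows "vacuum \<xi> \<zeta> (w @ [x]) = c * vacuum \<xi> \<zeta> w"
proof -
  obtain u a b v where w: "w = u @ a # b # v" "key b < key a"
    using unsorted_inversion[OF unsorted] by blast
  have "vacuum \<xi> \<zeta> (w @ [x]) = vacuum \<xi> \<zeta> ((u @ b # a # v) @ [x]) + bracket_coeff a b * vacuum \<xi> \<zeta> ((u @ bracket_index a b # v) @ [x])"
    using vacuum_swap[of \<xi> \<zeta> u a b "v @ [x]"] by (simp add: w(1))
  also have "vacuum \<xi> \<zeta> ((u @ b # a # v) @ [x]) = c * vacuum \<xi> \<zeta> (u @ b # a # v)"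
    by (rule IH) (use inversions_swap[OF w(2), of u v] in \<open>simp add: w(1)\<close>)
  also have "vacuum \<xi> \<zeta> ((u @ bracket_index a b # v) @ [x]) = c * vacuum \<xi> \<zeta> (u @ bracket_index a b # v)"
    by (rule IH) (simp add: w(1))
  finally show ?thesis by (simp add: w(1) vacuum_swap[of \<xi> \<zeta> u a b v] algebra_simps)
qed

lemma vacuum_L0: "vacuum \<xi> \<zeta> (w @ [Lix 0]) = \<zeta> * vacuum \<xi> \<zeta> w"
proof (induction w rule: inversion_induct)
  case (less w)
  show ?case
  proof (cases "sorted (map key w)")
    case sorted: True
    show ?thesis
    proof (cases "sorted (map key (w @ [Lix 0]))")
      case True
      show ?thesis unfolding vacuum_sorted[OF True] vacuum_sorted[OF sorted] by simp
    next
      case False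
      then obtain w' a where w: "w = w' @ [a]" using sorted by (cases w rule: rev_cases) auto
      have a: "key a > 1"
      proof (rule ccontr)
        assume "\<not> key a > 1"
        then have "sorted (map key (w @ [Lix 0]))" using sorted by (force simp: w sorted_append)
        then show False using False by simp
      qed
      have "vacuum \<xi> \<zeta> (w' @ a # Lix 0 # []) = 0"
        unfolding vacuum_swap[of _ _ w' a "Lix 0"]
        using vacuum_positive[of a \<xi> \<zeta> "w' @ [Lix 0]"] vacuum_positive[of _ \<xi> \<zeta> w']
          key_bracket_positive[of a "Lix 0"] a by auto
      moreover have "vacuum \<xi> \<zeta> w = 0" using vacuum_positive a by (simp add: w)
      ultimately show ?thesis by (simp add: w)
    qed
  next
    case False
    then show ?thesis using less by (rule vacuum_step)
  qed
qed

lemma vacuum_M0: "vacuum \<xi> \<zeta> (w @ [Mix 0]) = \<xi> * vacuum \<xi> \<zeta> w"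
proof (induction w rule: inversion_induct)
  case (less w)
  show ?case
  proof (cases "sorted (map key w)")
    case sorted: True
    show ?thesis
    proof (cases "sorted (map key (w @ [Mix 0]))")
      case True
      show ?thesis unfolding vacuum_sorted[OF True] vacuum_sorted[OF sorted] by simp
    next
      case False
      then obtain w' a where w: "w = w' @ [a]" using sorted by (cases w rule: rev_cases) auto
      have "key a > 0"
      proof (rule ccontr)
        assume "\<not> key a > 0"
        then have "sorted (map key (w @ [Mix 0]))" using sorted by (force simp: w sorted_append)
        then show False using False by simp
      qed
      then have a: "key a \<ge> 2 \<or> a = Lix 0" using key_inject[of a "Lix 0"] by (cases "key a = 1") auto
      have "bracket_coeff a (Mix 0) = 0" by (cases a) auto
      then have swap: "vacuum \<xi> \<zeta> (w @ [Mix 0]) = vacuum \<xi> \<zeta> ((w' @ [Mix 0]) @ [a])"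
        using vacuum_swap[of \<xi> \<zeta> w' a "Mix 0" "[]"] by (simp add: w)
      from a show ?thesis
      proof
        assume "key a \<ge> 2"
        then show ?thesis unfolding swap using vacuum_positive[of a \<xi> \<zeta>] by (simp add: w del: append_assoc)
      next
        assume L: "a = Lix 0"
        have "vacuum \<xi> \<zeta> (w' @ [Mix 0]) = \<xi> * vacuum \<xi> \<zeta> w'" by (rule less) (simp add: w)
        then show ?thesis unfolding swap L vacuum_L0 by (simp add: w L vacuum_L0)
      qed
    qed
  next
    case False
    then show ?thesis using less by (rule vacuum_step)
  qed
qed

section \<open>The vacuum functional on the free algebra\<close>

lemma poly_mapping_sum_induct [case_names zero single add]:
  fixes p :: "'a \<Rightarrow>\<^sub>0 'b::comm_monoid_add"
  assumes "P 0" "\<And>k v. P (Poly_Mapping.single k v)" "\<And>p q. P p \<Longrightarrow> P q \<Longrightarrow> P (p + q)"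
  shows "P p"
proof (induction p rule: update_induct)
  case (update f a b)
  have "Poly_Mapping.update a b f = Poly_Mapping.single a b + f"
    using update(1) by (intro poly_mapping_eqI)
      (auto simp: lookup_update lookup_add lookup_single when_def in_keys_iff)
  then show ?case using assms update by simp
qed (rule assms)

definition linear_ext :: "('a \<Rightarrow> complex) \<Rightarrow> ('a \<Rightarrow>\<^sub>0 complex) \<Rightarrow> complex" where
  "linear_ext h p = (\<Sum>k\<in>Poly_Mapping.keys p. Poly_Mapping.lookup p k * h k)"

lemma linear_ext_add: "linear_ext h (p + q) = linear_ext h p + linear_ext h q"
  unfolding linear_ext_def by (rule setsum_keys_plus_distrib) (simp_all add: distrib_right)

lemma linear_ext_single [simp]: "linear_ext h (Poly_Mapping.single k c) = c * h k"
  by (simp add: linear_ext_def)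

lemma linear_ext_zero [simp]: "linear_ext h 0 = 0"
  by (simp add: linear_ext_def)

lemma linear_ext_minus: "linear_ext h (- p) = - linear_ext h p"
  using minus_unique[of "linear_ext h p" "linear_ext h (- p)"] linear_ext_add[of h p "- p"] by simp

lemma linear_ext_diff: "linear_ext h (p - q) = linear_ext h p - linear_ext h q"
  using linear_ext_add[of h p "- q"] by (simp add: linear_ext_minus)

lemma linear_ext_sum: "linear_ext h (\<Sum>i\<in>I. p i) = (\<Sum>i\<in>I. linear_ext h (p i))"
  by (induction I rule: infinite_finite_induct) (simp_all add: linear_ext_add)

lemma sv_scale_single [simp]: "sv_scale c (Poly_Mapping.single i x) = Poly_Mapping.single i (c * x)"
  by (simp add: sv_scale_def)

lemma lookup_sv_scale: "Poly_Mapping.lookup (sv_scale c x) i = c * Poly_Mapping.lookup x i"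
  by (simp add: sv_scale_def map.rep_eq when_def)

lemma sv_scale_add: "sv_scale c (x + y) = sv_scale c x + sv_scale c y"
  by (intro poly_mapping_eqI) (simp add: lookup_sv_scale lookup_add distrib_left)

lemma sv_scale_zero: "sv_scale c 0 = 0"
  by (intro poly_mapping_eqI) (simp add: lookup_sv_scale)

lemma linear_ext_sv_scale: "linear_ext h (sv_scale c x) = c * linear_ext h x"
  by (induction x rule: poly_mapping_sum_induct)
    (simp_all add: sv_scale_zero sv_scale_add linear_ext_add distrib_left)

lemma linear_ext_linear:
  "linear_ext (\<lambda>k. g k + c * h k) p = linear_ext g p + c * linear_ext h p"
  by (simp add: linear_ext_def sum.distrib sum_distrib_left algebra_simps)

lemma linear_ext_commute:
  "linear_ext (\<lambda>a. linear_ext (\<lambda>b. g a b) y) x = linear_ext (\<lambda>b. linear_ext (\<lambda>a. g a b) x) y"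
  unfolding linear_ext_def sum_distrib_left by (subst sum.swap) (simp add: algebra_simps)

lemma linear_ext_sv_bracket:
  "linear_ext h (sv_bracket x y)
     = linear_ext (\<lambda>a. linear_ext (\<lambda>b. bracket_coeff a b * h (bracket_index a b)) y) x"
  unfolding sv_bracket_def linear_ext_sum linear_ext_sv_scale sv_basis_bracket_single linear_ext_single
  by (simp add: linear_ext_def sum_distrib_left mult.assoc)

text \<open>The letters of the free algebra are all elements of \<open>sv\<close>, not only basis vectors, so functions
  of words in the basis have to be extended linearly in every letter.\<close>

fun multilinear_ext :: "(sv_index list \<Rightarrow> complex) \<Rightarrow> sv list \<Rightarrow> complex" where
  "multilinear_ext \<phi> [] = \<phi> []"
| "multilinear_ext \<phi> (x # xs) = linear_ext (\<lambda>a. multilinear_ext (\<lambda>w. \<phi> (a # w)) xs) x"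

lemma multilinear_ext_linear:
  "multilinear_ext (\<lambda>w. \<phi> w + c * \<chi> w) xs = multilinear_ext \<phi> xs + c * multilinear_ext \<chi> xs"
  by (induction xs arbitrary: \<phi> \<chi>) (simp_all add: linear_ext_linear)

lemma multilinear_ext_add:
  "multilinear_ext \<phi> (u @ (x + y) # v) = multilinear_ext \<phi> (u @ x # v) + multilinear_ext \<phi> (u @ y # v)"
proof (induction u arbitrary: \<phi>)
  case (Cons z u)
  then show ?case using linear_ext_linear[where c = 1] by simp
qed (simp add: linear_ext_add)

lemma linear_ext_cmult: "linear_ext (\<lambda>k. c * h k) p = c * linear_ext h p"
  using linear_ext_linear[of "\<lambda>_. 0" c h p] by (simp add: linear_ext_def)

lemma multilinear_ext_scale:
  "multilinear_ext \<phi> (u @ sv_scale c x # v) = c * multilinear_ext \<phi> (u @ x # v)"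
  by (induction u arbitrary: \<phi>) (simp_all add: linear_ext_sv_scale linear_ext_cmult)

text \<open>The exchange rule for basis vectors is bilinear in the two letters exchanged.\<close>

lemma multilinear_ext_bracket:
  assumes "\<And>u a b v. \<phi> (u @ a # b # v) = \<phi> (u @ b # a # v) + bracket_coeff a b * \<phi> (u @ bracket_index a b # v)"
  shows "multilinear_ext \<phi> (u @ x # y # v)
    = multilinear_ext \<phi> (u @ y # x # v) + multilinear_ext \<phi> (u @ sv_bracket x y # v)"
  using assms
proof (induction u arbitrary: \<phi>)
  case Nil
  have swap: "multilinear_ext (\<lambda>w. \<phi> (a # b # w)) v = multilinear_ext (\<lambda>w. \<phi> (b # a # w)) v
      + 1 * (bracket_coeff a b * multilinear_ext (\<lambda>w. \<phi> (bracket_index a b # w)) v)" for a b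
  proof -
    have eq: "(\<lambda>w. \<phi> (a # b # w)) = (\<lambda>w. \<phi> (b # a # w) + bracket_coeff a b * \<phi> (bracket_index a b # w))"
      using Nil[of "[]" a b] by (intro ext) simp
    show ?thesis unfolding eq multilinear_ext_linear mult_1 ..
  qed
  have "multilinear_ext \<phi> (x # y # v) = linear_ext (\<lambda>a. linear_ext (\<lambda>b. multilinear_ext (\<lambda>w. \<phi> (a # b # w)) v) y) x"
    by simp
  also have "\<dots> = linear_ext (\<lambda>a. linear_ext (\<lambda>b. multilinear_ext (\<lambda>w. \<phi> (b # a # w)) v) y
        + 1 * linear_ext (\<lambda>b. bracket_coeff a b * multilinear_ext (\<lambda>w. \<phi> (bracket_index a b # w)) v) y) x"
    unfolding linear_ext_linear[symmetric]
    by (intro arg_cong[where f = "\<lambda>h. linear_ext h x"] arg_cong[where f = "\<lambda>h. linear_ext h y"] ext swap)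
  also have "\<dots> = multilinear_ext \<phi> (y # x # v) + multilinear_ext \<phi> (sv_bracket x y # v)"
    unfolding linear_ext_linear unfolding mult_1 multilinear_ext.simps linear_ext_sv_bracket
    by (rule arg_cong2[where f = "(+)", OF linear_ext_commute refl])
  finally show ?case by simp
next
  case (Cons z u)
  have "multilinear_ext (\<lambda>w. \<phi> (a # w)) (u @ x # y # v)
    = multilinear_ext (\<lambda>w. \<phi> (a # w)) (u @ y # x # v) + multilinear_ext (\<lambda>w. \<phi> (a # w)) (u @ sv_bracket x y # v)" for a
  proof (rule Cons.IH)
    fix u' a' b' v'
    show "\<phi> (a # u' @ a' # b' # v') = \<phi> (a # u' @ b' # a' # v')
        + bracket_coeff a' b' * \<phi> (a # u' @ bracket_index a' b' # v')"
      using Cons.prems[of "a # u'" a' b' v'] by (simp only: append.simps)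
  qed
  then show ?case
    using linear_ext_linear[where c = 1, of _ _ z] by simp
qed

lemma multilinear_ext_last:
  assumes "\<And>w a. a \<in> Poly_Mapping.keys x \<Longrightarrow> \<phi> (w @ [a]) = c * \<phi> w"
  shows "multilinear_ext \<phi> (u @ [x]) = c * linear_ext (\<lambda>_. 1) x * multilinear_ext \<phi> u"
  using assms
proof (induction u arbitrary: \<phi>)
  case Nil
  have "linear_ext (\<lambda>a. \<phi> [a]) x = linear_ext (\<lambda>a. (c * \<phi> []) * 1) x"
    unfolding linear_ext_def using Nil[of _ "[]"] by (intro sum.cong) auto
  then show ?case by (simp only: append.simps multilinear_ext.simps linear_ext_cmult) simp
next
  case (Cons z u)
  have "multilinear_ext (\<lambda>w. \<phi> (a # w)) (u @ [x])
      = c * linear_ext (\<lambda>_. 1) x * multilinear_ext (\<lambda>w. \<phi> (a # w)) u" for a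
    using Cons.prems[of _ "a # _"] by (intro Cons.IH) simp
  then show ?case by (simp add: linear_ext_cmult)
qed

lemma ring_free_alg: "ring (free_alg g)"
proof (intro ringI abelian_groupI monoidI)
  fix x y assume "x \<in> carrier (free_alg g)" "y \<in> carrier (free_alg g)"
  then show "x \<oplus>\<^bsub>free_alg g\<^esub> y \<in> carrier (free_alg g)" "x \<otimes>\<^bsub>free_alg g\<^esub> y \<in> carrier (free_alg g)"
    using keys_add[of x y] keys_mult[of x y] by (fastforce simp: free_alg_def plus_free_word_def)+
next
  fix x assume "x \<in> carrier (free_alg g)"
  then have "- x \<in> carrier (free_alg g)" by (auto simp: free_alg_def in_keys_iff)
  then show "\<exists>y\<in>carrier (free_alg g). y \<oplus>\<^bsub>free_alg g\<^esub> x = \<zero>\<^bsub>free_alg g\<^esub>"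
    by (intro bexI[of _ "- x"]) (simp_all add: free_alg_def)
qed (auto simp: free_alg_def zero_free_word_def algebra_simps)

lemma carrier_free_alg_UNIV [simp]: "carrier (free_alg UNIV) = UNIV"
  by (simp add: free_alg_def)

lemma free_alg_simps [simp]:
  "monoid.mult (free_alg g) = (*)" "one (free_alg g) = 1" "zero (free_alg g) = 0" "add (free_alg g) = (+)"
  by (simp_all add: free_alg_def)

lemma ideal_uea: "ideal (uea_ideal UNIV) (free_alg UNIV)"
  unfolding uea_ideal_def by (intro ring.genideal_ideal ring_free_alg) simp

lemma uea_rels_subset: "uea_rels UNIV \<subseteq> uea_ideal UNIV"
  unfolding uea_ideal_def by (intro ring.genideal_self ring_free_alg) simp

interpretation Usv: ring Usv
  unfolding uea_def by (rule ideal.quotient_is_ring[OF ideal_uea])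

definition vacuum_functional :: "complex \<Rightarrow> complex \<Rightarrow> sv nc_poly \<Rightarrow> complex" where
  "vacuum_functional \<xi> \<zeta> = linear_ext (\<lambda>w. multilinear_ext (vacuum \<xi> \<zeta>) (letters w))"

lemma letters_simps [simp]: "letters (v + w) = letters v @ letters w" "letters 0 = []"
  by (simp_all add: plus_free_word_def zero_free_word_def)

text \<open>The three kinds of relations correspond to additivity, homogeneity and the exchange rule of the
  multilinear extension.\<close>

lemma vacuum_functional_rels:
  assumes "r \<in> uea_rels UNIV"
  shows "vacuum_functional \<xi> \<zeta> (p * r * q) = 0"
proof (induction p rule: poly_mapping_sum_induct)
  case (single u c)
  show ?case
  proof (induction q rule: poly_mapping_sum_induct)
    case (single v d)
    show ?case
      using assms unfolding uea_rels_def
    proof (elim UnE CollectE exE conjE)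
      fix x y assume r: "r = nc_var (x + y) - nc_var x - nc_var y"
      show ?thesis
        by (simp add: r vacuum_functional_def nc_var_def left_diff_distrib right_diff_distrib mult_single
            linear_ext_diff multilinear_ext_add distrib_left)
    next
      fix a x assume r: "r = nc_var (sv_scale a x) - nc_const a * nc_var x"
      show ?thesis
        by (simp add: r vacuum_functional_def nc_var_def nc_const_def left_diff_distrib right_diff_distrib mult_single
            linear_ext_diff multilinear_ext_scale)
    next
      fix x y assume r: "r = nc_var x * nc_var y - nc_var y * nc_var x - nc_var (sv_bracket x y)"
      show ?thesis
        using multilinear_ext_bracket[OF vacuum_swap[of \<xi> \<zeta>], where u = "letters u" and x = x and y = y and v = "letters v"]
        by (simp add: r vacuum_functional_def nc_var_def left_diff_distrib right_diff_distrib mult_single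
            linear_ext_diff distrib_left)
    qed
  qed (simp_all add: distrib_left vacuum_functional_def linear_ext_add)
qed (simp_all add: distrib_right vacuum_functional_def linear_ext_add)

lemma ideal_free_algI:
  assumes "0 \<in> S" "\<And>x y. x \<in> S \<Longrightarrow> y \<in> S \<Longrightarrow> x + y \<in> S" "\<And>x. x \<in> S \<Longrightarrow> - x \<in> S"
    "S \<subseteq> carrier (free_alg g)"
    "\<And>a x. x \<in> S \<Longrightarrow> a \<in> carrier (free_alg g) \<Longrightarrow> a * x \<in> S"
    "\<And>a x. x \<in> S \<Longrightarrow> a \<in> carrier (free_alg g) \<Longrightarrow> x * a \<in> S"
  shows "ideal S (free_alg g)"
proof (intro idealI ring_free_alg)
  interpret ring "free_alg g" by (rule ring_free_alg)
  have "\<ominus>\<^bsub>free_alg g\<^esub> x \<in> S" if "x \<in> S" for x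
    using assms(3)[OF that] that assms(4)
    by (subst minus_equality[of "- x"]) auto
  then show "subgroup S (add_monoid (free_alg g))"
    using assms by (intro add.subgroupI) (auto simp: a_inv_def)
qed (use assms in auto)

lemma vacuum_functional_uea_ideal:
  assumes "x \<in> uea_ideal UNIV" shows "vacuum_functional \<xi> \<zeta> x = 0"
proof -
  let ?S = "{x. \<forall>p q. vacuum_functional \<xi> \<zeta> (p * x * q) = 0}"
  have "ideal ?S (free_alg UNIV)"
  proof (rule ideal_free_algI)
    fix a x assume "x \<in> ?S"
    then have "vacuum_functional \<xi> \<zeta> ((p * a) * x * q) = 0" "vacuum_functional \<xi> \<zeta> (p * x * (a * q)) = 0" for p q
      by blast+
    then show "a * x \<in> ?S" "x * a \<in> ?S" by (simp_all add: mult.assoc)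
  qed (auto simp: vacuum_functional_def distrib_left distrib_right linear_ext_add linear_ext_minus)
  moreover have "uea_rels UNIV \<subseteq> ?S" using vacuum_functional_rels by blast
  ultimately have "uea_ideal UNIV \<subseteq> ?S"
    unfolding uea_ideal_def by (rule ring.genideal_minimal[OF ring_free_alg])
  then have "vacuum_functional \<xi> \<zeta> (1 * x * 1) = 0" using assms by blast
  then show ?thesis by simp
qed

lemma vacuum_functional_one: "vacuum_functional \<xi> \<zeta> 1 = 1"
  unfolding vacuum_functional_def single_one[symmetric] linear_ext_single
  by (simp add: vacuum_sorted)

lemma vacuum_functional_last:
  assumes "\<And>w a. a \<in> Poly_Mapping.keys x \<Longrightarrow> vacuum \<xi> \<zeta> (w @ [a]) = c * vacuum \<xi> \<zeta> w"
  shows "vacuum_functional \<xi> \<zeta> (p * nc_var x) = c * linear_ext (\<lambda>_. 1) x * vacuum_functional \<xi> \<zeta> p"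
proof (induction p rule: poly_mapping_sum_induct)
  case (single w d)
  then show ?case
    using multilinear_ext_last[OF assms, where u = "letters w"]
    by (simp add: vacuum_functional_def nc_var_def mult_single)
qed (simp_all add: vacuum_functional_def distrib_right distrib_left linear_ext_add)

section \<open>The enveloping algebra as a type\<close>

text \<open>As an instance of the class of rings, the enveloping algebra admits calculation with the
  relations as equations. The class requires \<open>1 \<noteq> 0\<close>, which the vacuum functional provides.\<close>

typedef usv = "carrier Usv" by blast

lemma Usv_one_not_zero: "\<one>\<^bsub>Usv\<^esub> \<noteq> \<zero>\<^bsub>Usv\<^esub>"
proof
  interpret ideal "uea_ideal UNIV" "free_alg UNIV" by (rule ideal_uea)
  assume "\<one>\<^bsub>Usv\<^esub> = \<zero>\<^bsub>Usv\<^esub>"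
  then have "uea_ideal UNIV +>\<^bsub>free_alg UNIV\<^esub> 1 = uea_ideal UNIV"
    by (simp add: uea_def FactRing_def)
  then have "1 \<in> uea_ideal UNIV"
    using a_rcos_self[of 1] by simp
  then show False using vacuum_functional_uea_ideal[of 1 0 0] by (simp add: vacuum_functional_one)
qed

instantiation usv :: ring_1
begin

definition "(0::usv) = Abs_usv \<zero>\<^bsub>Usv\<^esub>"
definition "(1::usv) = Abs_usv \<one>\<^bsub>Usv\<^esub>"
definition "(x::usv) + y = Abs_usv (Rep_usv x \<oplus>\<^bsub>Usv\<^esub> Rep_usv y)"
definition "(x::usv) * y = Abs_usv (Rep_usv x \<otimes>\<^bsub>Usv\<^esub> Rep_usv y)"
definition "- (x::usv) = Abs_usv (\<ominus>\<^bsub>Usv\<^esub> Rep_usv x)"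
definition "(x::usv) - y = Abs_usv (Rep_usv x \<ominus>\<^bsub>Usv\<^esub> Rep_usv y)"

lemma Rep_usv_simps:
  "Rep_usv 0 = \<zero>\<^bsub>Usv\<^esub>" "Rep_usv 1 = \<one>\<^bsub>Usv\<^esub>"
  "Rep_usv (x + y) = Rep_usv x \<oplus>\<^bsub>Usv\<^esub> Rep_usv y"
  "Rep_usv (x * y) = Rep_usv x \<otimes>\<^bsub>Usv\<^esub> Rep_usv y"
  "Rep_usv (- x) = \<ominus>\<^bsub>Usv\<^esub> Rep_usv x"
  "Rep_usv (x - y) = Rep_usv x \<ominus>\<^bsub>Usv\<^esub> Rep_usv y"
  using Rep_usv[of x] Rep_usv[of y]
  by (auto simp: zero_usv_def one_usv_def plus_usv_def times_usv_def uminus_usv_def minus_usv_def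
      intro!: Abs_usv_inverse)

instance
proof
  fix x y z :: usv
  note [simp] = Rep_usv Rep_usv_simps
  note inj = Rep_usv_inject[THEN iffD1]
  show "x + y + z = x + (y + z)" by (rule inj) (simp add: Usv.a_assoc)
  show "x + y = y + x" by (rule inj) (simp add: Usv.a_comm)
  show "0 + x = x" by (rule inj) simp
  show "- x + x = 0" by (rule inj) (simp add: Usv.l_neg)
  show "x - y = x + - y" by (rule inj) (simp add: Usv.minus_eq)
  show "x * y * z = x * (y * z)" by (rule inj) (simp add: Usv.m_assoc)
  show "1 * x = x" by (rule inj) simp
  show "x * 1 = x" by (rule inj) simp
  show "(x + y) * z = x * z + y * z" by (rule inj) (simp add: Usv.l_distr)
  show "x * (y + z) = x * y + x * z" by (rule inj) (simp add: Usv.r_distr)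
  show "(0::usv) \<noteq> 1" using Usv_one_not_zero by (metis Rep_usv_simps(1,2))
qed

end

definition usv_class :: "sv nc_poly \<Rightarrow> usv" where
  "usv_class p = Abs_usv (uea_ideal UNIV +>\<^bsub>free_alg UNIV\<^esub> p)"

lemma Rep_usv_class: "Rep_usv (usv_class p) = uea_ideal UNIV +>\<^bsub>free_alg UNIV\<^esub> p"
  unfolding usv_class_def
  by (rule Abs_usv_inverse) (auto simp: uea_def FactRing_def A_RCOSETS_defs a_r_coset_def)

lemma usv_class_surj: obtains p where "u = usv_class p"
proof -
  have "Rep_usv u \<in> carrier Usv" by (rule Rep_usv)
  then obtain p where "Rep_usv u = uea_ideal UNIV +>\<^bsub>free_alg UNIV\<^esub> p"
    by (auto simp: uea_def FactRing_def A_RCOSETS_defs a_r_coset_def)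
  then have "u = usv_class p" unfolding Rep_usv_inject[symmetric] by (simp add: Rep_usv_class)
  then show thesis by (rule that)
qed

lemma usv_class_ring_hom [simp]:
  "usv_class (p + q) = usv_class p + usv_class q" "usv_class (p * q) = usv_class p * usv_class q"
  "usv_class 0 = 0" "usv_class 1 = 1"
proof -
  interpret ideal "uea_ideal UNIV" "free_alg UNIV" by (rule ideal_uea)
  show "usv_class (p + q) = usv_class p + usv_class q" "usv_class (p * q) = usv_class p * usv_class q"
    "usv_class 0 = 0" "usv_class 1 = 1"
    unfolding Rep_usv_inject[symmetric] Rep_usv_simps Rep_usv_class
    using a_rcos_sum[of p q] rcoset_mult_add[of p q] a_rcos_const[OF additive_subgroup.zero_closed[OF is_additive_subgroup]]
    by (simp_all add: uea_def FactRing_def)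
qed

lemma usv_class_minus: "usv_class (- p) = - usv_class p"
  using minus_unique[of "usv_class p" "usv_class (- p)"] usv_class_ring_hom(1)[of p "- p"]
  by (simp del: usv_class_ring_hom(1) add: usv_class_ring_hom(1)[symmetric])

lemma usv_class_diff [simp]: "usv_class (p - q) = usv_class p - usv_class q"
  using usv_class_ring_hom(1)[of p "- q"] by (simp add: usv_class_minus)

lemma usv_class_eq_0: "usv_class p = 0 \<longleftrightarrow> p \<in> uea_ideal UNIV"
proof -
  interpret ideal "uea_ideal UNIV" "free_alg UNIV" by (rule ideal_uea)
  have "usv_class p = 0 \<longleftrightarrow> uea_ideal UNIV +>\<^bsub>free_alg UNIV\<^esub> p = uea_ideal UNIV"
    unfolding Rep_usv_inject[symmetric] Rep_usv_simps Rep_usv_class by (simp add: uea_def FactRing_def)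
  also have "\<dots> \<longleftrightarrow> p \<in> uea_ideal UNIV"
    using a_rcos_self[of p] a_rcos_const[of p] by auto
  finally show ?thesis .
qed

definition usv_cst :: "complex \<Rightarrow> usv" where "usv_cst c = usv_class (nc_const c)"
definition usv_var :: "sv \<Rightarrow> usv" where "usv_var x = usv_class (nc_var x)"

abbreviation usv_basis :: "sv_index \<Rightarrow> usv" where
  "usv_basis a \<equiv> usv_var (Poly_Mapping.single a 1)"

lemma usv_var_add: "usv_var (x + y) = usv_var x + usv_var y"
proof -
  have "nc_var (x + y) - nc_var x - nc_var y \<in> uea_ideal UNIV"
    by (rule subsetD[OF uea_rels_subset], unfold uea_rels_def) blast
  then have "usv_class (nc_var (x + y) - nc_var x - nc_var y) = 0" by (simp only: usv_class_eq_0)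
  then show ?thesis by (simp add: usv_var_def algebra_simps)
qed

lemma usv_var_scale: "usv_var (sv_scale c x) = usv_cst c * usv_var x"
proof -
  have "nc_var (sv_scale c x) - nc_const c * nc_var x \<in> uea_ideal UNIV"
    by (rule subsetD[OF uea_rels_subset], unfold uea_rels_def) blast
  then have "usv_class (nc_var (sv_scale c x) - nc_const c * nc_var x) = 0" by (simp only: usv_class_eq_0)
  then show ?thesis by (simp add: usv_var_def usv_cst_def)
qed

lemma usv_var_bracket: "usv_var x * usv_var y = usv_var y * usv_var x + usv_var (sv_bracket x y)"
proof -
  have "nc_var x * nc_var y - nc_var y * nc_var x - nc_var (sv_bracket x y) \<in> uea_ideal UNIV"
    by (rule subsetD[OF uea_rels_subset], unfold uea_rels_def) blast
  then have "usv_class (nc_var x * nc_var y - nc_var y * nc_var x - nc_var (sv_bracket x y)) = 0"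
    by (simp only: usv_class_eq_0)
  then show ?thesis by (simp add: usv_var_def algebra_simps)
qed

lemma usv_cst_add: "usv_cst (a + b) = usv_cst a + usv_cst b"
  by (simp add: usv_cst_def nc_const_def single_add flip: usv_class_ring_hom)

lemma usv_cst_mult: "usv_cst (a * b) = usv_cst a * usv_cst b"
  by (simp add: usv_cst_def nc_const_def mult_single flip: usv_class_ring_hom)

lemma nc_const_central: "p * nc_const c = nc_const c * p"
  by (induction p rule: poly_mapping_sum_induct)
    (simp_all add: nc_const_def mult_single distrib_left distrib_right mult.commute)

lemma usv_var_zero: "usv_var 0 = 0"
  using usv_var_add[of 0 0] by simp

lemma usv_var_single: "usv_var (Poly_Mapping.single i c) = usv_cst c * usv_basis i"
  using usv_var_scale[of c "Poly_Mapping.single i 1"] by simp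

lemma usv_basis_bracket:
  "usv_basis a * usv_basis b
     = usv_basis b * usv_basis a
       + usv_cst (bracket_coeff a b) * usv_basis (bracket_index a b)"
proof -
  have "sv_bracket (Poly_Mapping.single a 1) (Poly_Mapping.single b 1)
      = Poly_Mapping.single (bracket_index a b) (bracket_coeff a b)"
    by (simp add: sv_bracket_def sv_basis_bracket_single)
  then show ?thesis
    using usv_var_bracket[of "Poly_Mapping.single a 1" "Poly_Mapping.single b 1"]
    by (simp add: usv_var_single[of "bracket_index a b" "bracket_coeff a b"])
qed

text \<open>Generation by letters: a subspace that contains \<open>1\<close> and is stable under left multiplication by
  the basis vectors is stable under all of \<open>sv\<close> by linearity, hence contains all words.\<close>

interpretation usv: sv_enveloping usv_cst "\<lambda>n. usv_var (sv_L n)" "\<lambda>n. usv_var (sv_M n)" "\<lambda>n. usv_var (sv_Y n)"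
proof
  fix m n
  show "usv_var (sv_L m) * usv_var (sv_L n)
      = usv_var (sv_L n) * usv_var (sv_L m) + usv_cst (of_int (n - m)) * usv_var (sv_L (m + n))"
    using usv_basis_bracket[of "Lix m" "Lix n"] by simp
  show "usv_var (sv_L m) * usv_var (sv_M n)
      = usv_var (sv_M n) * usv_var (sv_L m) + usv_cst (of_int n) * usv_var (sv_M (m + n))"
    using usv_basis_bracket[of "Lix m" "Mix n"] by simp
  show "usv_var (sv_L m) * usv_var (sv_Y n)
      = usv_var (sv_Y n) * usv_var (sv_L m) + usv_cst (of_int n + (1 - of_int m) / 2) * usv_var (sv_Y (m + n))"
    using usv_basis_bracket[of "Lix m" "Yix n"] by simp
  show "usv_var (sv_Y m) * usv_var (sv_Y n)
      = usv_var (sv_Y n) * usv_var (sv_Y m) + usv_cst (of_int (n - m)) * usv_var (sv_M (m + n + 1))"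
    using usv_basis_bracket[of "Yix m" "Yix n"] by simp
  show "usv_var (sv_M m) * usv_var (sv_M n) = usv_var (sv_M n) * usv_var (sv_M m)"
    using usv_basis_bracket[of "Mix m" "Mix n"] usv_cst_add[of 0 0] by simp
  show "usv_var (sv_M m) * usv_var (sv_Y n) = usv_var (sv_Y n) * usv_var (sv_M m)"
    using usv_basis_bracket[of "Mix m" "Yix n"] usv_cst_add[of 0 0] by simp
next
  show "usv_cst 1 = 1" by (simp add: usv_cst_def nc_const_def)
  show "x * usv_cst a = usv_cst a * x" for x a
    using usv_class_surj[of x] by (metis nc_const_central usv_class_ring_hom(2) usv_cst_def)
next
  fix S :: "usv set" and x
  assume S: "1 \<in> S" "\<And>x y. x \<in> S \<Longrightarrow> y \<in> S \<Longrightarrow> x + y \<in> S" "\<And>a x. x \<in> S \<Longrightarrow> usv_cst a * x \<in> S"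
    "\<And>n x. x \<in> S \<Longrightarrow> usv_var (sv_L n) * x \<in> S" "\<And>n x. x \<in> S \<Longrightarrow> usv_var (sv_M n) * x \<in> S"
    "\<And>n x. x \<in> S \<Longrightarrow> usv_var (sv_Y n) * x \<in> S"
  have zero: "0 \<in> S" using S(3)[OF S(1), of 0] usv_cst_add[of 0 0] by simp
  have letter: "usv_basis i * y \<in> S" if "y \<in> S" for i y
    using S(4-6) that by (cases i) auto
  have var: "usv_var z * y \<in> S" if y: "y \<in> S" for z y
  proof (induction z rule: poly_mapping_sum_induct)
    case (single i c)
    then show ?case using S(3)[OF letter[OF y]] by (simp add: usv_var_single[of i c] mult.assoc)
  qed (auto simp: usv_var_zero zero usv_var_add distrib_right intro: S(2))
  have word: "usv_class (Poly_Mapping.single (Word xs) 1) \<in> S" for xs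
  proof (induction xs)
    case Nil
    have "(Poly_Mapping.single (Word []) 1 :: sv nc_poly) = 1"
      by (metis single_one zero_free_word_def)
    then show ?case using S(1) by simp
  next
    case (Cons z xs)
    have "Poly_Mapping.single (Word (z # xs)) (1::complex) = nc_var z * Poly_Mapping.single (Word xs) 1"
      by (simp add: nc_var_def mult_single plus_free_word_def)
    then show ?case using var[OF Cons] by (simp add: usv_var_def)
  qed
  obtain p where p: "x = usv_class p" by (rule usv_class_surj)
  show "x \<in> S"
    unfolding p
  proof (induction p rule: poly_mapping_sum_induct)
    case (single w c)
    have "Poly_Mapping.single w c = nc_const c * Poly_Mapping.single w 1"
      by (simp add: nc_const_def mult_single)
    then show ?case using S(3)[OF word[of "letters w"], of c] by (simp add: usv_cst_def)
  qed (auto simp: zero intro: S(2))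
qed (rule usv_cst_add usv_cst_mult)+

text \<open>The classes of those \<open>p\<close> for which the functional vanishes on every \<open>q * p\<close> form a left ideal. It
  contains the generators, by the behaviour of the functional under appending a letter, but
  not \<open>1\<close>.\<close>

theorem one_not_in_verma_ideal: "1 \<notin> usv.verma_ideal \<xi> \<zeta>"
proof
  let ?S = "{u. \<exists>p. u = usv_class p \<and> (\<forall>q. vacuum_functional \<xi> \<zeta> (q * p) = 0)}"
  have "left_ideal ?S"
    unfolding left_ideal_def
  proof (intro conjI ballI allI)
    show "0 \<in> ?S" by (intro CollectI exI[of _ 0]) (simp add: vacuum_functional_def)
  next
    fix x y assume "x \<in> ?S" "y \<in> ?S"
    then obtain p q where "x = usv_class p" "y = usv_class q"
      "\<forall>r. vacuum_functional \<xi> \<zeta> (r * p) = 0" "\<forall>r. vacuum_functional \<xi> \<zeta> (r * q) = 0" by blast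
    then show "x + y \<in> ?S"
      by (intro CollectI exI[of _ "p + q"]) (simp add: distrib_left vacuum_functional_def linear_ext_add)
  next
    fix a x assume "x \<in> ?S"
    then obtain p where p: "x = usv_class p" "\<And>r. vacuum_functional \<xi> \<zeta> (r * p) = 0" by blast
    obtain b where "a = usv_class b" by (rule usv_class_surj)
    then show "a * x \<in> ?S"
      using p by (intro CollectI exI[of _ "b * p"]) (simp add: mult.assoc[symmetric])
  qed
  moreover have "insert (usv_var (sv_L 0) - usv_cst \<zeta>) (insert (usv_var (sv_M 0) - usv_cst \<xi>) usv.positive_letters) \<subseteq> ?S"
  proof -
    have last: "usv_basis a - usv_cst c \<in> ?S"
      if "\<And>w. vacuum \<xi> \<zeta> (w @ [a]) = c * vacuum \<xi> \<zeta> w" for a c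
    proof -
      have const: "vacuum_functional \<xi> \<zeta> (q * nc_const c) = c * vacuum_functional \<xi> \<zeta> q" for q
        by (induction q rule: poly_mapping_sum_induct)
          (simp_all add: vacuum_functional_def nc_const_def mult_single distrib_left distrib_right linear_ext_add)
      have "vacuum_functional \<xi> \<zeta> (q * nc_var (Poly_Mapping.single a 1)) = c * vacuum_functional \<xi> \<zeta> q" for q
        by (subst vacuum_functional_last[where c = c]) (auto simp: that)
      then have "vacuum_functional \<xi> \<zeta> (q * (nc_var (Poly_Mapping.single a 1) - nc_const c)) = 0" for q
        using const[of q] by (simp add: right_diff_distrib) (simp add: vacuum_functional_def linear_ext_diff)
      then show ?thesis
        by (intro CollectI exI[of _ "nc_var (Poly_Mapping.single a 1) - nc_const c"])
          (simp add: usv_var_def usv_cst_def)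
    qed
    have pos: "usv_basis a \<in> ?S" if "key a \<ge> 2" for a
      using last[of a 0] vacuum_positive[OF that] usv_cst_add[of 0 0] by simp
    have "usv.positive_letters \<subseteq> ?S"
      unfolding usv.positive_letters_def using pos by fastforce
    then show ?thesis using last[of "Lix 0" \<zeta>] last[of "Mix 0" \<xi>] vacuum_L0 vacuum_M0 by blast
  qed
  ultimately have "usv.verma_ideal \<xi> \<zeta> \<subseteq> ?S"
    unfolding usv.verma_ideal_def by (rule left_hull_minimal)
  moreover assume "1 \<in> usv.verma_ideal \<xi> \<zeta>"
  ultimately obtain p where p: "usv_class p = 1" "\<forall>q. vacuum_functional \<xi> \<zeta> (q * p) = 0" by auto
  have "1 - p \<in> uea_ideal UNIV" using p(1) by (simp add: usv_class_eq_0[symmetric])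
  then have "vacuum_functional \<xi> \<zeta> (1 - p) = 0" by (rule vacuum_functional_uea_ideal)
  moreover have "vacuum_functional \<xi> \<zeta> p = 0" using p(2)[rule_format, of 1] by simp
  ultimately show False
    using vacuum_functional_one[of \<xi> \<zeta>] by (simp add: vacuum_functional_def linear_ext_diff)
qed

section \<open>Modules and cyclic presentations\<close>

definition act :: "(sv nc_poly set, 'm) module \<Rightarrow> usv \<Rightarrow> 'm \<Rightarrow> 'm" where
  "act V u x = Rep_usv u \<odot>\<^bsub>V\<^esub> x"

lemma carrier_Usv: "carrier Usv = range Rep_usv"
  using type_definition.Rep_range[OF type_definition_usv] by simp

lemma comm_group_extend:
  assumes "comm_group \<lparr>carrier = A, monoid.mult = f, one = e\<rparr>"
  shows "comm_group \<lparr>carrier = A, monoid.mult = f, one = e, \<dots> = m\<rparr>"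
  using assms
  unfolding comm_group_def comm_monoid_def comm_monoid_axioms_def group_def group_axioms_def
    Group.monoid_def Units_def partial_object.simps monoid.simps .

locale sv_module =
  fixes V :: "(sv nc_poly set, 'm) module" (structure)
  assumes left_module: "left_module Usv V"
begin

sublocale abelian_group V
  using left_module by (simp add: left_module_def)

lemma act_closed [simp, intro]: "x \<in> carrier V \<Longrightarrow> act V u x \<in> carrier V"
  and act_add_left: "x \<in> carrier V \<Longrightarrow> act V (u + v) x = act V u x \<oplus> act V v x"
  and act_add_right: "x \<in> carrier V \<Longrightarrow> y \<in> carrier V \<Longrightarrow> act V u (x \<oplus> y) = act V u x \<oplus> act V u y"
  and act_mult: "x \<in> carrier V \<Longrightarrow> act V (u * v) x = act V u (act V v x)"
  and act_one [simp]: "x \<in> carrier V \<Longrightarrow> act V 1 x = x"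
  using left_module unfolding left_module_def module_axioms_def act_def Rep_usv_simps
  by (auto simp: Rep_usv)

lemma act_zero_right [simp]: "act V u \<zero> = \<zero>"
  using act_add_right[of \<zero> \<zero> u] by (metis act_closed add.r_cancel_one' zero_closed r_zero)

lemma act_zero_left [simp]: "x \<in> carrier V \<Longrightarrow> act V 0 x = \<zero>"
  using act_add_left[of x 0 0] by (metis act_closed add.r_cancel_one' add_0)

lemma act_minus_left: "x \<in> carrier V \<Longrightarrow> act V (- u) x = \<ominus> act V u x"
  using act_add_left[of x "- u" u] by (simp add: minus_equality)

lemma act_diff: "x \<in> carrier V \<Longrightarrow> act V (u - v) x = act V u x \<ominus> act V v x"
  using act_add_left[of x u "- v"] by (simp add: act_minus_left minus_eq)

lemma act_eq_iff:
  assumes "x \<in> carrier V" shows "act V u x = act V v x \<longleftrightarrow> act V (u - v) x = \<zero>"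
proof
  assume "act V (u - v) x = \<zero>"
  then have "act V (u - v) x \<oplus> act V v x = act V v x" using assms by simp
  then show "act V u x = act V v x" using assms by (simp add: act_add_left[symmetric])
qed (simp add: act_diff assms minus_eq r_neg)

lemma submoduleI:
  assumes "N \<subseteq> carrier V" "\<zero> \<in> N" "\<And>x y. x \<in> N \<Longrightarrow> y \<in> N \<Longrightarrow> x \<oplus> y \<in> N" "\<And>u x. x \<in> N \<Longrightarrow> act V u x \<in> N"
  shows "submodule N Usv V"
proof (intro submodule.intro submodule_axioms.intro)
  have "\<ominus> x \<in> N" if "x \<in> N" for x
  proof -
    have "x \<in> carrier V" using that assms(1) by blast
    moreover have "act V (- 1) x \<in> N" by (rule assms(4)[OF that])
    ultimately show ?thesis by (simp only: act_minus_left act_one)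
  qed
  then show "subgroup N (add_monoid V)"
    using assms by (intro add.subgroupI) (auto simp: a_inv_def)
  show "a \<odot> x \<in> N" if "a \<in> carrier Usv" "x \<in> N" for a x
    using assms(4)[OF that(2)] that(1) by (auto simp: act_def carrier_Usv)
qed

lemma submoduleD:
  assumes "submodule N Usv V"
  shows "N \<subseteq> carrier V" "\<zero> \<in> N" "x \<in> N \<Longrightarrow> y \<in> N \<Longrightarrow> x \<oplus> y \<in> N" "x \<in> N \<Longrightarrow> act V u x \<in> N"
proof -
  interpret N: subgroup N "add_monoid V" using assms by (rule submodule.axioms)
  show "N \<subseteq> carrier V" "\<zero> \<in> N" "x \<in> N \<Longrightarrow> y \<in> N \<Longrightarrow> x \<oplus> y \<in> N"
    using N.subset N.one_closed N.m_closed by auto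
  show "x \<in> N \<Longrightarrow> act V u x \<in> N"
    using submodule.smult_closed[OF assms Rep_usv] by (simp add: act_def)
qed

lemma submodule_minus:
  assumes "submodule N Usv V" "x \<in> N" "y \<in> N"
  shows "x \<ominus> y \<in> N"
proof -
  have "x \<oplus> act V (- 1) y \<in> N" by (intro submoduleD[OF assms(1)] assms)
  moreover have "y \<in> carrier V" using submoduleD(1)[OF assms(1)] assms(3) by blast
  ultimately show ?thesis by (simp add: act_minus_left minus_eq)
qed

lemma abelian_subgroup_submodule: "submodule N Usv V \<Longrightarrow> abelian_subgroup N V"
  by (intro abelian_subgroupI3 additive_subgroupI submodule.axioms(1) abelian_group_axioms)

lemma annihilator_left_ideal: "x \<in> carrier V \<Longrightarrow> left_ideal {u. act V u x = \<zero>}"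
  by (simp add: left_ideal_def act_add_left act_mult)

lemma submodule_cyclic:
  assumes "x \<in> carrier V"
  shows "submodule {act V u x | u. True} Usv V"
proof (rule submoduleI)
  show "{act V u x | u. True} \<subseteq> carrier V" using assms by auto
  show "\<zero> \<in> {act V u x | u. True}" using act_zero_left[OF assms] by (metis (mono_tags, lifting) mem_Collect_eq)
  fix y z assume "y \<in> {act V u x | u. True}"
  then obtain u where y: "y = act V u x" by blast
  show "act V v y \<in> {act V u x | u. True}" for v
    unfolding y act_mult[OF assms, symmetric] by blast
  assume "z \<in> {act V u x | u. True}"
  then obtain v where "z = act V v x" by blast
  then show "y \<oplus> z \<in> {act V u x | u. True}"
    unfolding y by (simp add: act_add_left[OF assms, symmetric]) blast
qed

lemma gen_submodule_single:
  assumes "x \<in> carrier V"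
  shows "gen_submodule Usv V {x} = {act V u x | u. True}"
proof
  have "x \<in> {act V u x | u. True}" using act_one[OF assms] by (metis (mono_tags, lifting) mem_Collect_eq)
  then show "gen_submodule Usv V {x} \<subseteq> {act V u x | u. True}"
    using submodule_cyclic[OF assms] by (auto simp: gen_submodule_def)
  show "{act V u x | u. True} \<subseteq> gen_submodule Usv V {x}"
    unfolding gen_submodule_def using submoduleD(4) by blast
qed

lemma sv_module_submodule:
  assumes "submodule N Usv V"
  shows "sv_module (V\<lparr>carrier := N\<rparr>)"
proof
  note N = submoduleD[OF assms]
  have "abelian_group (V\<lparr>carrier := N\<rparr>)"
  proof (intro abelian_groupI)
    fix x assume "x \<in> carrier (V\<lparr>carrier := N\<rparr>)"
    then have x: "x \<in> N" "x \<in> carrier V" using N(1) by auto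
    have "act V (- 1) x \<in> N" by (rule N(4)[OF x(1)])
    moreover have "act V (- 1) x \<oplus> x = \<zero>" using x(2) by (simp add: act_minus_left l_neg)
    ultimately show "\<exists>y\<in>carrier (V\<lparr>carrier := N\<rparr>). y \<oplus>\<^bsub>V\<lparr>carrier := N\<rparr>\<^esub> x = \<zero>\<^bsub>V\<lparr>carrier := N\<rparr>\<^esub>"
      by auto
  qed (use N in \<open>auto simp: subset_iff a_ac\<close>)
  moreover have "module_axioms Usv (V\<lparr>carrier := N\<rparr>)"
    using left_module N(1) submodule.smult_closed[OF assms]
    unfolding left_module_def module_axioms_def by (auto simp: subset_iff)
  ultimately show "left_module Usv (V\<lparr>carrier := N\<rparr>)"
    by (simp add: left_module_def Usv.ring_axioms)
qed

lemma quot_coset_eq: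
  assumes N: "submodule N Usv V" and xy: "x \<in> carrier V" "y \<in> carrier V"
  shows "N +> x = N +> y \<longleftrightarrow> x \<ominus> y \<in> N"
proof -
  interpret N: abelian_subgroup N V by (rule abelian_subgroup_submodule[OF N])
  have "N +> x = N +> y \<longleftrightarrow> x \<in> N +> y"
    using N.a_repr_independence'[of x y] N.a_repr_independenceD[of x y] xy by auto
  also have "\<dots> \<longleftrightarrow> x \<ominus> y \<in> N"
    using N.a_rcos_module[OF xy(2,1)] by (simp add: minus_eq)
  finally show ?thesis .
qed

lemma quot_module_act:
  assumes N: "submodule N Usv V" and x: "x \<in> carrier V"
  shows "act (quot_module V N) u (N +> x) = N +> act V u x"
proof -
  interpret N: abelian_subgroup N V by (rule abelian_subgroup_submodule[OF N])
  have "N +> act V u y = N +> act V u x" if "y \<in> N +> x" for y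
  proof -
    have y: "y \<in> carrier V" using that x N.a_elemrcos_carrier by blast
    have "y \<ominus> x \<in> N" using that N.a_rcos_module[OF x y] by (simp add: minus_eq)
    then have "act V u (y \<ominus> x) \<in> N" by (rule submoduleD(4)[OF N])
    also have "act V u (y \<ominus> x) = act V u y \<ominus> act V u x"
      using act_mult[OF x, of u "- 1"] y x
      by (simp add: minus_eq act_add_right act_minus_left)
    finally show ?thesis using y x N by (simp add: quot_coset_eq)
  qed
  moreover have "N +> x \<noteq> {}" using N.a_rcos_self[OF x] by blast
  ultimately show ?thesis by (simp add: quot_module_def act_def SUP_eq_const)
qed

lemma quot_module_simps:
  "carrier (quot_module V N) = {N +> x | x. x \<in> carrier V}" "\<zero>\<^bsub>quot_module V N\<^esub> = N"
  "add (quot_module V N) = set_add V"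
  by (auto simp: quot_module_def A_RCOSETS_defs a_r_coset_def)

lemma sv_module_quot:
  assumes N: "submodule N Usv V"
  shows "sv_module (quot_module V N)"
proof
  interpret N: abelian_subgroup N V by (rule abelian_subgroup_submodule[OF N])
  have add: "(N +> x) <+> (N +> y) = N +> (x \<oplus> y)" if "x \<in> carrier V" "y \<in> carrier V" for x y
    using N.a_rcos_sum that by simp
  have zero: "N +> \<zero> = N" by (rule N.a_rcos_const) simp
  have "abelian_group (quot_module V N)"
  proof (rule comm_group_abelian_groupI)
    have "comm_group (V A_Mod N)" by (rule N.a_factorgroup_is_comm_group)
    then show "comm_group (add_monoid (quot_module V N))"
      by (simp add: quot_module_def A_FactGroup_def' comm_group_extend)
  qed
  moreover have "module_axioms Usv (quot_module V N)"
  proof -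
    have smult: "Rep_usv u \<odot>\<^bsub>quot_module V N\<^esub> (N +> x) = N +> act V u x" if "x \<in> carrier V" for u x
      using quot_module_act[OF N that] by (simp add: act_def)
    show ?thesis
    proof (rule module_axioms.intro; unfold carrier_Usv quot_module_simps(1,3))
      fix a X assume "a \<in> range Rep_usv" "X \<in> {N +> x | x. x \<in> carrier V}"
      then obtain u x where a: "a = Rep_usv u" and X: "X = N +> x" and x: "x \<in> carrier V" by blast
      show "a \<odot>\<^bsub>quot_module V N\<^esub> X \<in> {N +> x | x. x \<in> carrier V}"
        unfolding a X smult[OF x] using x by blast
    next
      fix a b X assume "a \<in> range Rep_usv" "b \<in> range Rep_usv" "X \<in> {N +> x | x. x \<in> carrier V}"
      then obtain u v x where a: "a = Rep_usv u" and b: "b = Rep_usv v" and X: "X = N +> x" and x: "x \<in> carrier V"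
        by blast
      show "(a \<oplus>\<^bsub>Usv\<^esub> b) \<odot>\<^bsub>quot_module V N\<^esub> X
          = a \<odot>\<^bsub>quot_module V N\<^esub> X <+> b \<odot>\<^bsub>quot_module V N\<^esub> X"
        unfolding a b X Rep_usv_simps[symmetric] smult[OF x] using x by (simp add: add act_add_left)
      show "(a \<otimes>\<^bsub>Usv\<^esub> b) \<odot>\<^bsub>quot_module V N\<^esub> X = a \<odot>\<^bsub>quot_module V N\<^esub> (b \<odot>\<^bsub>quot_module V N\<^esub> X)"
        unfolding a b X Rep_usv_simps[symmetric] using x by (simp add: smult act_mult)
    next
      fix a X Z assume "a \<in> range Rep_usv" "X \<in> {N +> x | x. x \<in> carrier V}" "Z \<in> {N +> x | x. x \<in> carrier V}"
      then obtain u x z where a: "a = Rep_usv u" and X: "X = N +> x" and x: "x \<in> carrier V"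
        and Z: "Z = N +> z" and z: "z \<in> carrier V"
        by blast
      show "a \<odot>\<^bsub>quot_module V N\<^esub> (X <+> Z) = a \<odot>\<^bsub>quot_module V N\<^esub> X <+> a \<odot>\<^bsub>quot_module V N\<^esub> Z"
        unfolding a X Z using x z by (simp add: add smult act_add_right)
    next
      fix X assume "X \<in> {N +> x | x. x \<in> carrier V}"
      then obtain x where X: "X = N +> x" and x: "x \<in> carrier V" by blast
      show "\<one>\<^bsub>Usv\<^esub> \<odot>\<^bsub>quot_module V N\<^esub> X = X"
        unfolding X Rep_usv_simps(2)[symmetric] using x by (simp add: smult)
    qed
  qed
  ultimately show "left_module Usv (quot_module V N)"
    by (simp add: left_module_def Usv.ring_axioms)
qed

end

text \<open>A module \<open>V\<close> that is a copy of \<open>U/J\<close>, with \<open>w\<close> in the place of the class of \<open>1\<close>.\<close>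

definition cyclic_presentation :: "(sv nc_poly set, 'm) module \<Rightarrow> 'm \<Rightarrow> usv set \<Rightarrow> bool" where
  "cyclic_presentation V w J \<longleftrightarrow> left_module Usv V \<and> w \<in> carrier V \<and>
     carrier V = {act V u w | u. True} \<and> (\<forall>u. act V u w = \<zero>\<^bsub>V\<^esub> \<longleftrightarrow> u \<in> J)"

lemma cyclic_presentationD:
  assumes "cyclic_presentation V w J"
  shows "sv_module V" "w \<in> carrier V" "carrier V = {act V u w | u. True}"
    "act V u w = \<zero>\<^bsub>V\<^esub> \<longleftrightarrow> u \<in> J" "act V u w = act V v w \<longleftrightarrow> u - v \<in> J"
proof -
  show V: "sv_module V" using assms by (simp add: cyclic_presentation_def sv_module_def)
  show w: "w \<in> carrier V" "carrier V = {act V u w | u. True}"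
    and ann: "\<And>u. act V u w = \<zero>\<^bsub>V\<^esub> \<longleftrightarrow> u \<in> J"
    using assms unfolding cyclic_presentation_def by blast+
  show "act V u w = act V v w \<longleftrightarrow> u - v \<in> J"
    using sv_module.act_eq_iff[OF V w(1), of u v] ann by simp
qed

lemma cyclic_presentation_iso:
  assumes V: "cyclic_presentation V v J" and W: "cyclic_presentation W w J"
  shows "module_iso Usv V W"
proof -
  interpret V: sv_module V by (rule cyclic_presentationD[OF V])
  interpret W: sv_module W by (rule cyclic_presentationD[OF W])
  define f where "f x = act W (SOME u. x = act V u v) w" for x
  have f: "f (act V u v) = act W u w" for u
  proof -
    define u' where "u' = (SOME u'. act V u v = act V u' v)"
    have "act V u v = act V u' v" unfolding u'_def by (rule someI) (rule refl)
    then have "act W u w = act W u' w"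
      unfolding cyclic_presentationD(5)[OF V] cyclic_presentationD(5)[OF W] .
    then show ?thesis by (simp add: f_def u'_def)
  qed
  have v: "v \<in> carrier V" and w: "w \<in> carrier W"
    by (rule cyclic_presentationD[OF V], rule cyclic_presentationD[OF W])
  have cV: "\<exists>u. x = act V u v" if "x \<in> carrier V" for x using that cyclic_presentationD(3)[OF V] by blast
  have "bij_betw f (carrier V) (carrier W)"
  proof (rule bij_betwI')
    fix x y assume xy: "x \<in> carrier V" "y \<in> carrier V"
    obtain a where "x = act V a v" using cV[OF xy(1)] by blast
    moreover obtain b where "y = act V b v" using cV[OF xy(2)] by blast
    ultimately show "f x = f y \<longleftrightarrow> x = y"
      by (simp add: f cyclic_presentationD(5)[OF V] cyclic_presentationD(5)[OF W])
  next
    fix x assume "x \<in> carrier V"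
    then obtain a where "x = act V a v" using cV by blast
    then show "f x \<in> carrier W" using w by (simp add: f)
  next
    fix y assume "y \<in> carrier W"
    then obtain a where "y = act W a w" using cyclic_presentationD(3)[OF W] by blast
    then show "\<exists>x\<in>carrier V. y = f x" using v by (intro bexI[of _ "act V a v"]) (auto simp: f)
  qed
  moreover have "f (x \<oplus>\<^bsub>V\<^esub> y) = f x \<oplus>\<^bsub>W\<^esub> f y" if xy: "x \<in> carrier V" "y \<in> carrier V" for x y
  proof -
    obtain a where "x = act V a v" using cV[OF xy(1)] by blast
    moreover obtain b where "y = act V b v" using cV[OF xy(2)] by blast
    ultimately show ?thesis
      using v w by (simp add: V.act_add_left[symmetric] f W.act_add_left)
  qed
  moreover have "f (r \<odot>\<^bsub>V\<^esub> x) = r \<odot>\<^bsub>W\<^esub> f x" if rx: "r \<in> carrier Usv" "x \<in> carrier V" for r x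
  proof -
    obtain u where r: "r = Rep_usv u" using rx by (auto simp: carrier_Usv)
    obtain a where x: "x = act V a v" using cV[OF rx(2)] by blast
    have "f (act V u x) = act W u (f x)"
      unfolding x using v w by (simp add: V.act_mult[symmetric] f W.act_mult)
    then show ?thesis by (simp add: r act_def)
  qed
  ultimately show ?thesis unfolding module_iso_def by blast
qed

lemma cyclic_presentation_quot:
  assumes V: "cyclic_presentation V w J" and N: "submodule N Usv V"
  shows "cyclic_presentation (quot_module V N) (N +>\<^bsub>V\<^esub> w) {u. act V u w \<in> N}"
proof -
  interpret V: sv_module V by (rule cyclic_presentationD[OF V])
  interpret N: abelian_subgroup N V by (rule V.abelian_subgroup_submodule[OF N])
  have w: "w \<in> carrier V" by (rule cyclic_presentationD[OF V])
  have zero: "N +>\<^bsub>V\<^esub> x = N \<longleftrightarrow> x \<in> N" if "x \<in> carrier V" for x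
    using N.a_rcos_self[OF that] N.a_rcos_const[of x] by auto
  have "left_module Usv (quot_module V N)"
    using V.sv_module_quot[OF N] by (simp add: sv_module_def)
  moreover have "carrier (quot_module V N) = {act (quot_module V N) u (N +>\<^bsub>V\<^esub> w) | u. True}"
    unfolding V.quot_module_simps V.quot_module_act[OF N w] by (auto simp: cyclic_presentationD(3)[OF V])
  moreover have "N +>\<^bsub>V\<^esub> w \<in> carrier (quot_module V N)"
    unfolding V.quot_module_simps using w by blast
  ultimately show ?thesis
    unfolding cyclic_presentation_def V.quot_module_act[OF N w] V.quot_module_simps(2)
    by (intro conjI allI) (simp_all add: zero w)
qed

text \<open>The submodule generated by \<open>a w\<close> is \<open>(U a + J)/J\<close>, which is \<open>U\<close> modulo the preimage of \<open>J\<close> under right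
  multiplication by \<open>a\<close>.\<close>

lemma cyclic_presentation_submodule:
  assumes V: "cyclic_presentation V w J"
  shows "cyclic_presentation (V\<lparr>carrier := {act V u (act V a w) | u. True}\<rparr>) (act V a w) {u. u * a \<in> J}"
proof -
  interpret V: sv_module V by (rule cyclic_presentationD[OF V])
  have w: "w \<in> carrier V" by (rule cyclic_presentationD[OF V])
  let ?N = "{act V u (act V a w) | u. True}"
  have N: "submodule ?N Usv V" using w by (intro V.submodule_cyclic) simp
  have actN: "act (V\<lparr>carrier := ?N\<rparr>) = act V" by (intro ext) (simp add: act_def)
  have aw: "act V a w \<in> ?N"
    using V.act_one[of "act V a w"] w by (intro CollectI exI[of _ 1]) simp
  have ann: "act V u (act V a w) = \<zero>\<^bsub>V\<^esub> \<longleftrightarrow> u * a \<in> J" for u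
    unfolding V.act_mult[OF w, symmetric] by (rule cyclic_presentationD(4)[OF V])
  have "left_module Usv (V\<lparr>carrier := ?N\<rparr>)"
    using V.sv_module_submodule[OF N] by (simp add: sv_module_def)
  then show ?thesis
    unfolding cyclic_presentation_def actN using aw ann by auto
qed

section \<open>The universal Whittaker module\<close>

lemma Usv_elem_Rep: "Usv_elem x = Rep_usv (usv_var x)"
  by (simp add: Usv_elem_def usv_var_def Rep_usv_class)

lemma Usv_const_Rep: "Usv_const c = Rep_usv (usv_cst c)"
  by (simp add: Usv_const_def usv_cst_def Rep_usv_class)

lemma sv_plus_iff: "x \<in> sv_plus \<longleftrightarrow> (\<forall>a\<in>Poly_Mapping.keys x. key a \<ge> 2)"
proof -
  have "a \<in> {Lix n | n. n \<ge> 1} \<union> {Mix n | n. n \<ge> 1} \<union> {Yix m | m. m \<ge> 0} \<longleftrightarrow> key a \<ge> 2" for a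
    by (cases a) auto
  then show ?thesis unfolding sv_plus_def by blast
qed

lemma sv_plus_add: "x \<in> sv_plus \<Longrightarrow> y \<in> sv_plus \<Longrightarrow> x + y \<in> sv_plus"
  using keys_add[of x y] unfolding sv_plus_iff by blast

lemma sv_plus_scale: "x \<in> sv_plus \<Longrightarrow> sv_scale c x \<in> sv_plus"
  unfolding sv_plus_iff by (auto simp: in_keys_iff lookup_sv_scale)

lemma sv_plus_bracket:
  assumes x: "x \<in> sv_plus" and y: "y \<in> sv_plus" shows "sv_bracket x y \<in> sv_plus"
proof -
  have zero: "0 \<in> sv_plus" by (simp add: sv_plus_iff)
  have sum: "(\<Sum>i\<in>I. f i) \<in> sv_plus" if "\<And>i. i \<in> I \<Longrightarrow> f i \<in> sv_plus" for I :: "sv_index set" and f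
    using that by (induction I rule: infinite_finite_induct) (auto simp: zero intro: sv_plus_add)
  have "sv_basis_bracket a b \<in> sv_plus" if "a \<in> Poly_Mapping.keys x" "b \<in> Poly_Mapping.keys y" for a b
  proof -
    have "key a \<ge> 2" "key b \<ge> 1" using x y that by (force simp: sv_plus_iff)+
    from key_bracket_positive[OF this] show ?thesis
      by (auto simp: sv_basis_bracket_single sv_plus_iff split: if_splits)
  qed
  then show ?thesis unfolding sv_bracket_def by (intro sum sv_plus_scale)
qed

lemma lookup_mult_zero: "Poly_Mapping.lookup (p * q) 0 = Poly_Mapping.lookup p 0 * Poly_Mapping.lookup q 0"
  for p q :: "'a nc_poly"
proof (induction p rule: poly_mapping_sum_induct)
  case (single v c)
  show ?case
  proof (induction q rule: poly_mapping_sum_induct)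
    case (single w d)
    have "v + w = 0 \<longleftrightarrow> v = 0 \<and> w = 0"
      by (cases v; cases w) (auto simp: plus_free_word_def zero_free_word_def)
    then show ?case by (auto simp: mult_single lookup_single when_def)
  qed (simp_all add: distrib_left lookup_add)
qed (simp_all add: distrib_right lookup_add)

lemma free_alg_mult_closed:
  "p \<in> carrier (free_alg g) \<Longrightarrow> q \<in> carrier (free_alg g) \<Longrightarrow> p * q \<in> carrier (free_alg g)"
  and free_alg_add_closed:
  "p \<in> carrier (free_alg g) \<Longrightarrow> q \<in> carrier (free_alg g) \<Longrightarrow> p + q \<in> carrier (free_alg g)"
  and free_alg_minus_closed: "p \<in> carrier (free_alg g) \<Longrightarrow> - p \<in> carrier (free_alg g)"
  and free_alg_diff_closed:
  "p \<in> carrier (free_alg g) \<Longrightarrow> q \<in> carrier (free_alg g) \<Longrightarrow> p - q \<in> carrier (free_alg g)"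
proof -
  interpret ring "free_alg g" by (rule ring_free_alg)
  show mult: "p \<in> carrier (free_alg g) \<Longrightarrow> q \<in> carrier (free_alg g) \<Longrightarrow> p * q \<in> carrier (free_alg g)"
    and add: "p \<in> carrier (free_alg g) \<Longrightarrow> q \<in> carrier (free_alg g) \<Longrightarrow> p + q \<in> carrier (free_alg g)" for p q
    using m_closed[of p q] a_closed[of p q] by simp_all
  show minus: "p \<in> carrier (free_alg g) \<Longrightarrow> - p \<in> carrier (free_alg g)" for p
    by (auto simp: free_alg_def in_keys_iff)
  show "p \<in> carrier (free_alg g) \<Longrightarrow> q \<in> carrier (free_alg g) \<Longrightarrow> p - q \<in> carrier (free_alg g)"
    using add[of p "- q"] minus[of q] by simp
qed

lemma nc_var_in_free_alg: "x \<in> g \<Longrightarrow> nc_var x \<in> carrier (free_alg g)"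
  and nc_const_in_free_alg: "nc_const c \<in> carrier (free_alg g)"
  by (auto simp: free_alg_def nc_var_def nc_const_def zero_free_word_def split: if_splits)

abbreviation plus_polys :: "sv nc_poly set" where
  "plus_polys \<equiv> carrier (free_alg sv_plus)"

lemma uea_rels_sv_plus_subset: "uea_rels sv_plus \<subseteq> plus_polys"
  unfolding uea_rels_def
  by (auto intro!: free_alg_diff_closed free_alg_mult_closed nc_var_in_free_alg nc_const_in_free_alg
      sv_plus_add sv_plus_scale sv_plus_bracket)

lemma ideal_uea_sv_plus: "ideal (uea_ideal sv_plus) (free_alg sv_plus)"
  unfolding uea_ideal_def by (rule ring.genideal_ideal[OF ring_free_alg uea_rels_sv_plus_subset])

lemma lookup_nc_var_zero [simp]: "Poly_Mapping.lookup (nc_var x) 0 = 0"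
  by (simp add: nc_var_def zero_free_word_def lookup_single)

text \<open>The two properties make the inclusion into the enveloping algebra of \<open>sv\<close> and the augmentation,
  the action on the trivial module, well defined on cosets.\<close>

lemma uea_ideal_sv_plus:
  "uea_ideal sv_plus \<subseteq> {p \<in> plus_polys. p \<in> uea_ideal UNIV \<and> Poly_Mapping.lookup p 0 = 0}"
proof -
  let ?S = "{p \<in> plus_polys. p \<in> uea_ideal UNIV \<and> Poly_Mapping.lookup p 0 = 0}"
  have "ideal ?S (free_alg sv_plus)"
    by (rule ideal_free_algI)
      (auto simp: usv_class_eq_0[symmetric] usv_class_minus lookup_add lookup_mult_zero
        intro: free_alg_add_closed free_alg_minus_closed free_alg_mult_closed,
       simp add: free_alg_def)
  moreover have "uea_rels sv_plus \<subseteq> ?S"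
  proof -
    have "uea_rels sv_plus \<subseteq> uea_rels UNIV" unfolding uea_rels_def by blast
    moreover have "Poly_Mapping.lookup r 0 = 0" if "r \<in> uea_rels sv_plus" for r
      using that unfolding uea_rels_def by (auto simp: lookup_minus lookup_mult_zero)
    ultimately show ?thesis using uea_rels_sv_plus_subset uea_rels_subset by blast
  qed
  ultimately show ?thesis
    unfolding uea_ideal_def[of sv_plus] by (rule ring.genideal_minimal[OF ring_free_alg])
qed

definition plus_coset :: "sv nc_poly \<Rightarrow> sv nc_poly set" where
  "plus_coset p = uea_ideal sv_plus +>\<^bsub>free_alg sv_plus\<^esub> p"

lemma carrier_uea_sv_plus: "carrier (uea sv_plus) = plus_coset ` plus_polys"
  by (auto simp: uea_def FactRing_def A_RCOSETS_defs a_r_coset_def plus_coset_def)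

lemma plus_coset_elem: "q \<in> plus_coset p \<longleftrightarrow> q - p \<in> uea_ideal sv_plus"
  by (auto simp: plus_coset_def a_r_coset_def' eq_diff_eq intro: bexI[of _ "q - p"])

lemma plus_coset_self: "p \<in> plus_coset p"
  using additive_subgroup.zero_closed[OF ideal.axioms(1)[OF ideal_uea_sv_plus]]
  by (simp add: plus_coset_elem)

lemma uea_incl_coset: "uea_incl (plus_coset p) = Rep_usv (usv_class p)"
proof -
  have "uea_ideal UNIV +>\<^bsub>free_alg UNIV\<^esub> q = Rep_usv (usv_class p)" if "q \<in> plus_coset p" for q
  proof -
    have "q - p \<in> uea_ideal UNIV" using that uea_ideal_sv_plus by (auto simp: plus_coset_elem)
    then have "usv_class (q - p) = 0" by (simp only: usv_class_eq_0)
    then have "usv_class q = usv_class p" by simp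
    then show ?thesis by (simp add: Rep_usv_class[symmetric])
  qed
  then show ?thesis unfolding uea_incl_def using plus_coset_self by (intro SUP_eq_const) auto
qed

text \<open>All words but the empty one contain a letter on which \<open>\<psi>\<close> vanishes.\<close>

lemma nc_eval_zero_type:
  assumes "\<forall>x\<in>sv_plus. \<psi> x = 0" "p \<in> plus_polys"
  shows "nc_eval \<psi> p = Poly_Mapping.lookup p 0"
proof -
  have "Poly_Mapping.lookup p w * prod_list (map \<psi> (letters w)) = (if w = 0 then Poly_Mapping.lookup p 0 else 0)"
    if "w \<in> Poly_Mapping.keys p" for w
  proof (cases "letters w")
    case Nil
    then have "w = 0" by (cases w) (simp add: zero_free_word_def)
    then show ?thesis by simp
  next
    case (Cons x xs)
    then have "x \<in> sv_plus" using that assms(2) by (auto simp: free_alg_def)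
    moreover have "w \<noteq> 0" using Cons by auto
    ultimately show ?thesis using Cons assms(1) by simp
  qed
  then have "nc_eval \<psi> p = (\<Sum>w\<in>Poly_Mapping.keys p. if w = 0 then Poly_Mapping.lookup p 0 else 0)"
    unfolding nc_eval_def by (rule sum.cong[OF refl])
  also have "\<dots> = Poly_Mapping.lookup p 0"
    by (simp add: sum.delta in_keys_iff)
  finally show ?thesis .
qed

lemma C_mod_smult:
  assumes "\<forall>x\<in>sv_plus. \<psi> x = 0" "p \<in> plus_polys"
  shows "plus_coset p \<odot>\<^bsub>C_mod \<psi>\<^esub> z = Poly_Mapping.lookup p 0 * z"
proof -
  have "nc_eval \<psi> q = Poly_Mapping.lookup p 0" if "q \<in> plus_coset p" for q
  proof -
    have *: "q - p \<in> plus_polys" "Poly_Mapping.lookup (q - p) 0 = 0"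
      using that uea_ideal_sv_plus by (auto simp: plus_coset_elem)
    have "q \<in> plus_polys" using free_alg_add_closed[OF *(1) assms(2)] by simp
    then show ?thesis using nc_eval_zero_type[OF assms(1)] *(2) by (simp add: lookup_minus)
  qed
  then have "nc_eval \<psi> ` plus_coset p = {Poly_Mapping.lookup p 0}" using plus_coset_self by force
  then show ?thesis by (simp add: C_mod_def)
qed

type_synonym W_free_elem = "sv nc_poly set \<times> complex \<Rightarrow>\<^sub>0 int"

text \<open>The generator of the free abelian group that represents the tensor \<open>u \<otimes> z\<close>.\<close>

definition pure :: "usv \<Rightarrow> complex \<Rightarrow> W_free_elem" where
  "pure u z = frag_of (Rep_usv u, z)"

abbreviation W_free :: "W_free_elem monoid" where
  "W_free \<equiv> free_Abelian_group (carrier Usv \<times> UNIV)"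

text \<open>The relations of the tensor product, with the elements of the two enveloping algebras replaced by
  representatives. The type \<open>\<psi>\<close> no longer occurs, since it acts through the augmentation.\<close>

definition W_rels :: "W_free_elem set" where
  "W_rels = {pure (u + v) z - pure u z - pure v z | u v z. True} \<union>
     {pure u (y + z) - pure u y - pure u z | u y z. True} \<union>
     {pure (u * usv_class p) z - pure u (Poly_Mapping.lookup p 0 * z) | u p z. p \<in> plus_polys}"

lemma tensor_rels_eq:
  assumes "\<forall>x\<in>sv_plus. \<psi> x = 0"
  shows "tensor_rels (uea sv_plus) (regular_module Usv) Usv_ract (C_mod \<psi>) = W_rels"
proof -
  have carr: "carrier (regular_module Usv) = range Rep_usv" "carrier (C_mod \<psi>) = UNIV"
    "add (regular_module Usv) = add Usv" "add (C_mod \<psi>) = (+)"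
    by (simp_all add: regular_module_def carrier_Usv C_mod_def)
  have r1: "{frag_of (m \<oplus>\<^bsub>Usv\<^esub> m', n) - frag_of (m, n) - frag_of (m', n) | m m' n.
        m \<in> range Rep_usv \<and> m' \<in> range Rep_usv \<and> n \<in> (UNIV :: complex set)}
      = {pure (u + v) z - pure u z - pure v z | u v z. True}"
    unfolding pure_def Rep_usv_simps by blast
  have r2: "{frag_of (m, n + n') - frag_of (m, n) - frag_of (m, n') | m n n'.
        m \<in> range Rep_usv \<and> n \<in> (UNIV :: complex set) \<and> n' \<in> (UNIV :: complex set)}
      = {pure u (y + z) - pure u y - pure u z | u y z. True}"
    unfolding pure_def by blast
  have r3: "{frag_of (Usv_ract m a, n) - frag_of (m, a \<odot>\<^bsub>C_mod \<psi>\<^esub> n) | m a n.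
        m \<in> range Rep_usv \<and> a \<in> plus_coset ` plus_polys \<and> n \<in> (UNIV :: complex set)}
      = {pure (u * usv_class p) z - pure u (Poly_Mapping.lookup p 0 * z) | u p z. p \<in> plus_polys}"
    (is "?A = ?B")
  proof -
    have eq: "frag_of (Usv_ract (Rep_usv u) (plus_coset p), z) - frag_of (Rep_usv u, plus_coset p \<odot>\<^bsub>C_mod \<psi>\<^esub> z)
        = pure (u * usv_class p) z - pure u (Poly_Mapping.lookup p 0 * z)" if "p \<in> plus_polys" for u p z
      by (simp add: Usv_ract_def uea_incl_coset C_mod_smult[OF assms that] pure_def Rep_usv_simps)
    show ?thesis
    proof (intro equalityI subsetI)
      fix x assume "x \<in> ?A"
      then obtain u p z where "p \<in> plus_polys"
        "x = frag_of (Usv_ract (Rep_usv u) (plus_coset p), z) - frag_of (Rep_usv u, plus_coset p \<odot>\<^bsub>C_mod \<psi>\<^esub> z)"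
        by blast
      then show "x \<in> ?B" using eq by blast
    next
      fix x assume "x \<in> ?B"
      then obtain u p z where p: "p \<in> plus_polys"
        "x = pure (u * usv_class p) z - pure u (Poly_Mapping.lookup p 0 * z)"
        by blast
      have "x = frag_of (Usv_ract (Rep_usv u) (plus_coset p), z) - frag_of (Rep_usv u, plus_coset p \<odot>\<^bsub>C_mod \<psi>\<^esub> z)"
        unfolding p(2) eq[OF p(1)] ..
      then show "x \<in> ?A" using p(1) by blast
    qed
  qed
  show ?thesis
    unfolding tensor_rels_def carr carrier_uea_sv_plus W_rels_def r1 r2 r3 ..
qed

definition W_kernel :: "W_free_elem set" where
  "W_kernel = generate W_free W_rels"

definition W_coset :: "W_free_elem \<Rightarrow> W_elem" where
  "W_coset p = W_kernel #>\<^bsub>W_free\<^esub> p"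

lemma pure_in_W_free: "pure u z \<in> carrier W_free"
  by (simp add: pure_def keys_frag_of carrier_Usv)

lemma W_free_add: "p \<in> carrier W_free \<Longrightarrow> q \<in> carrier W_free \<Longrightarrow> p + q \<in> carrier W_free"
  and W_free_diff: "p \<in> carrier W_free \<Longrightarrow> q \<in> carrier W_free \<Longrightarrow> p - q \<in> carrier W_free"
  unfolding carrier_free_Abelian_group_iff using keys_add[of p q] keys_diff[of p q] by blast+

lemma W_free_induct [consumes 1, case_names zero diff pure]:
  assumes "p \<in> carrier W_free" "P 0"
    "\<And>p q. p \<in> carrier W_free \<Longrightarrow> q \<in> carrier W_free \<Longrightarrow> P p \<Longrightarrow> P q \<Longrightarrow> P (p - q)"
    "\<And>u z. P (pure u z)"
  shows "P p"
proof -
  have "Poly_Mapping.keys p \<subseteq> carrier Usv \<times> UNIV" using assms(1) by simp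
  then show ?thesis
  proof (rule free_Abelian_group_induct)
    fix a :: "sv nc_poly set \<times> complex" assume "a \<in> carrier Usv \<times> UNIV"
    then obtain u where "a = (Rep_usv u, snd a)" by (cases a) (auto simp: carrier_Usv)
    then show "P (frag_of a)" using assms(4) by (metis pure_def)
  qed (use assms in auto)
qed

lemma W_rels_subset: "W_rels \<subseteq> carrier W_free"
  unfolding W_rels_def using pure_in_W_free W_free_diff by blast

lemma subgroup_W_kernel: "subgroup W_kernel W_free"
  unfolding W_kernel_def
  by (rule group.generate_is_subgroup[OF group_free_Abelian_group W_rels_subset])

lemma W_kernel_closed:
  "0 \<in> W_kernel" "p \<in> W_kernel \<Longrightarrow> q \<in> W_kernel \<Longrightarrow> p + q \<in> W_kernel"
  "p \<in> W_kernel \<Longrightarrow> - p \<in> W_kernel" "p \<in> W_kernel \<Longrightarrow> q \<in> W_kernel \<Longrightarrow> p - q \<in> W_kernel"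
  "W_kernel \<subseteq> carrier W_free"
proof -
  interpret subgroup W_kernel W_free by (rule subgroup_W_kernel)
  show zero: "0 \<in> W_kernel" and add: "p \<in> W_kernel \<Longrightarrow> q \<in> W_kernel \<Longrightarrow> p + q \<in> W_kernel"
    and sub: "W_kernel \<subseteq> carrier W_free" for p q
    using one_closed m_closed[of p q] subset by simp_all
  show neg: "- p \<in> W_kernel" if p: "p \<in> W_kernel" for p
  proof -
    have "inv\<^bsub>W_free\<^esub> p = - p" using subsetD[OF sub p] by (intro inv_free_Abelian_group) simp
    then show ?thesis using m_inv_closed[OF p] by simp
  qed
  show "p \<in> W_kernel \<Longrightarrow> q \<in> W_kernel \<Longrightarrow> p - q \<in> W_kernel"
    using add[of p "- q"] neg[of q] by simp
qed

lemma W_rels_in_kernel: "r \<in> W_rels \<Longrightarrow> r \<in> W_kernel"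
  unfolding W_kernel_def by (rule generate.incl)

lemma W_kernel_induct [consumes 1, case_names zero rel minus add]:
  assumes "p \<in> W_kernel" "P 0" "\<And>r. r \<in> W_rels \<Longrightarrow> P r" "\<And>r. P r \<Longrightarrow> P (- r)" "\<And>p q. P p \<Longrightarrow> P q \<Longrightarrow> P (p + q)"
  shows "P p"
  using assms(1) unfolding W_kernel_def
proof (induction rule: generate.induct)
  case (inv h)
  then have "Poly_Mapping.keys h \<subseteq> carrier Usv \<times> UNIV" using subsetD[OF W_rels_subset] by simp
  then show ?case using assms(3,4) inv by simp
qed (use assms in auto)

lemma pure_add_left: "pure (u + v) z - pure u z - pure v z \<in> W_kernel"
  and pure_add_right: "pure u (y + z) - pure u y - pure u z \<in> W_kernel"
  and pure_balanced: "p \<in> plus_polys \<Longrightarrow>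
    pure (u * usv_class p) z - pure u (Poly_Mapping.lookup p 0 * z) \<in> W_kernel"
  by (rule W_rels_in_kernel; unfold W_rels_def; blast)+

lemma W_coset_eq: "W_coset p = W_coset q \<longleftrightarrow> p - q \<in> W_kernel"
proof -
  have mem: "r \<in> W_coset p \<longleftrightarrow> r - p \<in> W_kernel" for r p
    by (auto simp: W_coset_def r_coset_def eq_diff_eq intro: bexI[of _ "r - p"])
  show ?thesis
  proof
    assume "W_coset p = W_coset q"
    then have "p \<in> W_coset q" using mem[of p p] W_kernel_closed(1) by simp
    then show "p - q \<in> W_kernel" by (simp add: mem)
  next
    assume *: "p - q \<in> W_kernel"
    show "W_coset p = W_coset q"
    proof (rule Set.set_eqI)
      fix r
      have "(r - p) + (p - q) = r - q" "(r - q) - (p - q) = r - p" by simp_all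
      then show "r \<in> W_coset p \<longleftrightarrow> r \<in> W_coset q"
        unfolding mem using * W_kernel_closed by metis
    qed
  qed
qed

definition free_act :: "usv \<Rightarrow> W_free_elem \<Rightarrow> W_free_elem" where
  "free_act u = frag_extend (\<lambda>(m, n). frag_of (Rep_usv u \<otimes>\<^bsub>Usv\<^esub> m, n))"

lemma free_act_simps [simp]:
  "free_act u 0 = 0" "free_act u (p + q) = free_act u p + free_act u q"
  "free_act u (p - q) = free_act u p - free_act u q" "free_act u (- p) = - free_act u p"
  "free_act u (pure v z) = pure (u * v) z"
  by (simp_all add: free_act_def frag_extend_add frag_extend_diff frag_extend_minus pure_def Rep_usv_simps)

lemma free_act_closed: "p \<in> carrier W_free \<Longrightarrow> free_act u p \<in> carrier W_free"
proof (induction rule: W_free_induct)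
  case (pure v z)
  then show ?case unfolding free_act_simps by (rule pure_in_W_free)
qed (auto intro: W_free_diff simp del: carrier_free_Abelian_group_iff, simp)

lemma free_act_kernel: "p \<in> W_kernel \<Longrightarrow> free_act u p \<in> W_kernel"
proof (induction rule: W_kernel_induct)
  case (rel r)
  then show ?case
    unfolding W_rels_def
  proof (elim UnE CollectE exE conjE)
    fix v w z assume "r = pure (v + w) z - pure v z - pure w z"
    then show ?thesis using pure_add_left[of "u * v" "u * w" z] by (simp add: distrib_left)
  next
    fix v y z assume "r = pure v (y + z) - pure v y - pure v z"
    then show ?thesis using pure_add_right[of "u * v" y z] by simp
  next
    fix v p z assume "r = pure (v * usv_class p) z - pure v (Poly_Mapping.lookup p 0 * z)"
      "p \<in> plus_polys"
    then show ?thesis using pure_balanced[of p "u * v" z] by (simp add: mult.assoc)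
  qed
qed (auto intro: W_kernel_closed)

context
  fixes \<psi> :: "sv \<Rightarrow> complex"
  assumes \<psi>: "\<forall>x\<in>sv_plus. \<psi> x = 0"
begin

lemma tensor_kernel_eq: "tensor_kernel (uea sv_plus) (regular_module Usv) Usv_ract (C_mod \<psi>) = W_kernel"
  unfolding tensor_kernel_def W_kernel_def tensor_rels_eq[OF \<psi>]
  by (simp add: regular_module_def C_mod_def)

lemma W_mod_simps:
  "carrier (W_mod \<psi>) = W_coset ` carrier W_free" "\<zero>\<^bsub>W_mod \<psi>\<^esub> = W_coset 0"
  "add (W_mod \<psi>) = monoid.mult (W_free Mod W_kernel)"
  "W_gen \<psi> = W_coset (pure 1 1)"
proof -
  have F: "free_Abelian_group (carrier (regular_module Usv) \<times> carrier (C_mod \<psi>)) = W_free"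
    by (simp add: regular_module_def C_mod_def)
  show "carrier (W_mod \<psi>) = W_coset ` carrier W_free" "add (W_mod \<psi>) = monoid.mult (W_free Mod W_kernel)"
    unfolding W_mod_def tensor_product_def tensor_kernel_eq F Let_def
    by (auto simp: FactGroup_def RCOSETS_def W_coset_def)
  have "W_coset 0 = W_kernel" by (auto simp: W_coset_def r_coset_def)
  then show "\<zero>\<^bsub>W_mod \<psi>\<^esub> = W_coset 0"
    unfolding W_mod_def tensor_product_def tensor_kernel_eq F Let_def by (simp add: FactGroup_def)
  show "W_gen \<psi> = W_coset (pure 1 1)"
    unfolding W_gen_def tensor_elem_def tensor_kernel_eq F by (simp add: W_coset_def pure_def Rep_usv_simps)
qed

lemma W_coset_add:
  assumes "p \<in> carrier W_free" "q \<in> carrier W_free"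
  shows "W_coset p \<oplus>\<^bsub>W_mod \<psi>\<^esub> W_coset q = W_coset (p + q)"
proof -
  interpret normal W_kernel W_free
    by (rule comm_group.subgroup_imp_normal[OF abelian_free_Abelian_group subgroup_W_kernel])
  show ?thesis unfolding W_mod_simps W_coset_def using rcos_sum[OF assms] by simp
qed

lemma W_act_coset:
  assumes "p \<in> carrier W_free"
  shows "act (W_mod \<psi>) u (W_coset p) = W_coset (free_act u p)"
proof -
  have F: "free_Abelian_group (carrier (regular_module Usv) \<times> carrier (C_mod \<psi>)) = W_free"
    by (simp add: regular_module_def C_mod_def)
  have "act (W_mod \<psi>) u (W_coset p) = (\<Union>q\<in>W_coset p. W_coset (free_act u q))"
    unfolding act_def W_mod_def tensor_product_def tensor_kernel_eq F Let_def free_act_def W_coset_def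
    by (simp add: regular_module_def)
  also have "\<dots> = W_coset (free_act u p)"
  proof (rule SUP_eq_const)
    show "W_coset p \<noteq> {}" using W_kernel_closed(1) by (auto simp: W_coset_def r_coset_def)
    fix q assume "q \<in> W_coset p"
    then have "q - p \<in> W_kernel" by (auto simp: W_coset_def r_coset_def)
    then have "free_act u (q - p) \<in> W_kernel" by (rule free_act_kernel)
    then show "W_coset (free_act u q) = W_coset (free_act u p)" by (simp add: W_coset_eq)
  qed
  finally show ?thesis .
qed

lemma left_module_W: "left_module Usv (W_mod \<psi>)"
proof -
  have "abelian_group (W_mod \<psi>)"
  proof (rule comm_group_abelian_groupI)
    have group: "comm_group (W_free Mod W_kernel)"
      by (rule comm_group.abelian_FactGroup[OF abelian_free_Abelian_group subgroup_W_kernel])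
    have "W_free Mod W_kernel
        = \<lparr>carrier = carrier (W_mod \<psi>), monoid.mult = add (W_mod \<psi>), one = \<zero>\<^bsub>W_mod \<psi>\<^esub>\<rparr>"
      unfolding W_mod_simps by (auto simp: FactGroup_def RCOSETS_def W_coset_def r_coset_def)
    from comm_group_extend[OF group[unfolded this]] show "comm_group (add_monoid (W_mod \<psi>))" .
  qed
  moreover have "module_axioms Usv (W_mod \<psi>)"
  proof -
    have smult: "Rep_usv u \<odot>\<^bsub>W_mod \<psi>\<^esub> W_coset p = W_coset (free_act u p)" if "p \<in> carrier W_free" for u p
      using W_act_coset[OF that] by (simp add: act_def)
    have add_left: "free_act (u + v) p - (free_act u p + free_act v p) \<in> W_kernel" if "p \<in> carrier W_free" for u v p
      using that
    proof (induction rule: W_free_induct)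
      case (diff p q)
      then show ?case using W_kernel_closed(4)[OF diff(3,4)] by (simp add: algebra_simps)
    next
      case (pure w z)
      then show ?case using pure_add_left[of "u * w" "v * w" z] by (simp add: distrib_right algebra_simps)
    qed (simp add: W_kernel_closed)
    have mult: "free_act (u * v) p = free_act u (free_act v p)" if "p \<in> carrier W_free" for u v p
      using that by (induction rule: W_free_induct) (simp_all add: mult.assoc)
    have one: "free_act 1 p = p" if "p \<in> carrier W_free" for p
      using that by (induction rule: W_free_induct) simp_all
    have rep: "\<exists>u. a = Rep_usv u" if "a \<in> carrier Usv" for a
      using that unfolding carrier_Usv by blast
    have coset: "\<exists>p. X = W_coset p \<and> p \<in> carrier W_free" if "X \<in> carrier (W_mod \<psi>)" for X
      using that unfolding W_mod_simps(1) by blast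
    show ?thesis
    proof (rule module_axioms.intro)
      fix a X assume a_in: "a \<in> carrier Usv" and X_in: "X \<in> carrier (W_mod \<psi>)"
      obtain u where a: "a = Rep_usv u" using rep[OF a_in] by blast
      obtain p where X: "X = W_coset p" and p: "p \<in> carrier W_free" using coset[OF X_in] by blast
      show "a \<odot>\<^bsub>W_mod \<psi>\<^esub> X \<in> carrier (W_mod \<psi>)"
        unfolding a X smult[OF p] W_mod_simps(1) using free_act_closed[OF p] by blast
    next
      fix a b X assume a_in: "a \<in> carrier Usv" and b_in: "b \<in> carrier Usv" and X_in: "X \<in> carrier (W_mod \<psi>)"
      obtain u where a: "a = Rep_usv u" using rep[OF a_in] by blast
      obtain v where b: "b = Rep_usv v" using rep[OF b_in] by blast
      obtain p where X: "X = W_coset p" and p: "p \<in> carrier W_free" using coset[OF X_in] by blast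
      show "(a \<oplus>\<^bsub>Usv\<^esub> b) \<odot>\<^bsub>W_mod \<psi>\<^esub> X = a \<odot>\<^bsub>W_mod \<psi>\<^esub> X \<oplus>\<^bsub>W_mod \<psi>\<^esub> b \<odot>\<^bsub>W_mod \<psi>\<^esub> X"
        unfolding a b X Rep_usv_simps[symmetric] smult[OF p] W_coset_add[OF free_act_closed[OF p] free_act_closed[OF p]]
          W_coset_eq by (rule add_left[OF p])
      show "(a \<otimes>\<^bsub>Usv\<^esub> b) \<odot>\<^bsub>W_mod \<psi>\<^esub> X = a \<odot>\<^bsub>W_mod \<psi>\<^esub> (b \<odot>\<^bsub>W_mod \<psi>\<^esub> X)"
        unfolding a b X Rep_usv_simps[symmetric] smult[OF p] smult[OF free_act_closed[OF p]] mult[OF p] ..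
    next
      fix a X Z assume a_in: "a \<in> carrier Usv" and X_in: "X \<in> carrier (W_mod \<psi>)" and Z_in: "Z \<in> carrier (W_mod \<psi>)"
      obtain u where a: "a = Rep_usv u" using rep[OF a_in] by blast
      obtain p where X: "X = W_coset p" and p: "p \<in> carrier W_free" using coset[OF X_in] by blast
      obtain q where Z: "Z = W_coset q" and q: "q \<in> carrier W_free" using coset[OF Z_in] by blast
      show "a \<odot>\<^bsub>W_mod \<psi>\<^esub> (X \<oplus>\<^bsub>W_mod \<psi>\<^esub> Z) = a \<odot>\<^bsub>W_mod \<psi>\<^esub> X \<oplus>\<^bsub>W_mod \<psi>\<^esub> a \<odot>\<^bsub>W_mod \<psi>\<^esub> Z"
        unfolding a X Z W_coset_add[OF p q] smult[OF p] smult[OF q] smult[OF W_free_add[OF p q]]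
          W_coset_add[OF free_act_closed[OF p] free_act_closed[OF q]] free_act_simps ..
    next
      fix X assume X_in: "X \<in> carrier (W_mod \<psi>)"
      obtain p where X: "X = W_coset p" and p: "p \<in> carrier W_free" using coset[OF X_in] by blast
      show "\<one>\<^bsub>Usv\<^esub> \<odot>\<^bsub>W_mod \<psi>\<^esub> X = X"
        unfolding X Rep_usv_simps(2)[symmetric] smult[OF p] one[OF p] ..
    qed
  qed
  ultimately show ?thesis by (simp add: left_module_def Usv.ring_axioms)
qed

end

text \<open>Every tensor is pure with second factor \<open>1\<close>, because the scalar \<open>z\<close> can be moved to the left
  through the constants of the enveloping algebra of \<open>sv_plus\<close>.\<close>

lemma exists_pure:
  assumes "p \<in> carrier W_free" shows "\<exists>u. p - pure u 1 \<in> W_kernel"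
  using assms
proof (induction rule: W_free_induct)
  case zero
  have "- (pure (0 + 0) 1 - pure 0 1 - pure 0 1) \<in> W_kernel" by (intro W_kernel_closed pure_add_left)
  then have "pure 0 1 \<in> W_kernel" by simp
  then have "0 - pure 0 1 \<in> W_kernel" by (intro W_kernel_closed)
  then show ?case by blast
next
  case (diff p q)
  then obtain u v where u: "p - pure u 1 \<in> W_kernel" and v: "q - pure v 1 \<in> W_kernel" by blast
  have "(p - pure u 1) - (q - pure v 1) + (pure ((u - v) + v) 1 - pure (u - v) 1 - pure v 1) \<in> W_kernel"
    by (intro W_kernel_closed u v pure_add_left)
  then have "(p - q) - pure (u - v) 1 \<in> W_kernel" by (simp add: algebra_simps)
  then show ?case by blast
next
  case (pure u z)
  have "pure (u * usv_class (nc_const z)) 1 - pure u (Poly_Mapping.lookup (nc_const z :: sv nc_poly) 0 * 1) \<in> W_kernel"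
    by (intro pure_balanced nc_const_in_free_alg)
  then have "- (pure (u * usv_class (nc_const z)) 1 - pure u z) \<in> W_kernel"
    by (intro W_kernel_closed(3)) (simp add: nc_const_def)
  then show ?case by (intro exI[of _ "u * usv_class (nc_const z)"]) simp
qed

lemma poly_mapping_sum_single: "p = (\<Sum>k\<in>Poly_Mapping.keys p. Poly_Mapping.single k (Poly_Mapping.lookup p k))"
  for p :: "'a \<Rightarrow>\<^sub>0 'b::comm_monoid_add"
  by (intro poly_mapping_eqI) (simp add: lookup_sum lookup_single when_def sum.delta in_keys_iff)

abbreviation positive_ideal :: "usv set" where
  "positive_ideal \<equiv> left_hull usv.positive_letters"

lemma usv_var_sv_plus:
  assumes "x \<in> sv_plus" shows "usv_var x \<in> positive_ideal"
proof -
  have J: "left_ideal positive_ideal" by (rule left_ideal_left_hull)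
  have letter: "usv_basis a \<in> positive_ideal" if "key a \<ge> 2" for a
  proof (rule subsetD[OF left_hull_superset])
    show "usv_basis a \<in> usv.positive_letters"
      using that unfolding usv.positive_letters_def by (cases a) auto
  qed
  have var_sum: "usv_var (\<Sum>i\<in>I. f i) = (\<Sum>i\<in>I. usv_var (f i))" for I :: "sv_index set" and f
    by (induction I rule: infinite_finite_induct) (simp_all add: usv_var_zero usv_var_add)
  have "usv_var x = (\<Sum>a\<in>Poly_Mapping.keys x. usv_cst (Poly_Mapping.lookup x a) * usv_basis a)"
    by (subst poly_mapping_sum_single) (simp only: var_sum usv_var_single[symmetric])
  also have "\<dots> \<in> positive_ideal"
    using assms by (intro left_ideal_sum[OF J] left_idealD(3)[OF J] letter) (auto simp: sv_plus_iff)
  finally show ?thesis .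
qed

text \<open>A nonempty word in \<open>sv_plus\<close> ends with a letter of \<open>sv_plus\<close>.\<close>

lemma usv_class_augmentation:
  assumes "p \<in> plus_polys"
  shows "usv_class p - usv_cst (Poly_Mapping.lookup p 0) \<in> positive_ideal"
proof -
  have J: "left_ideal positive_ideal" by (rule left_ideal_left_hull)
  have class_sum: "usv_class (\<Sum>i\<in>I. f i) = (\<Sum>i\<in>I. usv_class (f i))" for I :: "sv free_word set" and f
    by (induction I rule: infinite_finite_induct) simp_all
  have cst_zero: "usv_cst 0 = 0" by (rule usv.cst_0)
  have "usv_class (Poly_Mapping.single w c) - (if w = 0 then usv_cst c else 0) \<in> positive_ideal"
    if "w \<in> Poly_Mapping.keys p" for w c
  proof (cases "letters w" rule: rev_cases)
    case Nil
    then have "w = 0" by (cases w) (simp add: zero_free_word_def)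
    then show ?thesis by (simp add: usv_cst_def nc_const_def left_idealD(1)[OF J])
  next
    case (snoc xs x)
    then have x: "x \<in> sv_plus" using that assms by (auto simp: free_alg_def)
    have "Poly_Mapping.single w c = Poly_Mapping.single (Word xs) c * nc_var x"
      using snoc by (cases w) (simp add: nc_var_def mult_single plus_free_word_def)
    then have "usv_class (Poly_Mapping.single w c) = usv_class (Poly_Mapping.single (Word xs) c) * usv_var x"
      by (simp add: usv_var_def)
    moreover have "w \<noteq> 0" using snoc by auto
    ultimately show ?thesis using left_idealD(3)[OF J usv_var_sv_plus[OF x]] by simp
  qed
  then have "(\<Sum>w\<in>Poly_Mapping.keys p. usv_class (Poly_Mapping.single w (Poly_Mapping.lookup p w))
      - (if w = 0 then usv_cst (Poly_Mapping.lookup p w) else 0)) \<in> positive_ideal"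
    by (intro left_ideal_sum[OF J])
  also have "(\<Sum>w\<in>Poly_Mapping.keys p. usv_class (Poly_Mapping.single w (Poly_Mapping.lookup p w))
      - (if w = 0 then usv_cst (Poly_Mapping.lookup p w) else 0)) = usv_class p - usv_cst (Poly_Mapping.lookup p 0)"
  proof -
    have "(\<Sum>w\<in>Poly_Mapping.keys p. usv_class (Poly_Mapping.single w (Poly_Mapping.lookup p w))) = usv_class p"
      unfolding class_sum[symmetric] poly_mapping_sum_single[symmetric] ..
    moreover have "(\<Sum>w\<in>Poly_Mapping.keys p. if w = 0 then usv_cst (Poly_Mapping.lookup p w) else 0) = usv_cst (Poly_Mapping.lookup p 0)"
      using cst_zero by (simp add: sum.delta in_keys_iff)
    ultimately show ?thesis by (simp add: sum_subtractf)
  qed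
  finally show ?thesis .
qed

text \<open>The map \<open>u \<otimes> z \<mapsto> u z\<close>. It is balanced modulo the left ideal generated by the positive letters, so
  that it detects which tensors are nonzero.\<close>

definition W_eval :: "W_free_elem \<Rightarrow> usv" where
  "W_eval p = (\<Sum>a\<in>Poly_Mapping.keys p. of_int (Poly_Mapping.lookup p a) * (Abs_usv (fst a) * usv_cst (snd a)))"

lemma W_eval_add: "W_eval (p + q) = W_eval p + W_eval q"
  unfolding W_eval_def by (rule setsum_keys_plus_distrib) (simp_all add: distrib_right)

lemma W_eval_minus: "W_eval (- p) = - W_eval p"
proof (rule minus_unique[symmetric])
  show "W_eval p + W_eval (- p) = 0"
    unfolding W_eval_add[symmetric] by (simp add: W_eval_def)
qed

lemma W_eval_diff: "W_eval (p - q) = W_eval p - W_eval q"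
  using W_eval_add[of p "- q"] by (simp add: W_eval_minus)

lemma W_eval_pure: "W_eval (pure u z) = u * usv_cst z"
  by (simp add: W_eval_def pure_def keys_frag_of Rep_usv_inverse)

lemma W_eval_kernel:
  assumes "p \<in> W_kernel" shows "W_eval p \<in> positive_ideal"
proof -
  have J: "left_ideal positive_ideal" by (rule left_ideal_left_hull)
  show ?thesis
    using assms
  proof (induction rule: W_kernel_induct)
    case zero
    then show ?case by (simp add: W_eval_def left_idealD(1)[OF J])
  next
    case (rel r)
    then show ?case
      unfolding W_rels_def
    proof (elim UnE CollectE exE conjE)
      fix u v z assume r: "r = pure (u + v) z - pure u z - pure v z"
      show ?thesis unfolding r W_eval_diff W_eval_pure by (simp add: distrib_right left_idealD(1)[OF J])
    next
      fix u y z assume r: "r = pure u (y + z) - pure u y - pure u z"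
      show ?thesis unfolding r W_eval_diff W_eval_pure usv_cst_add by (simp add: distrib_left left_idealD(1)[OF J])
    next
      fix u p z assume r: "r = pure (u * usv_class p) z - pure u (Poly_Mapping.lookup p 0 * z)"
        and p: "p \<in> plus_polys"
      let ?d = "usv_class p - usv_cst (Poly_Mapping.lookup p 0)"
      have "W_eval r = u * (?d * usv_cst z)"
        unfolding r W_eval_diff W_eval_pure usv_cst_mult by (simp add: left_diff_distrib right_diff_distrib mult.assoc)
      also have "\<dots> = (u * usv_cst z) * ?d" unfolding usv.cst_central[of ?d z] by (simp only: mult.assoc)
      finally show ?thesis using left_idealD(3)[OF J usv_class_augmentation[OF p]] by simp
    qed
  next
    case (minus r)
    then show ?case using left_idealD(4)[OF J] by (simp add: W_eval_minus)
  next
    case (add p q)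
    then show ?case using left_idealD(2)[OF J] by (simp add: W_eval_add)
  qed
qed

text \<open>The left ideal generated by the positive letters annihilates \<open>1 \<otimes> 1\<close> by the balancing relations;
  conversely the evaluation map carries the relations into this ideal.\<close>

theorem W_mod_presentation:
  assumes \<psi>: "\<forall>x\<in>sv_plus. \<psi> x = 0"
  shows "cyclic_presentation (W_mod \<psi>) (W_gen \<psi>) positive_ideal"
proof -
  interpret W: sv_module "W_mod \<psi>" using left_module_W[OF \<psi>] by unfold_locales
  have w: "W_gen \<psi> \<in> carrier (W_mod \<psi>)"
    unfolding W_mod_simps[OF \<psi>] using pure_in_W_free by blast
  have act_gen: "act (W_mod \<psi>) u (W_gen \<psi>) = W_coset (pure u 1)" for u
    unfolding W_mod_simps[OF \<psi>] W_act_coset[OF \<psi> pure_in_W_free] by simp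
  have "carrier (W_mod \<psi>) = {act (W_mod \<psi>) u (W_gen \<psi>) | u. True}"
    unfolding act_gen W_mod_simps(1)[OF \<psi>]
    using exists_pure pure_in_W_free by (auto simp: W_coset_eq simp del: carrier_free_Abelian_group_iff)
  moreover have "act (W_mod \<psi>) u (W_gen \<psi>) = \<zero>\<^bsub>W_mod \<psi>\<^esub> \<longleftrightarrow> u \<in> positive_ideal" for u
  proof
    assume "act (W_mod \<psi>) u (W_gen \<psi>) = \<zero>\<^bsub>W_mod \<psi>\<^esub>"
    then have "pure u 1 \<in> W_kernel" unfolding act_gen W_mod_simps(2)[OF \<psi>] W_coset_eq by simp
    then have "u * usv_cst 1 \<in> positive_ideal" using W_eval_kernel W_eval_pure by metis
    then show "u \<in> positive_ideal" by (simp add: usv.cst_1)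
  next
    have "positive_ideal \<subseteq> {u. act (W_mod \<psi>) u (W_gen \<psi>) = \<zero>\<^bsub>W_mod \<psi>\<^esub>}"
    proof (rule left_hull_minimal[OF W.annihilator_left_ideal[OF w]], rule subsetI)
      fix x assume "x \<in> usv.positive_letters"
      then obtain a where a: "x = usv_basis a" "key a \<ge> 2"
        unfolding usv.positive_letters_def by force
      let ?p = "nc_var (Poly_Mapping.single a 1) :: sv nc_poly"
      have "?p \<in> plus_polys"
        using a(2) by (intro nc_var_in_free_alg) (simp add: sv_plus_iff)
      then have "pure (1 * usv_class ?p) 1 - pure 1 (Poly_Mapping.lookup ?p 0 * 1) \<in> W_kernel"
        by (rule pure_balanced)
      then have "pure x 1 - pure 1 0 \<in> W_kernel" by (simp add: a(1) usv_var_def)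
      moreover have "- (pure 1 (0 + 0) - pure 1 0 - pure 1 0) \<in> W_kernel" by (intro W_kernel_closed pure_add_right)
      ultimately have "(pure x 1 - pure 1 0) + pure 1 0 \<in> W_kernel" by (intro W_kernel_closed(2)) simp_all
      then show "x \<in> {u. act (W_mod \<psi>) u (W_gen \<psi>) = \<zero>\<^bsub>W_mod \<psi>\<^esub>}"
        unfolding mem_Collect_eq act_gen W_mod_simps(2)[OF \<psi>] W_coset_eq by simp
    qed
    then show "u \<in> positive_ideal \<Longrightarrow> act (W_mod \<psi>) u (W_gen \<psi>) = \<zero>\<^bsub>W_mod \<psi>\<^esub>" by blast
  qed
  ultimately show ?thesis using w left_module_W[OF \<psi>] unfolding cyclic_presentation_def by blast
qed

section \<open>The filtration\<close>

abbreviation shifted_L0 :: "complex \<Rightarrow> usv" where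
  "shifted_L0 \<zeta> \<equiv> usv_var (sv_L 0) - usv_cst \<zeta>"

abbreviation shifted_M0 :: "complex \<Rightarrow> usv" where
  "shifted_M0 \<xi> \<equiv> usv_var (sv_M 0) - usv_cst \<xi>"

lemma mem_multiples_plus_iff:
  fixes h :: "'u::ring_1"
  shows "u \<in> {a * h + k | a k. k \<in> K} \<longleftrightarrow> (\<exists>a. u - a * h \<in> K)"
proof
  assume "\<exists>a. u - a * h \<in> K"
  then obtain a where "u - a * h \<in> K" ..
  moreover have "u = a * h + (u - a * h)" by simp
  ultimately show "u \<in> {a * h + k | a k. k \<in> K}" by blast
next
  assume "u \<in> {a * h + k | a k. k \<in> K}"
  then obtain a k where "u = a * h + k" "k \<in> K" by blast
  then show "\<exists>a. u - a * h \<in> K" by (intro exI[of _ a]) simp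
qed

lemma shifted_M0_central: "shifted_M0 \<xi> * u = u * shifted_M0 \<xi>"
  by (simp add: left_diff_distrib right_diff_distrib usv.M_zero_central usv.cst_central[of u])

lemma whittaker_ideal_eq:
  "usv.whittaker_ideal \<xi> = {a * shifted_M0 \<xi> + k | a k. k \<in> positive_ideal}"
proof
  let ?S = "{a * shifted_M0 \<xi> + k | a k. k \<in> positive_ideal}"
  have J: "left_ideal positive_ideal" by (rule left_ideal_left_hull)
  show "usv.whittaker_ideal \<xi> \<subseteq> ?S"
    unfolding usv.whittaker_ideal_def
  proof (rule left_hull_minimal[OF left_ideal_add_multiples[OF J]], intro insert_subsetI subsetI)
    show "shifted_M0 \<xi> \<in> ?S"
      using left_idealD(1)[OF J] by (intro CollectI exI[of _ 1] exI[of _ 0]) simp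
    fix x assume "x \<in> usv.positive_letters"
    then have "x \<in> positive_ideal" by (rule subsetD[OF left_hull_superset])
    then show "x \<in> ?S" by (intro CollectI exI[of _ 0] exI[of _ x]) simp
  qed
  have W: "left_ideal (usv.whittaker_ideal \<xi>)" by (rule usv.left_ideal_whittaker)
  have sup: "insert (shifted_M0 \<xi>) usv.positive_letters \<subseteq> usv.whittaker_ideal \<xi>"
    unfolding usv.whittaker_ideal_def by (rule left_hull_superset)
  have "positive_ideal \<subseteq> usv.whittaker_ideal \<xi>"
    using sup by (intro left_hull_minimal[OF W]) simp
  then show "?S \<subseteq> usv.whittaker_ideal \<xi>"
    using sup by (auto intro!: left_idealD(2)[OF W] left_idealD(3)[OF W])
qed

text \<open>The image of \<open>M\<^sub>0 - \<xi>\<close> is a submodule because \<open>M\<^sub>0\<close> is central; dividing by it enlarges the annihilator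
  of the generator by the multiples of \<open>M\<^sub>0 - \<xi>\<close>.\<close>

theorem L_mod_presentation:
  assumes \<psi>: "\<forall>x\<in>sv_plus. \<psi> x = 0"
  shows "cyclic_presentation (L_mod \<psi> \<xi>) (L_gen \<psi> \<xi>) (usv.whittaker_ideal \<xi>)"
proof -
  note P = W_mod_presentation[OF \<psi>]
  interpret W: sv_module "W_mod \<psi>" by (rule cyclic_presentationD[OF P])
  have w: "W_gen \<psi> \<in> carrier (W_mod \<psi>)" by (rule cyclic_presentationD[OF P])
  have image: "M0_image \<psi> \<xi> = act (W_mod \<psi>) (shifted_M0 \<xi>) ` carrier (W_mod \<psi>)"
    unfolding M0_image_def act_def Usv_elem_Rep Usv_const_Rep Rep_usv_simps ..
  have sub: "submodule (M0_image \<psi> \<xi>) Usv (W_mod \<psi>)"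
    unfolding image
  proof (rule W.submoduleI)
    show "\<zero>\<^bsub>W_mod \<psi>\<^esub> \<in> act (W_mod \<psi>) (shifted_M0 \<xi>) ` carrier (W_mod \<psi>)"
      using W.act_zero_right[of "shifted_M0 \<xi>"] by (metis W.zero_closed imageI)
  next
    fix x y assume "x \<in> act (W_mod \<psi>) (shifted_M0 \<xi>) ` carrier (W_mod \<psi>)"
      "y \<in> act (W_mod \<psi>) (shifted_M0 \<xi>) ` carrier (W_mod \<psi>)"
    then obtain x' y' where "x = act (W_mod \<psi>) (shifted_M0 \<xi>) x'" "x' \<in> carrier (W_mod \<psi>)"
      "y = act (W_mod \<psi>) (shifted_M0 \<xi>) y'" "y' \<in> carrier (W_mod \<psi>)" by blast
    then show "x \<oplus>\<^bsub>W_mod \<psi>\<^esub> y \<in> act (W_mod \<psi>) (shifted_M0 \<xi>) ` carrier (W_mod \<psi>)"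
      by (intro image_eqI[of _ _ "x' \<oplus>\<^bsub>W_mod \<psi>\<^esub> y'"]) (simp_all add: W.act_add_right)
  next
    fix u x assume "x \<in> act (W_mod \<psi>) (shifted_M0 \<xi>) ` carrier (W_mod \<psi>)"
    then obtain x' where x': "x = act (W_mod \<psi>) (shifted_M0 \<xi>) x'" "x' \<in> carrier (W_mod \<psi>)" by blast
    have "act (W_mod \<psi>) u x = act (W_mod \<psi>) (shifted_M0 \<xi>) (act (W_mod \<psi>) u x')"
      unfolding x'(1) W.act_mult[OF x'(2), symmetric] shifted_M0_central ..
    then show "act (W_mod \<psi>) u x \<in> act (W_mod \<psi>) (shifted_M0 \<xi>) ` carrier (W_mod \<psi>)"
      using x'(2) by blast
  qed auto
  have "{u. act (W_mod \<psi>) u (W_gen \<psi>) \<in> M0_image \<psi> \<xi>} = usv.whittaker_ideal \<xi>"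
  proof -
    have "act (W_mod \<psi>) u (W_gen \<psi>) \<in> M0_image \<psi> \<xi> \<longleftrightarrow> u \<in> usv.whittaker_ideal \<xi>" for u
    proof -
      have "act (W_mod \<psi>) u (W_gen \<psi>) \<in> M0_image \<psi> \<xi>
          \<longleftrightarrow> (\<exists>a. act (W_mod \<psi>) u (W_gen \<psi>) = act (W_mod \<psi>) (shifted_M0 \<xi>) (act (W_mod \<psi>) a (W_gen \<psi>)))"
        unfolding image cyclic_presentationD(3)[OF P] by blast
      also have "\<dots> \<longleftrightarrow> (\<exists>a. u - a * shifted_M0 \<xi> \<in> positive_ideal)"
        unfolding W.act_mult[OF w, symmetric] shifted_M0_central cyclic_presentationD(5)[OF P] ..
      also have "\<dots> \<longleftrightarrow> u \<in> usv.whittaker_ideal \<xi>"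
        unfolding whittaker_ideal_eq by (rule mem_multiples_plus_iff[symmetric])
      finally show ?thesis .
    qed
    then show ?thesis by blast
  qed
  then show ?thesis
    using cyclic_presentation_quot[OF P sub] by (simp add: L_mod_def L_gen_def)
qed

lemma multiples_in_verma_ideal:
  assumes V: "cyclic_presentation V w (usv.whittaker_ideal \<xi>)"
  shows "act V u w \<in> {act V v (act V (shifted_L0 \<zeta>) w) | v. True} \<longleftrightarrow> u \<in> usv.verma_ideal \<xi> \<zeta>"
proof -
  interpret V: sv_module V by (rule cyclic_presentationD[OF V])
  have w: "w \<in> carrier V" by (rule cyclic_presentationD[OF V])
  have "act V u w \<in> {act V v (act V (shifted_L0 \<zeta>) w) | v. True}
      \<longleftrightarrow> (\<exists>v. u - v * shifted_L0 \<zeta> \<in> usv.whittaker_ideal \<xi>)"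
    unfolding V.act_mult[OF w, symmetric] cyclic_presentationD(5)[OF V, symmetric] by blast
  also have "\<dots> \<longleftrightarrow> u \<in> usv.verma_ideal \<xi> \<zeta>"
    unfolding usv.verma_ideal_eq by (rule mem_multiples_plus_iff[symmetric])
  finally show ?thesis .
qed

text \<open>A submodule that is larger contains \<open>p w\<close> for some \<open>p\<close> outside the Verma ideal, hence \<open>q p w\<close>, which is \<open>w\<close>
  modulo the given submodule.\<close>

lemma maximal_submodule_shifted:
  assumes V: "cyclic_presentation V w (usv.whittaker_ideal \<xi>)" and \<xi>: "\<xi> \<noteq> 0"
  shows "maximal_submodule Usv V {act V v (act V (shifted_L0 \<zeta>) w) | v. True}"
proof -
  interpret V: sv_module V by (rule cyclic_presentationD[OF V])
  have w: "w \<in> carrier V" by (rule cyclic_presentationD[OF V])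
  let ?N = "{act V v (act V (shifted_L0 \<zeta>) w) | v. True}"
  note N_iff = multiples_in_verma_ideal[OF V, of _ \<zeta>]
  have "submodule ?N Usv V" using w by (intro V.submodule_cyclic) simp
  moreover have "?N \<noteq> carrier V"
  proof
    assume "?N = carrier V"
    then have "act V 1 w \<in> ?N" using w by simp
    then show False using one_not_in_verma_ideal unfolding N_iff by blast
  qed
  moreover have "K = carrier V" if K: "submodule K Usv V" and NK: "?N \<subseteq> K" and "K \<noteq> ?N" for K
  proof -
    note Kcl = V.submoduleD[OF K]
    obtain x where x: "x \<in> K" "x \<notin> ?N" using NK \<open>K \<noteq> ?N\<close> by blast
    have "x \<in> carrier V" using x(1) Kcl(1) by blast
    then obtain p where p: "x = act V p w" using cyclic_presentationD(3)[OF V] by blast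
    have "p \<notin> usv.verma_ideal \<xi> \<zeta>" using x(2) unfolding p N_iff .
    then obtain q where "q * p - 1 \<in> usv.verma_ideal \<xi> \<zeta>" using usv.verma_ideal_maximal[OF \<xi>] by blast
    then have "act V (q * p - 1) w \<in> ?N" unfolding N_iff .
    then have "act V (q * p - 1) w \<in> K" by (rule subsetD[OF NK])
    moreover have "act V (q * p) w \<in> K"
      unfolding V.act_mult[OF w] using Kcl(4)[OF x(1)] by (simp add: p)
    ultimately have "act V (q * p) w \<ominus>\<^bsub>V\<^esub> act V (q * p - 1) w \<in> K" by (intro V.submodule_minus[OF K])
    then have "w \<in> K" unfolding V.act_diff[OF w, symmetric] using w by simp
    show ?thesis
    proof (intro equalityI Kcl(1) subsetI)
      fix y assume "y \<in> carrier V"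
      then obtain u where "y = act V u w" using cyclic_presentationD(3)[OF V] by blast
      then show "y \<in> K" using Kcl(4)[OF \<open>w \<in> K\<close>] by simp
    qed
  qed
  ultimately show ?thesis unfolding maximal_submodule_def by blast
qed

lemma quot_shifted_presentation:
  assumes V: "cyclic_presentation V w (usv.whittaker_ideal \<xi>)"
  shows "\<exists>v. cyclic_presentation (quot_module V {act V v (act V (shifted_L0 \<zeta>) w) | v. True}) v (usv.verma_ideal \<xi> \<zeta>)"
proof -
  interpret V: sv_module V by (rule cyclic_presentationD[OF V])
  have w: "w \<in> carrier V" by (rule cyclic_presentationD[OF V])
  have "submodule {act V v (act V (shifted_L0 \<zeta>) w) | v. True} Usv V"
    using w by (intro V.submodule_cyclic) simp
  from cyclic_presentation_quot[OF V this] show ?thesis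
    unfolding multiples_in_verma_ideal[OF V] Collect_mem_eq by blast
qed

lemma Usv_shifted_L0_power:
  "(Usv_elem (sv_L 0) \<ominus>\<^bsub>Usv\<^esub> Usv_const \<zeta>) [^]\<^bsub>Usv\<^esub> (i::nat) = Rep_usv (shifted_L0 \<zeta> ^ i)"
proof (induction i)
  case (Suc i)
  then show ?case
    unfolding Usv.nat_pow_Suc Usv_elem_Rep Usv_const_Rep Rep_usv_simps(6)[symmetric]
    by (simp only: Rep_usv_simps(4)[symmetric] power_Suc2)
qed (simp add: Rep_usv_simps)

lemma shifted_L0_power_cancel:
  assumes "\<xi> \<noteq> 0"
  shows "u * shifted_L0 \<zeta> ^ i \<in> usv.whittaker_ideal \<xi> \<longleftrightarrow> u \<in> usv.whittaker_ideal \<xi>"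
proof (induction i)
  case (Suc i)
  have "u * shifted_L0 \<zeta> ^ i * shifted_L0 \<zeta> \<in> usv.whittaker_ideal \<xi>
      \<longleftrightarrow> u * shifted_L0 \<zeta> ^ i \<in> usv.whittaker_ideal \<xi>"
    using usv.whittaker_ideal_right_cancel[OF assms one_not_in_verma_ideal] usv.whittaker_ideal_right_mult by blast
  then show ?case using Suc by (simp only: power_Suc2 mult.assoc)
qed simp

theorem theorem5p7:
  fixes \<psi> :: "sv \<Rightarrow> complex" and \<xi> :: complex
  assumes "sv_plus_hom \<psi>" and "\<forall>x\<in>sv_plus. \<psi> x = 0" and "\<xi> \<noteq> 0"
  shows "(\<forall>\<zeta>. V_fil \<psi> \<xi> \<zeta> 0 = carrier (L_mod \<psi> \<xi>) \<and>
            (\<forall>i. V_fil \<psi> \<xi> \<zeta> (Suc i) \<subseteq> V_fil \<psi> \<xi> \<zeta> i \<and>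
                 submodule (V_fil \<psi> \<xi> \<zeta> i) Usv (L_mod \<psi> \<xi>) \<and>
                 whittaker_module \<psi> (V_mod \<psi> \<xi> \<zeta> i) \<and>
                 maximal_submodule Usv (V_mod \<psi> \<xi> \<zeta> i) (V_fil \<psi> \<xi> \<zeta> (Suc i)) \<and>
                 module_iso Usv (quot_module (V_mod \<psi> \<xi> \<zeta> i) (V_fil \<psi> \<xi> \<zeta> (Suc i)))
                   (verma \<xi> \<zeta>))) \<and>
         (\<forall>\<zeta> i. module_iso Usv (L_mod \<psi> \<xi>) (V_mod \<psi> \<xi> \<zeta> i))"
proof -
  let ?L = "L_mod \<psi> \<xi>" and ?w = "L_gen \<psi> \<xi>" and ?J = "usv.whittaker_ideal \<xi>"
  have L: "cyclic_presentation ?L ?w ?J" by (rule L_mod_presentation[OF assms(2)])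
  interpret L: sv_module ?L by (rule cyclic_presentationD[OF L])
  have w: "?w \<in> carrier ?L" by (rule cyclic_presentationD[OF L])
  let ?g = "\<lambda>\<zeta> i. act ?L (shifted_L0 \<zeta> ^ i) ?w"
  have fil: "V_fil \<psi> \<xi> \<zeta> i = {act ?L u (?g \<zeta> i) | u. True}" for \<zeta> i
    unfolding V_fil_def Usv_shifted_L0_power act_def carrier_Usv by blast
  \<comment> \<open>Cancelling powers of \<open>L\<^sub>0 - \<zeta>\<close> shows that all generators have the same annihilator.\<close>
  have V: "cyclic_presentation (V_mod \<psi> \<xi> \<zeta> i) (?g \<zeta> i) ?J" for \<zeta> i
    using cyclic_presentation_submodule[OF L, of "shifted_L0 \<zeta> ^ i"]
    unfolding V_mod_def fil shifted_L0_power_cancel[OF assms(3)] Collect_mem_eq .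
  have act_V: "act (V_mod \<psi> \<xi> \<zeta> i) = act ?L" for \<zeta> i
    by (intro ext) (simp add: act_def V_mod_def)
  have Suc: "V_fil \<psi> \<xi> \<zeta> (Suc i) = {act (V_mod \<psi> \<xi> \<zeta> i) v (act (V_mod \<psi> \<xi> \<zeta> i) (shifted_L0 \<zeta>) (?g \<zeta> i)) | v. True}" for \<zeta> i
    unfolding fil act_V by (simp only: L.act_mult[OF w, symmetric] power_Suc)
  have sub: "submodule (V_fil \<psi> \<xi> \<zeta> i) Usv ?L" for \<zeta> i
    unfolding fil using w by (intro L.submodule_cyclic) simp
  have zero: "V_fil \<psi> \<xi> \<zeta> 0 = carrier ?L" for \<zeta>
    unfolding fil using w cyclic_presentationD(3)[OF L] by simp
  have le: "V_fil \<psi> \<xi> \<zeta> (Suc i) \<subseteq> V_fil \<psi> \<xi> \<zeta> i" for \<zeta> i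
  proof
    fix x assume "x \<in> V_fil \<psi> \<xi> \<zeta> (Suc i)"
    then obtain v where "x = act ?L v (act ?L (shifted_L0 \<zeta>) (?g \<zeta> i))" unfolding Suc act_V by blast
    then have "x = act ?L (v * shifted_L0 \<zeta>) (?g \<zeta> i)" using w by (simp add: L.act_mult)
    then show "x \<in> V_fil \<psi> \<xi> \<zeta> i" unfolding fil by blast
  qed
  have whittaker: "whittaker_module \<psi> (V_mod \<psi> \<xi> \<zeta> i)" for \<zeta> i
  proof -
    interpret V: sv_module "V_mod \<psi> \<xi> \<zeta> i" by (rule cyclic_presentationD[OF V])
    have g: "?g \<zeta> i \<in> carrier (V_mod \<psi> \<xi> \<zeta> i)" by (rule cyclic_presentationD[OF V])
    have "act (V_mod \<psi> \<xi> \<zeta> i) (usv_var x) (?g \<zeta> i) = act (V_mod \<psi> \<xi> \<zeta> i) (usv_cst (\<psi> x)) (?g \<zeta> i)"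
      if "x \<in> sv_plus" for x
    proof -
      have "usv_var x = 0 * shifted_M0 \<xi> + usv_var x" by simp
      then have "usv_var x \<in> ?J" unfolding whittaker_ideal_eq using usv_var_sv_plus[OF that] by blast
      moreover have "usv_cst (\<psi> x) = 0" using assms(2) that usv.cst_0 by simp
      ultimately show ?thesis unfolding cyclic_presentationD(5)[OF V] by simp
    qed
    then have "whittaker_vector \<psi> (V_mod \<psi> \<xi> \<zeta> i) (?g \<zeta> i)"
      using g unfolding whittaker_vector_def Usv_elem_Rep Usv_const_Rep act_def by blast
    moreover have "gen_submodule Usv (V_mod \<psi> \<xi> \<zeta> i) {?g \<zeta> i} = carrier (V_mod \<psi> \<xi> \<zeta> i)"
      unfolding V.gen_submodule_single[OF g] cyclic_presentationD(3)[OF V] ..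
    ultimately show ?thesis
      unfolding whittaker_module_def using V.left_module by blast
  qed
  have max: "maximal_submodule Usv (V_mod \<psi> \<xi> \<zeta> i) (V_fil \<psi> \<xi> \<zeta> (Suc i))" for \<zeta> i
    unfolding Suc by (rule maximal_submodule_shifted[OF V assms(3)])
  have quot: "module_iso Usv (quot_module (V_mod \<psi> \<xi> \<zeta> i) (V_fil \<psi> \<xi> \<zeta> (Suc i))) (verma \<xi> \<zeta>)" for \<zeta> i
  proof -
    let ?L0 = "L_mod (\<lambda>_. 0) \<xi>" and ?w0 = "L_gen (\<lambda>_. 0) \<xi>"
    have L0: "cyclic_presentation ?L0 ?w0 ?J" by (rule L_mod_presentation) simp
    interpret L0: sv_module ?L0 by (rule cyclic_presentationD[OF L0])
    have w0: "?w0 \<in> carrier ?L0" by (rule cyclic_presentationD[OF L0])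
    have "verma \<xi> \<zeta> = quot_module ?L0 (gen_submodule Usv ?L0 {act ?L0 (shifted_L0 \<zeta>) ?w0})"
      unfolding verma_def act_def Usv_elem_Rep Usv_const_Rep Rep_usv_simps ..
    also have "\<dots> = quot_module ?L0 {act ?L0 v (act ?L0 (shifted_L0 \<zeta>) ?w0) | v. True}"
      using w0 by (simp add: L0.gen_submodule_single)
    finally obtain v0 where "cyclic_presentation (verma \<xi> \<zeta>) v0 (usv.verma_ideal \<xi> \<zeta>)"
      using quot_shifted_presentation[OF L0, of \<zeta>] by auto
    moreover obtain v where "cyclic_presentation (quot_module (V_mod \<psi> \<xi> \<zeta> i) (V_fil \<psi> \<xi> \<zeta> (Suc i))) v (usv.verma_ideal \<xi> \<zeta>)"
      using quot_shifted_presentation[OF V[of \<zeta> i], of \<zeta>] unfolding Suc by blast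
    ultimately show ?thesis by (intro cyclic_presentation_iso)
  qed
  have iso: "module_iso Usv ?L (V_mod \<psi> \<xi> \<zeta> i)" for \<zeta> i
    by (rule cyclic_presentation_iso[OF L V])
  show ?thesis using zero le sub whittaker max quot iso by (intro conjI allI)
qed

end
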